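(* Let $M$ be a projective manifold of dimension $d$. For arbitrary $n$ and $\lambda$, the formula $$\widehat\Pi^{\|a_{ij}\|}_\lambda(\Delta)=\sum_{i=0}^n\frac{P_i(\widehat w)}{P_i(\lambda)}\,\widehat\Pi^{\rm DLO}_\lambda(\Delta_{n-i})=\widehat\Pi^{\rm DLO}_\lambda(\Delta_n)+\frac{a_{10}+a_{11}\widehat w}{a_{10}+a_{11}\lambda}\widehat\Pi^{\rm DLO}_\lambda(\Delta_{n-1})+\frac{a_{20}+a_{21}\widehat w+a_{22}\widehat w^2}{a_{20}+a_{21}\lambda+a_{22}\lambda^2}\widehat\Pi^{\rm DLO}_\lambda(\Delta_{n-2})+\dots\qquad(\ddagger)$$ describes the family of regular $\mathrm{proj}(M)$-equivariant pencil liftings of operators in $\mathcal D^{(n)}_\lambda(M)$. Here $\Delta=\Delta_n+\Delta_{n-1}+\dots+\Delta_0$ is the canonical decomposition of $\Delta\in\mathcal D^{(n)}_\lambda(M)$, $\|a_{ij}\|_{i,j=0,\dots,n}$ is an arbitrary lower triangular matrix of numbers ($a_{ij}=0$ if $j>i$) with a nonzero element in every row, and $P_i(\mu)=\sum_j a_{ij}\mu^j$. The liftings $(\ddagger)$ are all the regular $\mathrm{proj}(M)$-equivariant pencil liftings of $\mathcal D^{(n)}_\lambda(M)$.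
   Context: Densities and operators. $\mathcal F_\lambda(M)$ is the space of densities $s(x)|Dx|^\lambda$ of weight $\lambda\in\mathbb R$ on $M$; $\mathcal F(M)=\bigoplus_\lambda\mathcal F_\lambda(M)$ is the algebra of densities, with weight operator $\widehat w(\boldsymbol s)=\lambda\boldsymbol s$ for $\boldsymbol s\in\mathcal F_\lambda(M)$. $\mathcal D^{(n)}_\lambda(M)$ is the space of linear differential operators of order $\le n$ from $\mathcal F_\lambda(M)$ to $\mathcal F_\lambda(M)$. $\mathcal D^{(n)}(\widehat M)$ is the space of weight-zero (mapping each $\mathcal F_\mu(M)$ to itself) differential operators of order $\le n$ on the algebra $\mathcal F(M)$, where order zero means multiplication by a density and $L$ has order $\le k+1$ if its commutator with multiplication by any density has order $\le k$; in particular $\widehat w$ has order 1. An operator $\widehat\Delta$ on $\mathcal F(M)$ is identified with the pencil (depending polynomially on $\mu$) of its restrictions $\widehat\Delta|_{\widehat w=\mu}$ to $\mathcal F_\mu(M)$. Pencil liftings. A pencil lifting of $\mathcal D^{(n)}_\lambda(M)$ is a map $\widehat\Pi$ assigning to each $\Delta\in\mathcal D^{(n)}_\lambda(M)$ an operator (pencil) $\widehat\Pi(\Delta)$ on $\mathcal F(M)$ passing through it: $\widehat\Pi(\Delta)|_{\widehat w=\lambda}=\Delta$. It is regular if it takes values in $\mathcal D^{(n)}(\widehat M)$. It is equivariant with respect to a Lie algebra $\mathcal G$ of vector fields on $M$ if $\mathrm{ad}_{\mathbf K}(\widehat\Pi(\Delta))=\widehat\Pi(\mathrm{ad}_{\mathbf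 K}\Delta)$ for all $\mathbf K\in\mathcal G$, where $\mathrm{ad}_{\mathbf K}(\Delta)\boldsymbol s=\mathcal L_{\mathbf K}(\Delta\boldsymbol s)-\Delta(\mathcal L_{\mathbf K}\boldsymbol s)$ and $\mathcal L_{\mathbf K}$ is the Lie derivative of densities. Projective structure. A projective manifold of dimension $d$ is one that is locally a projective space $\mathbb RP^d$: it has local projective coordinates $x^1,\dots,x^d$, any two such systems being related by fractional-linear transformations $x^{i'}=(a^i_jx^j+b^i)/(c_kx^k+e)$. In local projective coordinates the Lie algebra $\mathrm{proj}(M)$ is generated by the vector fields $\partial_i$, $x^k\partial_i$, $x^k\sum_i x^i\partial_i$. Without loss of generality one takes $M=\mathbb R^d$ with Cartesian coordinates $x^i$, and the formulas below are written in these coordinates. Full symbol map and quantisation (Lecomte–Ovsienko). For each $\mu$ there is a unique $\mathrm{proj}$-equivariant full symbol map $\sigma_\mu$: a linear map from differential operators on $\mathcal F_\mu$ to functions on $T^*M$ polynomial in the momenta $\xi_i$ (symmetric contravariant tensor fields), such that for $\Delta$ of order $\le k$, $\sigma_\mu(\Delta)$ is the order-$k$ principal symbol $S^{i_1\dots i_k}\xi_{i_1}\cdots\xi_{i_k}$ plus terms of degree $<k$ in $\xi$. Its inverse $Q_\mu=\sigma_\mu^{-1}$ has the form $$Q_\mu(S^{i_1\dots i_k}\xi_{i_1}\cdots\xi_{i_k})=\sum_{r=0}^k\tilde c^{(k)}_r(\mu)\,\big(\partial_{j_1}\cdots\partial_{j_r}S^{j_1\dots j_ri_1\dots i_{k-r}}\big)\partial_{i_1}\cdots\partial_{i_{k-r}},$$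 with $\tilde c^{(k)}_0=1$ and $\tilde c^{(k)}_r$ polynomials in $\mu$. DLO-pencil lifting. $\widehat\Pi^{\rm DLO}_\lambda(\Delta)|_{\widehat w=\mu}=Q_\mu(\sigma_\lambda(\Delta))$ for all $\mu$. Canonical decomposition. For $\Delta\in\mathcal D^{(n)}_\lambda(M)$, $\Delta_n=Q_\lambda(\text{order-}n\text{ principal symbol of }\Delta)$, and inductively $\Delta_{n-k}=Q_\lambda(\text{order-}(n-k)\text{ principal symbol of }\Delta-\Delta_n-\dots-\Delta_{n-k+1})$; then $\Delta=\Delta_n+\dots+\Delta_0$. Two matrices whose corresponding rows are all proportional give the same lifting; the paper describes the family as parameterised by $\mathbb RP^1\times\mathbb RP^2\times\dots\times\mathbb RP^n$.
   Formalization: Pencil liftings are taken to be linear maps (for arbitrary maps the claim that all liftings have the form (‡) fails), and the matrix must satisfy P_i(λ) ≠ 0 for every i so that (‡) is defined; M is R^d as in the stated reduction. *)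

theory Defs
  imports "HOL-Analysis.Analysis" "HOL-Library.Poly_Mapping"
begin

section \<open>Smooth functions on Euclidean space\<close>

definition pderiv_at :: "'d::finite \<Rightarrow> (real ^ 'd \<Rightarrow> real) \<Rightarrow> real ^ 'd \<Rightarrow> real" where
  "pderiv_at i f x = frechet_derivative f (at x) (axis i 1)"

primrec pderivs_at :: "'d::finite list \<Rightarrow> (real ^ 'd \<Rightarrow> real) \<Rightarrow> real ^ 'd \<Rightarrow> real" where
  "pderivs_at [] f = f"
| "pderivs_at (i # is) f = pderivs_at is (pderiv_at i f)"

text \<open>All iterated partial derivatives exist and are (Frechet) differentiable, hence continuous.\<close>

definition smooth :: "(real ^ 'd::finite \<Rightarrow> real) \<Rightarrow> bool" where
  "smooth f \<longleftrightarrow> (\<forall>is x. pderivs_at is f differentiable (at x))"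

lemma smooth_differentiable: "smooth f \<Longrightarrow> f differentiable (at x)"
  unfolding smooth_def by (metis pderivs_at.simps(1))

lemma smooth_pderiv: "smooth f \<Longrightarrow> smooth (pderiv_at i f)"
  unfolding smooth_def by (metis pderivs_at.simps(2))

lemma pderiv_at_const: "pderiv_at i (\<lambda>x. c) = (\<lambda>x. 0)"
  by (simp add: pderiv_at_def fun_eq_iff)

lemma pderiv_at_add:
  assumes "\<And>x. f differentiable (at x)" "\<And>x. g differentiable (at x)"
  shows "pderiv_at i (\<lambda>x. f x + g x) = (\<lambda>x. pderiv_at i f x + pderiv_at i g x)"
proof
  fix x
  have "((\<lambda>x. f x + g x) has_derivative
      (\<lambda>h. frechet_derivative f (at x) h + frechet_derivative g (at x) h)) (at x)"
    using assms by (intro has_derivative_add) (auto simp: frechet_derivative_works[symmetric])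
  from frechet_derivative_at[OF this]
  show "pderiv_at i (\<lambda>x. f x + g x) x = pderiv_at i f x + pderiv_at i g x"
    unfolding pderiv_at_def by metis
qed

lemma pderiv_at_mult:
  assumes "\<And>x. f differentiable (at x)" "\<And>x. g differentiable (at x)"
  shows "pderiv_at i (\<lambda>x. f x * g x) = (\<lambda>x. f x * pderiv_at i g x + pderiv_at i f x * g x)"
proof
  fix x
  have "((\<lambda>x. f x * g x) has_derivative
      (\<lambda>h. f x * frechet_derivative g (at x) h + frechet_derivative f (at x) h * g x)) (at x)"
    using assms by (intro has_derivative_mult) (auto simp: frechet_derivative_works[symmetric])
  from frechet_derivative_at[OF this]
  show "pderiv_at i (\<lambda>x. f x * g x) x = f x * pderiv_at i g x + pderiv_at i f x * g x"
    unfolding pderiv_at_def by metis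
qed

lemma smooth_const: "smooth (\<lambda>x::real^'d::finite. c)"
proof -
  have "\<exists>c'. pderivs_at is (\<lambda>x::real^'d. c) = (\<lambda>x. c')" for "is"
    by (induction "is" arbitrary: c) (auto simp: pderiv_at_const)
  then have "pderivs_at is (\<lambda>x::real^'d. c) differentiable (at x)" for "is" x
    by (metis differentiable_const)
  then show ?thesis by (simp add: smooth_def)
qed

lemma pderivs_at_add_differentiable:
  assumes "\<And>is x. length is \<le> n \<Longrightarrow> pderivs_at is f differentiable (at x)"
    and "\<And>is x. length is \<le> n \<Longrightarrow> pderivs_at is g differentiable (at x)"
    and "length is \<le> n"
  shows "pderivs_at is (\<lambda>x. f x + g x) differentiable (at x)"
  using assms
proof (induction "is" arbitrary: f g n)
  case Nil
  from Nil(1)[of "[]"] Nil(2)[of "[]"] show ?case by simp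
next
  case (Cons i "is")
  then obtain m where m: "n = Suc m" by (cases n) auto
  from Cons.prems(1)[of "[]"] Cons.prems(2)[of "[]"]
  have eq: "pderiv_at i (\<lambda>x. f x + g x) = (\<lambda>x. pderiv_at i f x + pderiv_at i g x)"
    by (intro pderiv_at_add) simp_all
  have "pderivs_at js (pderiv_at i f) differentiable (at x)"
    "pderivs_at js (pderiv_at i g) differentiable (at x)" if "length js \<le> m" for js x
    using Cons.prems(1)[of "i # js"] Cons.prems(2)[of "i # js"] that m by auto
  from Cons.IH[OF this] Cons.prems(3) m show ?case by (simp add: eq)
qed

lemma smooth_add:
  assumes "smooth f" "smooth g" shows "smooth (\<lambda>x. f x + g x)"
  using assms pderivs_at_add_differentiable[of _ f g] unfolding smooth_def by blast

lemma smooth_mult: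
  fixes f g :: "real ^ 'a::finite \<Rightarrow> real"
  assumes "smooth f" "smooth g" shows "smooth (\<lambda>x. f x * g x)"
proof -
  have "\<forall>is x. length is \<le> n \<longrightarrow> pderivs_at is (\<lambda>x. f x * g x) differentiable (at x)" for n
    using assms
  proof (induction n arbitrary: f g)
    case 0
    then show ?case by (simp add: smooth_differentiable)
  next
    case (Suc n)
    show ?case
    proof (intro allI impI)
      fix "is" :: "'a list" and x
      assume len: "length is \<le> Suc n"
      show "pderivs_at is (\<lambda>x. f x * g x) differentiable (at x)"
      proof (cases "is")
        case Nil
        then show ?thesis using Suc.prems by (simp add: smooth_differentiable)
      next
        case (Cons i js)
        have "pderivs_at js (\<lambda>x. f x * pderiv_at i g x + pderiv_at i f x * g x)
            differentiable (at x)"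
          by (rule pderivs_at_add_differentiable[of n])
            (use Suc.IH Suc.prems len Cons in \<open>auto intro: smooth_pderiv\<close>)
        then show ?thesis
          using Cons Suc.prems by (simp add: pderiv_at_mult smooth_differentiable)
      qed
    qed
  qed
  then show ?thesis unfolding smooth_def by blast
qed

typedef (overloaded) 'd sfun = "{f :: real ^ 'd::finite \<Rightarrow> real. smooth f}"
  morphisms val Sfun
  using smooth_const by blast

setup_lifting type_definition_sfun

instantiation sfun :: (finite) "{real_algebra_1, comm_ring_1}"
begin

lift_definition zero_sfun :: "'a sfun" is "\<lambda>x. 0" by (rule smooth_const)
lift_definition one_sfun :: "'a sfun" is "\<lambda>x. 1" by (rule smooth_const)
lift_definition plus_sfun :: "'a sfun \<Rightarrow> 'a sfun \<Rightarrow> 'a sfun" is "\<lambda>f g x. f x + g x"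
  by (rule smooth_add)
lift_definition times_sfun :: "'a sfun \<Rightarrow> 'a sfun \<Rightarrow> 'a sfun" is "\<lambda>f g x. f x * g x"
  by (rule smooth_mult)
lift_definition uminus_sfun :: "'a sfun \<Rightarrow> 'a sfun" is "\<lambda>f x. - f x"
  using smooth_mult[OF smooth_const[of "-1"]] by simp
lift_definition minus_sfun :: "'a sfun \<Rightarrow> 'a sfun \<Rightarrow> 'a sfun" is "\<lambda>f g x. f x - g x"
  using smooth_add[OF _ smooth_mult[OF smooth_const[of "-1"]]] by simp
lift_definition scaleR_sfun :: "real \<Rightarrow> 'a sfun \<Rightarrow> 'a sfun" is "\<lambda>c f x. c * f x"
  by (rule smooth_mult[OF smooth_const])

instance
  by standard (transfer; simp add: algebra_simps fun_eq_iff)+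

end

lift_definition coord :: "'d::finite \<Rightarrow> 'd sfun" is "\<lambda>i x. x $ i"
proof -
  fix i :: 'd
  have "((\<lambda>x::real^'d. x $ i) has_derivative (\<lambda>h. h $ i)) (at x)" for x
    by (rule bounded_linear_imp_has_derivative) (rule bounded_linear_vec_nth)
  then have d: "(\<lambda>x::real^'d. x $ i) differentiable (at x)"
    and fd: "(\<lambda>h. h $ i) = frechet_derivative (\<lambda>x::real^'d. x $ i) (at x)" for x
    by (auto simp: differentiable_def intro: frechet_derivative_at)
  have "pderiv_at j (\<lambda>x::real^'d. x $ i) = (\<lambda>x. axis j 1 $ i)" for j
    unfolding pderiv_at_def by (rule ext) (rule fun_cong[OF fd, symmetric])
  then have "pderivs_at is (\<lambda>x::real^'d. x $ i) differentiable (at x)" for "is" x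
    using smooth_const unfolding smooth_def by (cases "is") (auto simp: d)
  then show "smooth (\<lambda>x::real^'d. x $ i)" by (simp add: smooth_def)
qed

lift_definition partial :: "'d::finite \<Rightarrow> 'd sfun \<Rightarrow> 'd sfun" is pderiv_at
  by (rule smooth_pderiv)

primrec partials :: "'d::finite list \<Rightarrow> 'd sfun \<Rightarrow> 'd sfun" where
  "partials [] f = f"
| "partials (i # is) f = partials is (partial i f)"


section \<open>The algebra of densities\<close>

text \<open>
  A density \<open>s(x) |Dx|\<^sup>\<lambda>\<close> on \<open>\<real>\<^sup>d\<close> is given by its coefficient \<open>s\<close> in Cartesian coordinates, so that
  all the spaces of densities of a fixed weight have the same carrier; the weight enters through
  the Lie derivative.  A general element is a finite sum of \<open>Poly_Mapping.single \<lambda> s\<close>, and the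
  convolution product of \<open>poly_mapping\<close> multiplies coefficients and adds weights.
\<close>

type_synonym 'd density = "real \<Rightarrow>\<^sub>0 'd sfun"

instantiation poly_mapping :: (type, real_vector) real_vector
begin

definition scaleR_poly_mapping :: "real \<Rightarrow> ('a \<Rightarrow>\<^sub>0 'b) \<Rightarrow> ('a \<Rightarrow>\<^sub>0 'b)" where
  "scaleR_poly_mapping c s = Poly_Mapping.map (scaleR c) s"

lemma lookup_scaleR: "Poly_Mapping.lookup (c *\<^sub>R s) k = c *\<^sub>R Poly_Mapping.lookup s k"
  for s :: "'a \<Rightarrow>\<^sub>0 'b"
  by (simp add: scaleR_poly_mapping_def Poly_Mapping.map.rep_eq when_def)

instance
  by standard (rule poly_mapping_eqI;
    simp add: lookup_scaleR lookup_add scaleR_add_left scaleR_add_right)+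

end

definition graded_op :: "(real \<Rightarrow> 'd sfun \<Rightarrow> 'd sfun) \<Rightarrow> 'd::finite density \<Rightarrow> 'd density" where
  "graded_op A s =
     (\<Sum>\<mu>\<in>Poly_Mapping.keys s. Poly_Mapping.single \<mu> (A \<mu> (Poly_Mapping.lookup s \<mu>)))"

definition weight_op :: "'d::finite density \<Rightarrow> 'd density" where
  "weight_op = graded_op (\<lambda>\<mu> f. \<mu> *\<^sub>R f)"

definition restrict_weight ::
    "real \<Rightarrow> ('d::finite density \<Rightarrow> 'd density) \<Rightarrow> 'd sfun \<Rightarrow> 'd sfun" where
  "restrict_weight \<mu> L f = Poly_Mapping.lookup (L (Poly_Mapping.single \<mu> f)) \<mu>"


section \<open>Differential operators\<close>

definition diff_op :: "nat \<Rightarrow> ('d::finite list \<Rightarrow> 'd sfun) \<Rightarrow> 'd sfun \<Rightarrow> 'd sfun" where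
  "diff_op n S f = (\<Sum>is | length is \<le> n. S is * partials is f)"

definition diff_ops :: "nat \<Rightarrow> ('d::finite sfun \<Rightarrow> 'd sfun) set" where
  "diff_ops n = range (diff_op n)"

primrec order_le :: "nat \<Rightarrow> ('a::comm_ring_1 \<Rightarrow> 'a) \<Rightarrow> bool" where
  "order_le 0 L \<longleftrightarrow> (\<exists>m. L = (\<lambda>s. m * s))"
| "order_le (Suc k) L \<longleftrightarrow> (\<forall>m. order_le k (\<lambda>s. L (m * s) - m * L s))"

definition weight_zero :: "('d::finite density \<Rightarrow> 'd density) \<Rightarrow> bool" where
  "weight_zero L \<longleftrightarrow>
     (\<forall>\<mu> f. \<exists>g. L (Poly_Mapping.single \<mu> f) = Poly_Mapping.single \<mu> g)"

definition polynomial_in_weight :: "('d::finite density \<Rightarrow> 'd density) \<Rightarrow> bool" where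
  "polynomial_in_weight L \<longleftrightarrow>
     (\<exists>N B. \<forall>\<mu> f. restrict_weight \<mu> L f = (\<Sum>j\<le>N. \<mu> ^ j *\<^sub>R B j f))"

definition pencils :: "('d::finite density \<Rightarrow> 'd density) set" where
  "pencils = {L. linear L \<and> weight_zero L \<and> polynomial_in_weight L}"

text \<open>
  Polynomial dependence on the weight does not follow from the order bound: for an additive
  \<open>\<phi> : \<real> \<rightarrow> \<real>\<close> that is not linear, \<open>s |Dx|\<^sup>\<mu> \<mapsto> \<phi>(\<mu>) s |Dx|\<^sup>\<mu>\<close> is a derivation of the algebra of
  densities.
\<close>

definition diff_ops_hat :: "nat \<Rightarrow> ('d::finite density \<Rightarrow> 'd density) set" where
  "diff_ops_hat n = {L \<in> pencils. order_le n L}"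


section \<open>Projective vector fields and Lie derivatives\<close>

type_synonym 'd vfield = "'d sfun ^ 'd"

text \<open>The linear span of these fields is closed under the bracket.\<close>

definition proj :: "'d::finite vfield set" where
  "proj = span
     (range (\<lambda>i. axis i 1) \<union>
      range (\<lambda>(k, i). axis i (coord k)) \<union>
      range (\<lambda>k. \<chi> i. coord k * coord i))"

definition lie_density :: "'d::finite vfield \<Rightarrow> real \<Rightarrow> 'd sfun \<Rightarrow> 'd sfun" where
  "lie_density K \<mu> f =
     (\<Sum>i\<in>UNIV. K $ i * partial i f) + \<mu> *\<^sub>R ((\<Sum>i\<in>UNIV. partial i (K $ i)) * f)"

definition lie_densities :: "'d::finite vfield \<Rightarrow> 'd density \<Rightarrow> 'd density" where
  "lie_densities K = graded_op (lie_density K)"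

definition ad_op :: "real \<Rightarrow> 'd::finite vfield \<Rightarrow> ('d sfun \<Rightarrow> 'd sfun) \<Rightarrow> 'd sfun \<Rightarrow> 'd sfun" where
  "ad_op \<mu> K D f = lie_density K \<mu> (D f) - D (lie_density K \<mu> f)"

definition ad_hat ::
    "'d::finite vfield \<Rightarrow> ('d density \<Rightarrow> 'd density) \<Rightarrow> 'd density \<Rightarrow> 'd density" where
  "ad_hat K L s = lie_densities K (L s) - L (lie_densities K s)"


section \<open>Symbols\<close>

text \<open>Functions \<open>s x \<xi>\<close> on the cotangent bundle; \<open>\<xi>\<close> is the momentum.\<close>

type_synonym 'd symbol = "real ^ 'd \<Rightarrow> real ^ 'd \<Rightarrow> real"

definition tensor_symbol :: "'d::finite list set \<Rightarrow> ('d list \<Rightarrow> 'd sfun) \<Rightarrow> 'd symbol" where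
  "tensor_symbol I S x \<xi> = (\<Sum>is\<in>I. val (S is) x * (\<Prod>i\<leftarrow>is. \<xi> $ i))"

definition symbols_below :: "nat \<Rightarrow> 'd::finite symbol set" where
  "symbols_below k = range (tensor_symbol {is. length is < k})"

definition symbols :: "'d::finite symbol set" where
  "symbols = (\<Union>k. symbols_below k)"

definition principal_symbol :: "nat \<Rightarrow> ('d::finite sfun \<Rightarrow> 'd sfun) \<Rightarrow> 'd symbol" where
  "principal_symbol k D =
     (THE s. \<exists>S. D = diff_op k S \<and> s = tensor_symbol {is. length is = k} S)"

text \<open>Lie derivative of symmetric contravariant tensors, i.e. the Poisson bracket with the
  Hamiltonian \<open>K\<^sup>i \<xi>\<^sub>i\<close>.\<close>

definition lie_symbol :: "'d::finite vfield \<Rightarrow> 'd symbol \<Rightarrow> 'd symbol" where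
  "lie_symbol K s x \<xi> =
     (\<Sum>i\<in>UNIV. val (K $ i) x * pderiv_at i (\<lambda>y. s y \<xi>) x)
     - (\<Sum>i\<in>UNIV. \<Sum>j\<in>UNIV. pderiv_at i (val (K $ j)) x * \<xi> $ j * pderiv_at i (s x) \<xi>)"

definition full_symbol_map :: "real \<Rightarrow> (('d::finite sfun \<Rightarrow> 'd sfun) \<Rightarrow> 'd symbol) \<Rightarrow> bool" where
  "full_symbol_map \<mu> \<sigma> \<longleftrightarrow>
     (\<forall>D \<in> (\<Union>k. diff_ops k). \<sigma> D \<in> symbols) \<and>
     (\<forall>D \<in> (\<Union>k. diff_ops k). \<forall>E \<in> (\<Union>k. diff_ops k). \<forall>a b.
        \<sigma> (\<lambda>f. a *\<^sub>R D f + b *\<^sub>R E f) = (\<lambda>x \<xi>. a * \<sigma> D x \<xi> + b * \<sigma> E x \<xi>)) \<and>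
     (\<forall>k. \<forall>D \<in> diff_ops k. (\<lambda>x \<xi>. \<sigma> D x \<xi> - principal_symbol k D x \<xi>) \<in> symbols_below k) \<and>
     (\<forall>K \<in> proj. \<forall>D \<in> (\<Union>k. diff_ops k). \<sigma> (ad_op \<mu> K D) = lie_symbol K (\<sigma> D))"

text \<open>The full symbol map is unique on differential operators, its values elsewhere are
  irrelevant.\<close>

definition symbol_map :: "real \<Rightarrow> ('d::finite sfun \<Rightarrow> 'd sfun) \<Rightarrow> 'd symbol" where
  "symbol_map \<mu> = (SOME \<sigma>. full_symbol_map \<mu> \<sigma>)"

definition quantisation :: "real \<Rightarrow> 'd::finite symbol \<Rightarrow> 'd sfun \<Rightarrow> 'd sfun" where
  "quantisation \<mu> = inv_into (\<Union>k. diff_ops k) (symbol_map \<mu>)"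


section \<open>Pencil liftings\<close>

definition dlo_lifting ::
    "real \<Rightarrow> ('d::finite sfun \<Rightarrow> 'd sfun) \<Rightarrow> 'd density \<Rightarrow> 'd density" where
  "dlo_lifting l D = graded_op (\<lambda>\<mu>. quantisation \<mu> (symbol_map l D))"

text \<open>\<open>canonical_part l n D k\<close> is the summand \<open>\<Delta>\<^bsub>n-k\<^esub>\<close> of an operator \<open>D = \<Delta>\<close> of order \<open>\<le> n\<close>.\<close>

fun canonical_part ::
    "real \<Rightarrow> nat \<Rightarrow> ('d::finite sfun \<Rightarrow> 'd sfun) \<Rightarrow> nat \<Rightarrow> 'd sfun \<Rightarrow> 'd sfun" where
  "canonical_part l n D k =
     quantisation l (principal_symbol (n - k) (\<lambda>f. D f - (\<Sum>j<k. canonical_part l n D j f)))"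

declare canonical_part.simps [simp del]

text \<open>A lifting is understood to be a linear map between the spaces of operators.\<close>

definition pencil_lifting ::
    "nat \<Rightarrow> real \<Rightarrow> (('d::finite sfun \<Rightarrow> 'd sfun) \<Rightarrow> 'd density \<Rightarrow> 'd density) \<Rightarrow> bool" where
  "pencil_lifting n l \<Phi> \<longleftrightarrow>
     (\<forall>D \<in> diff_ops n. \<Phi> D \<in> pencils \<and> restrict_weight l (\<Phi> D) = D) \<and>
     (\<forall>D \<in> diff_ops n. \<forall>E \<in> diff_ops n. \<forall>a b.
        \<Phi> (\<lambda>f. a *\<^sub>R D f + b *\<^sub>R E f) = (\<lambda>s. a *\<^sub>R \<Phi> D s + b *\<^sub>R \<Phi> E s))"

definition regular_lifting ::
    "nat \<Rightarrow> (('d::finite sfun \<Rightarrow> 'd sfun) \<Rightarrow> 'd density \<Rightarrow> 'd density) \<Rightarrow> bool" where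
  "regular_lifting n \<Phi> \<longleftrightarrow> (\<forall>D \<in> diff_ops n. \<Phi> D \<in> diff_ops_hat n)"

definition equivariant_lifting ::
    "'d::finite vfield set \<Rightarrow> nat \<Rightarrow> real \<Rightarrow>
     (('d sfun \<Rightarrow> 'd sfun) \<Rightarrow> 'd density \<Rightarrow> 'd density) \<Rightarrow> bool" where
  "equivariant_lifting G n l \<Phi> \<longleftrightarrow>
     (\<forall>K \<in> G. \<forall>D \<in> diff_ops n. ad_hat K (\<Phi> D) = \<Phi> (ad_op l K D))"

definition row_poly :: "(nat \<Rightarrow> nat \<Rightarrow> real) \<Rightarrow> nat \<Rightarrow> nat \<Rightarrow> real \<Rightarrow> real" where
  "row_poly a n i \<mu> = (\<Sum>j\<le>n. a i j * \<mu> ^ j)"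

definition row_poly_weight ::
    "(nat \<Rightarrow> nat \<Rightarrow> real) \<Rightarrow> nat \<Rightarrow> nat \<Rightarrow> 'd::finite density \<Rightarrow> 'd density" where
  "row_poly_weight a n i s = (\<Sum>j\<le>n. a i j *\<^sub>R (weight_op ^^ j) s)"

text \<open>The last clause is what gives the quotients \<open>P\<^sub>i(w) / P\<^sub>i(l)\<close> a meaning.\<close>

definition admissible_matrix :: "nat \<Rightarrow> real \<Rightarrow> (nat \<Rightarrow> nat \<Rightarrow> real) \<Rightarrow> bool" where
  "admissible_matrix n l a \<longleftrightarrow>
     (\<forall>i\<le>n. \<forall>j\<le>n. i < j \<longrightarrow> a i j = 0) \<and>
     (\<forall>i\<le>n. \<exists>j\<le>n. a i j \<noteq> 0) \<and>
     (\<forall>i\<le>n. row_poly a n i l \<noteq> 0)"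

definition matrix_lifting ::
    "(nat \<Rightarrow> nat \<Rightarrow> real) \<Rightarrow> nat \<Rightarrow> real \<Rightarrow>
     ('d::finite sfun \<Rightarrow> 'd sfun) \<Rightarrow> 'd density \<Rightarrow> 'd density" where
  "matrix_lifting a n l D s =
     (\<Sum>i\<le>n. (1 / row_poly a n i l) *\<^sub>R
        row_poly_weight a n i (dlo_lifting l (canonical_part l n D i) s))"

end

theory Submission
  imports Defs
begin

text \<open>
  Normal ordering identifies differential operators with polynomials in the momenta, and an
  explicit series in the divergence turns it into an equivariant quantisation \<open>Q\<^sub>\<mu>\<close> whose
  coefficient of the \<open>r\<close>-th divergence is a polynomial of degree at most \<open>r\<close> in \<open>\<mu>\<close>.  Transporting
  a regular equivariant lifting along \<open>Q\<^sub>l\<close> and \<open>Q\<^sub>\<mu>\<close> gives an equivariant linear map on symbols.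
  Such a map is local without any continuity assumption, because the Euler field centred at a point
  allows one to solve away symbols vanishing to high order there; the quadratic fields then kill
  all its components between different degrees, and the linear fields make the diagonal ones
  scalar.  So the lifting multiplies the degree \<open>n - i\<close> component by a polynomial \<open>P\<^sub>i(\<mu>)\<close>, and the
  order bound, tested with finite differences in the weight, gives \<open>deg P\<^sub>i \<le> i\<close>.
\<close>

section \<open>Smooth functions\<close>

text \<open>No value of the weights is exceptional. The divergence series has denominators
  \<open>(r + 1) * (2 * k + d - r - 1)\<close>, which do not involve the weight and are positive for
  \<open>r < k\<close>; and every factor divided by in the study of intertwiners is positive or a
  nonzero difference of degrees. The delicate place, between degrees \<open>j < k\<close>, is the
  Taylor term of order \<open>k - j\<close> at the centre of the Euler field: there the Euler
  eigenvalue gives no information and the quadratic fields must be used. The bound on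
  \<open>deg P_i\<close> is a balance of orders. The weight operator has order one, so a factor of
  degree \<open>i\<close> in the weight uses up exactly the order saved by passing to the component
  of degree \<open>n - i\<close>; in the same way the coefficient of the r-th divergence pays with
  degree \<open>r\<close> for the \<open>r\<close> orders that the divergences remove. The order
  bound gives only the degree; that \<open>P_i\<close> is a polynomial at all comes from the
  definition of a pencil. The analysis of intertwiners is used twice: it also proves that the full
  symbol map is unique, which identifies the map selected by choice with the inverse of the explicit
  quantisation.\<close>

lemma smooth_has_derivative:
  assumes "smooth f"
  shows "(f has_derivative (\<lambda>h. \<Sum>i\<in>UNIV. pderiv_at i f x * h $ i)) (at x)"
proof -
  let ?F = "frechet_derivative f (at x)"
  have F: "(f has_derivative ?F) (at x)"
    using smooth_differentiable[OF assms] frechet_derivative_works by blast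
  then have lin: "linear ?F" by (rule has_derivative_linear)
  have "?F h = (\<Sum>i\<in>UNIV. pderiv_at i f x * h $ i)" for h
  proof -
    have "?F h = ?F (\<Sum>i\<in>UNIV. h $ i *\<^sub>R axis i 1)"
      using basis_expansion[of h] by (simp add: scalar_mult_eq_scaleR)
    also have "\<dots> = (\<Sum>i\<in>UNIV. h $ i *\<^sub>R ?F (axis i 1))"
      by (simp add: linear_sum[OF lin] linear_scale[OF lin])
    finally show ?thesis by (simp add: pderiv_at_def mult.commute)
  qed
  then have "?F = (\<lambda>h. \<Sum>i\<in>UNIV. pderiv_at i f x * h $ i)" by auto
  with F show ?thesis by simp
qed

lemma smooth_continuous_on: "smooth f \<Longrightarrow> continuous_on S f"
  by (meson smooth_differentiable differentiable_imp_continuous_within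
      continuous_at_imp_continuous_on)

lemma pderiv_at_has_derivative:
  assumes "(f has_derivative F) (at x)"
  shows "pderiv_at i f x = F (axis i 1)"
  using frechet_derivative_at[OF assms] by (simp add: pderiv_at_def)

lemma smooth_directional:
  assumes "smooth f"
  shows "((\<lambda>t. f (x + t *\<^sub>R axis i 1)) has_real_derivative pderiv_at i f (x + t *\<^sub>R axis i 1)) (at t)"
proof -
  have "((\<lambda>t. x + t *\<^sub>R axis i (1::real)) has_derivative (\<lambda>h. h *\<^sub>R axis i 1)) (at t)"
    by (auto intro!: derivative_eq_intros)
  from has_derivative_compose[OF this smooth_has_derivative[OF assms]]
  have "((\<lambda>t. f (x + t *\<^sub>R axis i 1)) has_derivative
      (\<lambda>h. \<Sum>j\<in>UNIV. pderiv_at j f (x + t *\<^sub>R axis i 1) * (h *\<^sub>R axis i (1::real)) $ j)) (at t)" .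
  moreover have "(\<Sum>j\<in>UNIV. pderiv_at j f (x + t *\<^sub>R axis i 1) * (h *\<^sub>R axis i (1::real)) $ j)
      = pderiv_at i f (x + t *\<^sub>R axis i 1) * h" for h
    by (simp add: axis_def if_distrib cong: if_cong)
  ultimately show ?thesis by (simp add: has_field_derivative_def)
qed

section \<open>Symmetry of second derivatives\<close>

text \<open>Two applications of the mean value theorem, first along \<open>i\<close> to the
  difference in direction \<open>j\<close>, then along \<open>j\<close>. The left-hand side is
  symmetric in the two directions, which is what Schwarz's theorem rests on.\<close>

lemma second_difference_mvt:
  fixes f :: "real ^ 'd::finite \<Rightarrow> real"
  assumes f: "smooth f" and h: "0 < h"
  shows "\<exists>s t. 0 < s \<and> s < h \<and> 0 < t \<and> t < h \<and>
    f (x + h *\<^sub>R axis i 1 + h *\<^sub>R axis j 1) - f (x + h *\<^sub>R axis i 1) - f (x + h *\<^sub>R axis j 1) + f x =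
    h * h * pderiv_at j (pderiv_at i f) (x + s *\<^sub>R axis i 1 + t *\<^sub>R axis j 1)"
proof -
  let ?g = "\<lambda>s. f ((x + h *\<^sub>R axis j 1) + s *\<^sub>R axis i 1) - f (x + s *\<^sub>R axis i 1)"
  let ?g' = "\<lambda>s. pderiv_at i f ((x + h *\<^sub>R axis j 1) + s *\<^sub>R axis i 1) - pderiv_at i f (x + s *\<^sub>R axis i 1)"
  have "\<exists>s. 0 < s \<and> s < h \<and> ?g h - ?g 0 = (h - 0) * ?g' s"
    by (rule MVT2[OF h]) (intro DERIV_diff smooth_directional f)
  then obtain s where s: "0 < s" "s < h" "?g h - ?g 0 = h * ?g' s" by auto
  let ?k = "\<lambda>t. pderiv_at i f ((x + s *\<^sub>R axis i 1) + t *\<^sub>R axis j 1)"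
  have "\<exists>t. 0 < t \<and> t < h \<and> ?k h - ?k 0
      = (h - 0) * pderiv_at j (pderiv_at i f) ((x + s *\<^sub>R axis i 1) + t *\<^sub>R axis j 1)"
    by (rule MVT2[OF h]) (intro smooth_directional smooth_pderiv f)
  then obtain t where t: "0 < t" "t < h" "?k h - ?k 0
      = h * pderiv_at j (pderiv_at i f) ((x + s *\<^sub>R axis i 1) + t *\<^sub>R axis j 1)" by auto
  have "?g' s = ?k h - ?k 0" by (simp add: algebra_simps)
  with s t have "?g h - ?g 0
      = h * h * pderiv_at j (pderiv_at i f) ((x + s *\<^sub>R axis i 1) + t *\<^sub>R axis j 1)" by simp
  then show ?thesis using s(1,2) t(1,2)
    by (intro exI[of _ s] exI[of _ t]) (simp add: algebra_simps)
qed

lemma pderiv_at_commute: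
  fixes f :: "real ^ 'd::finite \<Rightarrow> real"
  assumes f: "smooth f"
  shows "pderiv_at i (pderiv_at j f) = pderiv_at j (pderiv_at i f)"
proof
  fix x
  let ?A = "pderiv_at i (pderiv_at j f)" and ?B = "pderiv_at j (pderiv_at i f)"
  have cont: "continuous (at x) ?A" "continuous (at x) ?B"
    by (intro differentiable_imp_continuous_within smooth_differentiable smooth_pderiv f)+
  show "?A x = ?B x"
  proof (rule ccontr)
    assume neq: "?A x \<noteq> ?B x"
    \<comment> \<open>Half the gap: values closer than \<open>e\<close> to \<open>?A x\<close> and
      to \<open>?B x\<close> respectively cannot coincide.\<close>
    define e where "e = \<bar>?A x - ?B x\<bar> / 2"
    have e: "e > 0" using neq by (simp add: e_def)
    obtain r where r: "r > 0" "\<And>y. dist y x < r \<Longrightarrow> dist (?A y) (?A x) < e"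
      using cont(1) e unfolding continuous_at_eps_delta by blast
    obtain r' where r': "r' > 0" "\<And>y. dist y x < r' \<Longrightarrow> dist (?B y) (?B x) < e"
      using cont(2) e unfolding continuous_at_eps_delta by blast
    define h where "h = min r r' / 2"
    have h: "h > 0" "2 * h \<le> r" "2 * h \<le> r'" using r(1) r'(1) by (auto simp: h_def)
    have near: "dist (x + s *\<^sub>R axis k 1 + t *\<^sub>R axis l 1) x < 2 * h"
      if "0 < s" "s < h" "0 < t" "t < h" for s t :: real and k l :: 'd
    proof -
      have "norm (s *\<^sub>R axis k (1::real) + t *\<^sub>R axis l (1::real)) \<le> \<bar>s\<bar> + \<bar>t\<bar>"
        using norm_triangle_ineq[of "s *\<^sub>R axis k (1::real)" "t *\<^sub>R axis l (1::real)"] by simp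
      then show ?thesis using that by (simp add: dist_norm add.assoc)
    qed
    obtain s t where st: "0 < s" "s < h" "0 < t" "t < h"
      "f (x + h *\<^sub>R axis i 1 + h *\<^sub>R axis j 1) - f (x + h *\<^sub>R axis i 1) - f (x + h *\<^sub>R axis j 1) + f x
      = h * h * ?B (x + s *\<^sub>R axis i 1 + t *\<^sub>R axis j 1)"
      using second_difference_mvt[OF f h(1)] by blast
    obtain s' t' where st': "0 < s'" "s' < h" "0 < t'" "t' < h"
      "f (x + h *\<^sub>R axis j 1 + h *\<^sub>R axis i 1) - f (x + h *\<^sub>R axis j 1) - f (x + h *\<^sub>R axis i 1) + f x
      = h * h * ?A (x + s' *\<^sub>R axis j 1 + t' *\<^sub>R axis i 1)"
      using second_difference_mvt[OF f h(1)] by blast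
    have "x + h *\<^sub>R axis j 1 + h *\<^sub>R axis i (1::real) = x + h *\<^sub>R axis i 1 + h *\<^sub>R axis j 1"
      by (simp add: algebra_simps)
    with st(5) st'(5) have "h * h * ?A (x + s' *\<^sub>R axis j 1 + t' *\<^sub>R axis i 1)
        = h * h * ?B (x + s *\<^sub>R axis i 1 + t *\<^sub>R axis j 1)" by (simp only:)
    then have eq: "?A (x + s' *\<^sub>R axis j 1 + t' *\<^sub>R axis i 1)
        = ?B (x + s *\<^sub>R axis i 1 + t *\<^sub>R axis j 1)" using h(1) by simp
    have "dist (?A (x + s' *\<^sub>R axis j 1 + t' *\<^sub>R axis i 1)) (?A x) < e"
      using near[OF st'(1-4), of j i] h by (intro r) linarith
    moreover have "dist (?B (x + s *\<^sub>R axis i 1 + t *\<^sub>R axis j 1)) (?B x) < e"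
      using near[OF st(1-4), of i j] h by (intro r') linarith
    moreover have "\<bar>?A x - ?B x\<bar> = 2 * e" by (simp add: e_def)
    ultimately show False using eq unfolding dist_real_def by arith
  qed
qed

section \<open>Radial means, Hadamard's lemma and the Euler equation\<close>

text \<open>Solution operator of \<open>E u + (q + 1) u = f\<close>, where \<open>E\<close> is the
  Euler field centred at \<open>a\<close>. The exponent is a parameter because each partial
  derivative raises it by one, so smoothness follows by induction over all \<open>q\<close> at
  once.\<close>

definition radial_mean :: "real ^ 'd::finite \<Rightarrow> nat \<Rightarrow> (real ^ 'd \<Rightarrow> real) \<Rightarrow> real ^ 'd \<Rightarrow> real" where
  "radial_mean a q f x = integral {0..1} (\<lambda>t. t ^ q * f (a + t *\<^sub>R (x - a)))"

lemma radial_integrand_has_derivative: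
  fixes f :: "real ^ 'd::finite \<Rightarrow> real"
  assumes "smooth f"
  shows "((\<lambda>x. t ^ q * f (a + t *\<^sub>R (x - a))) has_derivative
    (\<lambda>h. \<Sum>i\<in>UNIV. t ^ Suc q * pderiv_at i f (a + t *\<^sub>R (x - a)) * h $ i)) (at x)"
proof -
  have "((\<lambda>x. a + t *\<^sub>R (x - a)) has_derivative (\<lambda>h. t *\<^sub>R h)) (at x)"
    by (auto intro!: derivative_eq_intros)
  from has_derivative_compose[OF this smooth_has_derivative[OF assms]]
  have "((\<lambda>x. f (a + t *\<^sub>R (x - a))) has_derivative
    (\<lambda>h. \<Sum>i\<in>UNIV. pderiv_at i f (a + t *\<^sub>R (x - a)) * (t *\<^sub>R h) $ i)) (at x)" .
  from has_derivative_mult_right[OF this, of "t ^ q"] show ?thesis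
    by (simp add: sum_distrib_left algebra_simps)
qed

lemma radial_continuous:
  fixes f :: "real ^ 'd::finite \<Rightarrow> real"
  assumes "smooth f"
  shows "continuous_on S (\<lambda>(x, t::real). t ^ q * f (a + t *\<^sub>R (x - a)))"
  unfolding split_beta
  by (intro continuous_intros continuous_on_compose2[OF smooth_continuous_on[OF assms, of UNIV]]) auto

lemma radial_integrable:
  fixes f :: "real ^ 'd::finite \<Rightarrow> real"
  assumes "smooth f"
  shows "(\<lambda>t::real. t ^ q * f (a + t *\<^sub>R (x - a))) integrable_on {0..1}"
  by (intro integrable_continuous_interval continuous_intros
      continuous_on_compose2[OF smooth_continuous_on[OF assms, of UNIV]]) auto

lemma radial_mean_has_derivative:
  fixes f :: "real ^ 'd::finite \<Rightarrow> real"
  assumes f: "smooth f"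
  shows "(radial_mean a q f has_derivative
    (\<lambda>h. \<Sum>i\<in>UNIV. radial_mean a (Suc q) (pderiv_at i f) x * h $ i)) (at x)"
proof -
  let ?f = "\<lambda>x t. t ^ q * f (a + t *\<^sub>R (x - a))"
  let ?c = "\<lambda>i x t. t ^ Suc q * pderiv_at i f (a + t *\<^sub>R (x - a))"
  \<comment> \<open>The derivative in \<open>x\<close> as a bounded linear form, the shape in which
    one differentiates under the integral sign.\<close>
  define fx :: "real ^ 'd \<Rightarrow> real \<Rightarrow> (real ^ 'd) \<Rightarrow>\<^sub>L real"
    where "fx x t = (\<Sum>i\<in>UNIV. ?c i x t *\<^sub>R blinfun_inner_left (axis i 1))" for x t
  have app: "blinfun_apply (fx x t) h = (\<Sum>i\<in>UNIV. ?c i x t * h $ i)" for x t h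
    by (simp add: fx_def blinfun.sum_left blinfun.scaleR_left inner_axis)
  have cont: "continuous_on S (\<lambda>(x, t). fx x t)" for S
    unfolding fx_def split_beta
    by (intro continuous_intros radial_continuous[OF smooth_pderiv[OF f], unfolded split_beta])
  have "((\<lambda>x. integral (cbox 0 1) (?f x)) has_derivative integral (cbox 0 1) (fx x)) (at x within UNIV)"
  proof (rule leibniz_rule)
    show "((\<lambda>x. ?f x t) has_derivative blinfun_apply (fx x t)) (at x within UNIV)" for x t
      using radial_integrand_has_derivative[OF f] unfolding app by simp
    show "?f x integrable_on cbox 0 1" for x
      using radial_integrable[OF f] by simp
    show "continuous_on (UNIV \<times> cbox 0 1) (\<lambda>(x, t). fx x t)" by (rule cont)
  qed auto
  moreover have "blinfun_apply (integral (cbox 0 1) (fx x)) h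
      = (\<Sum>i\<in>UNIV. radial_mean a (Suc q) (pderiv_at i f) x * h $ i)" for h
  proof -
    have "continuous_on {0..1} (\<lambda>t. (\<lambda>(x, t). fx x t) (x, t))"
      by (rule continuous_on_compose2[OF cont[of UNIV]]) (auto intro!: continuous_intros)
    then have "fx x integrable_on {0..1}"
      by (intro integrable_continuous_interval) simp
    then have "blinfun_apply (integral {0..1} (fx x)) h = integral {0..1} (\<lambda>t. blinfun_apply (fx x t) h)"
      by (rule blinfun_apply_integral)
    also have "\<dots> = integral {0..1} (\<lambda>t. \<Sum>i\<in>UNIV. ?c i x t * h $ i)" by (simp only: app)
    also have "\<dots> = (\<Sum>i\<in>UNIV. integral {0..1} (\<lambda>t. ?c i x t * h $ i))"
      by (intro integral_sum finite integrable_on_mult_left radial_integrable smooth_pderiv f)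
    finally show ?thesis by (simp add: radial_mean_def)
  qed
  ultimately show ?thesis
    by (simp add: radial_mean_def[abs_def] has_derivative_eq_rhs fun_eq_iff)
qed

lemma pderiv_at_radial_mean:
  "smooth f \<Longrightarrow> pderiv_at i (radial_mean a q f) = radial_mean a (Suc q) (pderiv_at i f)"
  by (rule ext, subst pderiv_at_has_derivative[OF radial_mean_has_derivative])
    (auto simp: axis_def if_distrib cong: if_cong)

lemma smooth_radial_mean:
  assumes "smooth f"
  shows "smooth (radial_mean a q f)"
proof -
  have "pderivs_at is (radial_mean a q f) differentiable (at x)" for "is" x
    using assms
  proof (induction "is" arbitrary: q f)
    case Nil
    then show ?case using radial_mean_has_derivative unfolding differentiable_def by fastforce
  next
    case (Cons i "is")
    then show ?case by (simp add: pderiv_at_radial_mean smooth_pderiv)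
  qed
  then show ?thesis by (simp add: smooth_def)
qed

text \<open>The fundamental theorem of calculus along the segment from \<open>a\<close> to
  \<open>x\<close>. The boundary term \<open>0 ^ q * f a\<close> survives only for
  \<open>q = 0\<close>, which gives Hadamard's lemma; for positive \<open>q\<close> the identity
  becomes the Euler equation of the radial mean.\<close>

lemma radial_fundamental:
  fixes f :: "real ^ 'd::finite \<Rightarrow> real"
  assumes f: "smooth f"
  shows "((\<lambda>t. of_nat q * (t ^ (q - 1) * f (a + t *\<^sub>R (x - a)))
      + (\<Sum>i\<in>UNIV. (x - a) $ i * (t ^ q * pderiv_at i f (a + t *\<^sub>R (x - a)))))
    has_integral (f x - 0 ^ q * f a)) {0..1}"
proof -
  have "((\<lambda>t. t ^ q * f (a + t *\<^sub>R (x - a))) has_vector_derivative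
     (of_nat q * (t ^ (q - 1) * f (a + t *\<^sub>R (x - a)))
      + (\<Sum>i\<in>UNIV. (x - a) $ i * (t ^ q * pderiv_at i f (a + t *\<^sub>R (x - a)))))) (at t within {0..1})" for t
  proof -
    have "((\<lambda>t. a + t *\<^sub>R (x - a)) has_derivative (\<lambda>h. h *\<^sub>R (x - a))) (at t)"
      by (auto intro!: derivative_eq_intros)
    from has_derivative_compose[OF this smooth_has_derivative[OF f]]
    have "((\<lambda>t. f (a + t *\<^sub>R (x - a))) has_derivative
      (\<lambda>h. \<Sum>i\<in>UNIV. pderiv_at i f (a + t *\<^sub>R (x - a)) * (h *\<^sub>R (x - a)) $ i)) (at t)" .
    then have "((\<lambda>t. f (a + t *\<^sub>R (x - a))) has_real_derivative
      (\<Sum>i\<in>UNIV. pderiv_at i f (a + t *\<^sub>R (x - a)) * (x - a) $ i)) (at t)"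
      unfolding has_field_derivative_def
      by (rule has_derivative_eq_rhs) (simp add: fun_eq_iff sum_distrib_left mult_ac)
    from DERIV_mult[OF DERIV_pow[of q] this]
    have "((\<lambda>t. t ^ q * f (a + t *\<^sub>R (x - a))) has_real_derivative
     (of_nat q * (t ^ (q - 1) * f (a + t *\<^sub>R (x - a)))
      + (\<Sum>i\<in>UNIV. (x - a) $ i * (t ^ q * pderiv_at i f (a + t *\<^sub>R (x - a)))))) (at t)"
      by (rule DERIV_cong) (simp add: sum_distrib_left sum_distrib_right algebra_simps)
    then show ?thesis
      using has_real_derivative_iff_has_vector_derivative has_vector_derivative_at_within by blast
  qed
  from fundamental_theorem_of_calculus[OF _ this]
  show ?thesis by simp
qed

lemma radial_sum_has_integral:
  fixes f :: "real ^ 'd::finite \<Rightarrow> real"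
  assumes "smooth f"
  shows "((\<lambda>t. \<Sum>i\<in>UNIV. (x - a) $ i * (t ^ q * pderiv_at i f (a + t *\<^sub>R (x - a))))
    has_integral (\<Sum>i\<in>UNIV. (x - a) $ i * radial_mean a q (pderiv_at i f) x)) {0..1}"
  unfolding radial_mean_def
  by (intro has_integral_sum finite has_integral_mult_right integrable_integral
      radial_integrable smooth_pderiv assms)

lemma radial_mean_euler:
  fixes f :: "real ^ 'd::finite \<Rightarrow> real"
  assumes f: "smooth f"
  shows "(\<Sum>i\<in>UNIV. (x - a) $ i * pderiv_at i (radial_mean a q f) x)
    + (real q + 1) * radial_mean a q f x = f x"
proof -
  have "((\<lambda>t. t ^ q * f (a + t *\<^sub>R (x - a))) has_integral radial_mean a q f x) {0..1}"
    unfolding radial_mean_def by (rule integrable_integral[OF radial_integrable[OF f]])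
  from has_integral_add[OF has_integral_mult_right[OF this, of "real (Suc q)"]
      radial_sum_has_integral[OF f, of x a "Suc q"]]
    radial_fundamental[OF f, of "Suc q" a x]
  show ?thesis
    by (auto simp: pderiv_at_radial_mean[OF f] dest: has_integral_unique)
qed

lemma hadamard:
  fixes f :: "real ^ 'd::finite \<Rightarrow> real"
  assumes f: "smooth f"
  shows "f x = f a + (\<Sum>i\<in>UNIV. (x - a) $ i * radial_mean a 0 (pderiv_at i f) x)"
  using has_integral_unique[OF radial_fundamental[OF f, of 0 a x]] radial_sum_has_integral[OF f, of x a 0]
  by fastforce

section \<open>Calculus in the ring of smooth functions\<close>

lemma val_simps [simp]:
  "val 0 x = 0" "val 1 x = 1" "val (f + g) x = val f x + val g x" "val (f * g) x = val f x * val g x"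
  "val (- f) x = - val f x" "val (f - g) x = val f x - val g x" "val (r *\<^sub>R f) x = r * val f x"
  by (simp_all add: zero_sfun.rep_eq one_sfun.rep_eq plus_sfun.rep_eq times_sfun.rep_eq
      uminus_sfun.rep_eq minus_sfun.rep_eq scaleR_sfun.rep_eq)

lemma val_of_real [simp]: "val (of_real r) x = r"
  by (simp add: of_real_def)

lemma val_of_nat [simp]: "val (of_nat k) x = of_nat k"
  using val_of_real[of "of_nat k"] by simp

lemma val_sum: "val (sum f A) x = (\<Sum>a\<in>A. val (f a) x)"
  by (induction A rule: infinite_finite_induct) auto

lemma val_coord [simp]: "val (coord i) x = x $ i"
  by (simp add: coord.rep_eq)

lemma sfun_eqI: "(\<And>x. val f x = val g x) \<Longrightarrow> f = g"
  by (simp add: val_inject[symmetric] fun_eq_iff)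

lemma smooth_val: "smooth (val f)"
  using val by auto

lemma val_partial: "val (partial i f) = pderiv_at i (val f)"
  by (simp add: partial.rep_eq)

lemma partial_add: "partial i (f + g) = partial i f + partial i g"
  by (rule sfun_eqI) (simp add: val_partial plus_sfun.rep_eq pderiv_at_add smooth_differentiable smooth_val)

lemma partial_mult: "partial i (f * g) = f * partial i g + partial i f * g"
  by (rule sfun_eqI) (simp add: val_partial times_sfun.rep_eq pderiv_at_mult smooth_differentiable smooth_val)

lemma partial_commute: "partial i (partial j f) = partial j (partial i f)"
  by (rule sfun_eqI) (simp add: val_partial pderiv_at_commute smooth_val)

lemma partial_of_real [simp]: "partial i (of_real r) = 0"
proof (rule sfun_eqI)
  fix x
  have "val (of_real r :: 'a sfun) = (\<lambda>x. r)" by auto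
  then show "val (partial i (of_real r)) x = val 0 x" by (simp add: val_partial pderiv_at_const)
qed

lemma partial_0 [simp]: "partial i 0 = 0" and partial_1 [simp]: "partial i 1 = 0"
  using partial_of_real[of i 0] partial_of_real[of i 1] by simp_all

lemma partial_scaleR: "partial i (r *\<^sub>R f) = r *\<^sub>R partial i f"
  using partial_mult[of i "of_real r" f] by (simp add: scaleR_conv_of_real)

lemma partial_uminus: "partial i (- f) = - partial i f"
  using partial_scaleR[of i "-1" f] by simp

lemma partial_diff: "partial i (f - g) = partial i f - partial i g"
  using partial_add[of i f "- g"] by (simp add: partial_uminus)

lemma partial_coord: "partial j (coord i) = (if i = j then 1 else 0)"
proof (rule sfun_eqI)
  fix x :: "real ^ 'a"
  have "((\<lambda>x::real^'a. x $ i) has_derivative (\<lambda>h. h $ i)) (at x)"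
    by (rule bounded_linear_imp_has_derivative) (rule bounded_linear_vec_nth)
  from pderiv_at_has_derivative[OF this, of j]
  show "val (partial j (coord i)) x = val (if i = j then 1 else 0) x"
    by (simp add: val_partial coord.rep_eq axis_def)
qed

definition pos :: "real ^ 'd::finite \<Rightarrow> 'd \<Rightarrow> 'd sfun" where
  "pos a i = coord i - of_real (a $ i)"

lemma val_pos [simp]: "val (pos a i) x = x $ i - a $ i"
  by (simp add: pos_def)

lemma partial_pos [simp]: "partial j (pos a i) = (if i = j then 1 else 0)"
  by (simp add: pos_def partial_diff partial_coord)

lemma hadamard_sfun: "\<exists>g. f = of_real (val f a) + (\<Sum>i\<in>UNIV. pos a i * g i)"
proof -
  define g where "g i = Sfun (radial_mean a 0 (pderiv_at i (val f)))" for i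
  have g: "val (g i) = radial_mean a 0 (pderiv_at i (val f))" for i
    unfolding g_def by (rule Sfun_inverse) (simp add: smooth_radial_mean smooth_pderiv smooth_val)
  have "f = of_real (val f a) + (\<Sum>i\<in>UNIV. pos a i * g i)"
  proof (rule sfun_eqI)
    fix x
    show "val f x = val (of_real (val f a) + (\<Sum>i\<in>UNIV. pos a i * g i)) x"
      using hadamard[OF smooth_val, of f x a] by (simp add: val_sum g)
  qed
  then show ?thesis by blast
qed

text \<open>Surjectivity holds on all smooth functions, those flat at \<open>a\<close> included.
  This is what later replaces a continuity assumption.\<close>

lemma radial_sfun: "\<exists>u. (\<Sum>i\<in>UNIV. pos a i * partial i u) + of_nat (Suc q) * u = f"
proof -
  define u where "u = Sfun (radial_mean a q (val f))"
  have u: "val u = radial_mean a q (val f)"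
    unfolding u_def by (rule Sfun_inverse) (simp add: smooth_radial_mean smooth_val)
  have "(\<Sum>i\<in>UNIV. pos a i * partial i u) + of_nat (Suc q) * u = f"
  proof (rule sfun_eqI)
    fix x
    have "val ((\<Sum>i\<in>UNIV. pos a i * partial i u) + of_nat (Suc q) * u) x
      = (\<Sum>i\<in>UNIV. (x - a) $ i * pderiv_at i (radial_mean a q (val f)) x)
        + of_nat (Suc q) * radial_mean a q (val f) x"
      by (simp only: val_simps val_sum val_partial u val_of_nat val_pos vector_minus_component)
    also have "\<dots> = val f x"
      using radial_mean_euler[OF smooth_val, of x a q f] by (simp add: add.commute)
    finally show "val ((\<Sum>i\<in>UNIV. pos a i * partial i u) + of_nat (Suc q) * u) x = val f x" .
  qed
  then show ?thesis by blast
qed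

section \<open>Additive extension\<close>

abbreviation (input) lookup where "lookup \<equiv> Poly_Mapping.lookup"
abbreviation (input) single where "single \<equiv> Poly_Mapping.single"
abbreviation (input) keys where "keys \<equiv> Poly_Mapping.keys"

lemma pm_induct [case_names single add]:
  fixes s :: "'a \<Rightarrow>\<^sub>0 'b::comm_monoid_add"
  assumes "\<And>k v. P (single k v)" "\<And>s t. P s \<Longrightarrow> P t \<Longrightarrow> P (s + t)"
  shows "P s"
proof (induction s rule: Poly_Mapping.update_induct)
  case const
  then show ?case using assms(1)[of undefined 0] by simp
next
  case (update f k v)
  have "Poly_Mapping.update k v f = f + single k v"
    using update by (intro poly_mapping_eqI)
      (auto simp: lookup_update lookup_add lookup_single when_def in_keys_iff)
  then show ?case using assms update by simp
qed

text \<open>Serves both symbols, indexed by multisets, and densities, indexed by real weights.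
  Scalars are identified with constants at index zero, which are central.\<close>

instance poly_mapping :: (monoid_add, real_algebra_1) real_algebra_1
proof
  fix r :: real and x y :: "'a \<Rightarrow>\<^sub>0 'b"
  have L: "r *\<^sub>R x = single 0 (of_real r) * x" for x :: "'a \<Rightarrow>\<^sub>0 'b"
    by (rule poly_mapping_eqI)
      (simp add: lookup_scaleR mult_map_scale_conv_mult[symmetric] Poly_Mapping.map.rep_eq when_def
        scaleR_conv_of_real)
  have R: "r *\<^sub>R x = x * single 0 (of_real r)" for x :: "'a \<Rightarrow>\<^sub>0 'b"
  proof -
    have "single 0 (of_real r) * x = x * single 0 (of_real r)"
      by (induction x rule: pm_induct)
        (simp_all add: mult_single distrib_left distrib_right Real_Vector_Spaces.of_real_def)
    then show ?thesis by (simp add: L)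
  qed
  show "r *\<^sub>R x * y = r *\<^sub>R (x * y)" by (simp add: L mult.assoc)
  show "x * r *\<^sub>R y = r *\<^sub>R (x * y)"
    by (metis L R mult.assoc)
qed

definition pm_sum :: "('a \<Rightarrow> 'b::zero \<Rightarrow> 'c::comm_monoid_add) \<Rightarrow> ('a \<Rightarrow>\<^sub>0 'b) \<Rightarrow> 'c" where
  "pm_sum F s = (\<Sum>k\<in>keys s. F k (lookup s k))"

lemma pm_sum_superset:
  assumes "finite A" "keys s \<subseteq> A" "\<And>k. F k 0 = 0"
  shows "pm_sum F s = (\<Sum>k\<in>A. F k (lookup s k))"
  unfolding pm_sum_def
  by (rule sum.mono_neutral_left) (use assms in \<open>auto simp: in_keys_iff\<close>)

lemma pm_sum_single: "F k 0 = 0 \<Longrightarrow> pm_sum F (single k v) = F k v"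
  by (simp add: pm_sum_def)

lemma pm_sum_add:
  fixes s t :: "'a \<Rightarrow>\<^sub>0 'b::comm_monoid_add"
  assumes "\<And>k. F k 0 = 0" "\<And>k u v. F k (u + v) = F k u + F k v"
  shows "pm_sum F (s + t) = pm_sum F s + pm_sum F t"
proof -
  let ?A = "keys s \<union> keys t"
  have sub: "keys (s + t) \<subseteq> ?A" by (rule keys_add)
  show ?thesis
    using sub by (subst (1 2 3) pm_sum_superset[where A = ?A])
      (auto simp: assms lookup_add sum.distrib)
qed

lemma additive_eqI:
  fixes f g :: "('a \<Rightarrow>\<^sub>0 'b::comm_monoid_add) \<Rightarrow> 'c::plus"
  assumes "\<And>s t. f (s + t) = f s + f t" "\<And>s t. g (s + t) = g s + g t"
    and "\<And>k v. f (single k v) = g (single k v)"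
  shows "f s = g s"
  by (induction s rule: pm_induct) (simp_all add: assms)

section \<open>Formal symbols\<close>

text \<open>
  Polynomials in the momenta with smooth coefficients; a multiset of indices is a monomial.
\<close>

type_synonym 'd sym = "'d multiset \<Rightarrow>\<^sub>0 'd sfun"

lemma scaleR_single: "r *\<^sub>R single k v = single k (r *\<^sub>R v)"
  for v :: "'b::real_vector"
  by (rule poly_mapping_eqI) (simp add: lookup_scaleR lookup_single when_def)

lemma linear_pm_sum:
  fixes F :: "'a \<Rightarrow> 'b::real_vector \<Rightarrow> 'c::real_vector"
  assumes "\<And>k. linear (F k)"
  shows "linear (pm_sum F)"
proof -
  have add: "F k 0 = 0" "F k (u + v) = F k u + F k v" for k u v
    using linear_0[OF assms] linear_add[OF assms] by auto
  show ?thesis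
  proof (rule linearI)
    fix s t :: "'a \<Rightarrow>\<^sub>0 'b" and r
    show "pm_sum F (s + t) = pm_sum F s + pm_sum F t"
      by (rule pm_sum_add) (simp_all add: add)
    show "pm_sum F (r *\<^sub>R s) = r *\<^sub>R pm_sum F s"
      by (induction s rule: pm_induct)
        (simp_all add: scaleR_single pm_sum_single pm_sum_add add scaleR_add_right linear_scale[OF assms])
  qed
qed

lemma linear_eqI:
  fixes f g :: "('a \<Rightarrow>\<^sub>0 'b::real_vector) \<Rightarrow> 'c::real_vector"
  assumes "linear f" "linear g" "\<And>k v. f (single k v) = g (single k v)"
  shows "f s = g s"
  by (rule additive_eqI) (simp_all add: assms linear_add)

lemma linear_single: "linear (single k :: 'b::real_vector \<Rightarrow> _)"
  by (rule linearI) (simp_all add: single_add scaleR_single)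

lemma linear_partial: "linear (partial i)"
  by (rule linearI) (simp_all add: partial_add partial_scaleR)

lemma linear_mult_left: "linear (\<lambda>x. a * x :: 'a::real_algebra)"
  and linear_mult_right: "linear (\<lambda>x. x * a :: 'a::real_algebra)"
  by (rule linearI; simp add: distrib_left distrib_right)+

lemma linear_zero_fun: "linear (\<lambda>x. 0)"
  by (rule linearI) auto

definition cst :: "'d::finite sfun \<Rightarrow> 'd sym" where "cst f = single {#} f"

definition mom :: "'d::finite \<Rightarrow> 'd sym" where "mom i = single {#i#} 1"

lemma cst_simps: "cst 0 = 0" "cst 1 = 1" "cst (f + g) = cst f + cst g" "cst (f * g) = cst f * cst g"
  "cst (f - g) = cst f - cst g" "cst (- f) = - cst f"
  "cst (r *\<^sub>R f) = r *\<^sub>R cst f"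
proof -
  show "cst 1 = 1" unfolding cst_def by (metis single_one zero_multiset_def)
  show "cst (f * g) = cst f * cst g" by (simp add: cst_def mult_single)
qed (simp_all add: cst_def single_add single_diff single_uminus scaleR_single)

lemma linear_cst: "linear cst"
  by (rule linearI) (simp_all add: cst_simps)

lemma cst_of_real [simp]: "cst (of_real r) = of_real r"
  by (simp add: Real_Vector_Spaces.of_real_def cst_simps)

lemma cst_of_nat [simp]: "cst (of_nat k) = of_nat k"
  using cst_of_real[of "of_nat k"] by simp

lemma cst_mult_single: "cst f * single \<alpha> g = single \<alpha> (f * g)"
  by (simp add: cst_def mult_single)

lemma mom_mult_single: "mom i * single \<alpha> g = single (add_mset i \<alpha>) g"
  by (simp add: mom_def mult_single)

text \<open>Splitting off one momentum at a time reduces an identity between additive operators to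
  functions and to multiplication by a single momentum.\<close>

lemma sym_induct [case_names cst mom add]:
  fixes c :: "'d::finite sym"
  assumes "\<And>f. P (cst f)" "\<And>i c. P c \<Longrightarrow> P (mom i * c)" "\<And>c c'. P c \<Longrightarrow> P c' \<Longrightarrow> P (c + c')"
  shows "P c"
proof (induction c rule: pm_induct)
  case (single k v)
  show ?case
    by (induction k) (simp_all add: assms mom_mult_single[symmetric] cst_def[symmetric])
qed (rule assms)

section \<open>Derivations, homogeneous components and evaluation\<close>

text \<open>The derivative in the momentum \<xi>_i: the multiplicity of \<open>i\<close> in the
  monomial is its exponent.\<close>

definition dmom :: "'d::finite \<Rightarrow> 'd sym \<Rightarrow> 'd sym" where
  "dmom i = pm_sum (\<lambda>\<alpha> f. single (\<alpha> - {#i#}) (of_nat (count \<alpha> i) * f))"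

definition dpos :: "'d::finite \<Rightarrow> 'd sym \<Rightarrow> 'd sym" where
  "dpos i = pm_sum (\<lambda>\<alpha> f. single \<alpha> (partial i f))"

definition part :: "nat \<Rightarrow> 'd::finite sym \<Rightarrow> 'd sym" where
  "part k = pm_sum (\<lambda>\<alpha> f. if size \<alpha> = k then single \<alpha> f else 0)"

text \<open>Coefficients are frozen at \<open>a\<close> but kept as constant functions, so the
  result is again a symbol, now with constant coefficients.\<close>

definition at_pt :: "real ^ 'd::finite \<Rightarrow> 'd sym \<Rightarrow> 'd sym" where
  "at_pt a = pm_sum (\<lambda>\<alpha> f. single \<alpha> (of_real (val f a)))"

lemma linear_dmom: "linear (dmom i)"
  unfolding dmom_def
  by (intro linear_pm_sum linear_compose[OF linear_mult_left linear_single, unfolded o_def])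

lemma linear_dpos: "linear (dpos i)"
  unfolding dpos_def
  by (intro linear_pm_sum linear_compose[OF linear_partial linear_single, unfolded o_def])

lemma linear_part: "linear (part k)"
  unfolding part_def
proof (rule linear_pm_sum)
  fix \<alpha> :: "'a multiset"
  show "linear (\<lambda>f. if size \<alpha> = k then single \<alpha> f else 0)"
    by (cases "size \<alpha> = k") (simp_all add: linear_single linear_zero_fun)
qed

lemma linear_at_pt: "linear (at_pt a)"
  unfolding at_pt_def
  by (rule linear_pm_sum, rule linearI) (simp_all add: single_add scaleR_single scaleR_add_left Real_Vector_Spaces.of_real_def)

lemmas dmom_linear = linear_0[OF linear_dmom] linear_add[OF linear_dmom] linear_diff[OF linear_dmom]
  linear_neg[OF linear_dmom] linear_scale[OF linear_dmom] linear_sum[OF linear_dmom]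
lemmas dpos_linear = linear_0[OF linear_dpos] linear_add[OF linear_dpos] linear_diff[OF linear_dpos]
  linear_neg[OF linear_dpos] linear_scale[OF linear_dpos] linear_sum[OF linear_dpos]
lemmas part_linear = linear_0[OF linear_part] linear_add[OF linear_part] linear_diff[OF linear_part]
  linear_neg[OF linear_part] linear_scale[OF linear_part] linear_sum[OF linear_part]
lemmas at_pt_linear = linear_0[OF linear_at_pt] linear_add[OF linear_at_pt] linear_diff[OF linear_at_pt]
  linear_neg[OF linear_at_pt] linear_scale[OF linear_at_pt] linear_sum[OF linear_at_pt]

lemma dmom_single: "dmom i (single \<alpha> f) = single (\<alpha> - {#i#}) (of_nat (count \<alpha> i) * f)"
  by (simp add: dmom_def pm_sum_single)

lemma dpos_single: "dpos i (single \<alpha> f) = single \<alpha> (partial i f)"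
  by (simp add: dpos_def pm_sum_single)

lemma part_single: "part k (single \<alpha> f) = (if size \<alpha> = k then single \<alpha> f else 0)"
  by (simp add: part_def pm_sum_single)

lemma at_pt_single: "at_pt a (single \<alpha> f) = single \<alpha> (of_real (val f a))"
  by (simp add: at_pt_def pm_sum_single)

lemma dmom_cst [simp]: "dmom i (cst f) = 0"
  by (simp add: cst_def dmom_single)

lemma dpos_cst [simp]: "dpos i (cst f) = cst (partial i f)"
  by (simp add: cst_def dpos_single)

lemma dmom_cst_mult [simp]: "dmom i (cst f * c) = cst f * dmom i c"
  by (rule additive_eqI[where s = c])
    (simp_all add: distrib_left dmom_linear cst_mult_single dmom_single mult.left_commute)

lemma dmom_mom_mult [simp]: "dmom i (mom j * c) = (if i = j then c else 0) + mom j * dmom i c"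
proof (rule additive_eqI[where s = c])
  fix \<alpha> and f :: "'a sfun"
  show "dmom i (mom j * single \<alpha> f) = (if i = j then single \<alpha> f else 0) + mom j * dmom i (single \<alpha> f)"
  proof (cases "i \<in># \<alpha>")
    case True
    then obtain \<gamma> where "\<alpha> = add_mset i \<gamma>" by (metis insert_DiffM)
    then show ?thesis
      by (cases "i = j")
        (simp_all add: mom_mult_single dmom_single single_add[symmetric] distrib_right del: of_nat_Suc,
          simp_all add: distrib_right)
  next
    case False
    then show ?thesis
      by (auto simp: mom_mult_single dmom_single not_in_iff)
  qed
qed (simp_all add: distrib_left dmom_linear)

lemma dpos_cst_mult [simp]: "dpos i (cst f * c) = cst (partial i f) * c + cst f * dpos i c"
  by (rule additive_eqI[where s = c])
    (simp_all add: distrib_left dpos_linear cst_mult_single dpos_single partial_mult single_add[symmetric]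
      add.commute)

lemma dpos_mom_mult [simp]: "dpos i (mom j * c) = mom j * dpos i c"
  by (rule additive_eqI[where s = c])
    (simp_all add: distrib_left dpos_linear mom_mult_single dpos_single)

lemma dmom_mult: "dmom i (c * c') = dmom i c * c' + c * dmom i c'"
  by (induction c rule: sym_induct) (auto simp: dmom_linear distrib_left distrib_right mult.assoc add_ac)

lemma dpos_mult: "dpos i (c * c') = dpos i c * c' + c * dpos i c'"
  by (induction c rule: sym_induct) (auto simp: dpos_linear distrib_left distrib_right mult.assoc add_ac)

lemma dmom_1 [simp]: "dmom i 1 = 0" and dpos_1 [simp]: "dpos i 1 = 0"
  using dmom_cst[of i 1] dpos_cst[of i 1] by (simp_all add: cst_simps)

lemma dmom_mom [simp]: "dmom i (mom j) = (if i = j then 1 else 0)"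
  using dmom_mom_mult[of i j 1] by simp

lemma dpos_mom [simp]: "dpos i (mom j) = 0"
  using dpos_mom_mult[of i j 1] by simp

lemma dmom_commute: "dmom i (dmom j c) = dmom j (dmom i c)"
  by (induction c rule: sym_induct) (auto simp: dmom_linear)

lemma dpos_commute: "dpos i (dpos j c) = dpos j (dpos i c)"
  by (induction c rule: sym_induct) (auto simp: dpos_linear partial_commute)

lemma dpos_dmom_commute: "dpos i (dmom j c) = dmom j (dpos i c)"
  by (induction c rule: sym_induct) (auto simp: dpos_linear dmom_linear)

lemma at_pt_cst_mult [simp]: "at_pt a (cst f * c) = of_real (val f a) * at_pt a c"
  by (rule additive_eqI[where s = c])
    (simp_all add: distrib_left at_pt_linear at_pt_single cst_mult_single flip: cst_of_real)

lemma at_pt_mom_mult [simp]: "at_pt a (mom i * c) = mom i * at_pt a c"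
  by (rule additive_eqI[where s = c])
    (simp_all add: distrib_left at_pt_linear at_pt_single mom_mult_single)

lemma dpos_at_pt [simp]: "dpos i (at_pt a c) = 0"
  by (rule additive_eqI[where g = "\<lambda>_. 0", where s = c])
   (simp_all add: at_pt_linear at_pt_single dpos_linear dpos_single)

lemma at_pt_at_pt [simp]: "at_pt a (at_pt b c) = at_pt b c"
  by (rule additive_eqI[where s = c]) (simp_all add: at_pt_linear at_pt_single)

lemma lookup_at_pt: "lookup (at_pt a c) \<alpha> = of_real (val (lookup c \<alpha>) a)"
  by (rule additive_eqI[where s = c])
    (simp_all add: at_pt_linear at_pt_single lookup_add lookup_single when_def)

lemma at_pt_eqI:
  assumes "\<And>a. at_pt a c = at_pt a c'"
  shows "c = c'"
proof (rule poly_mapping_eqI, rule sfun_eqI)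
  fix \<alpha> x
  have "lookup (at_pt x c) \<alpha> = lookup (at_pt x c') \<alpha>" using assms by simp
  then show "val (lookup c \<alpha>) x = val (lookup c' \<alpha>) x" by (simp add: lookup_at_pt)
qed

lemma lookup_part: "lookup (part k c) \<alpha> = (if size \<alpha> = k then lookup c \<alpha> else 0)"
  by (rule additive_eqI[where s = c])
    (auto simp: part_linear part_single lookup_add lookup_single when_def)

lemma lookup_dmom: "lookup (dmom i c) \<alpha> = of_nat (Suc (count \<alpha> i)) * lookup c (add_mset i \<alpha>)"
proof (rule additive_eqI[where s = c])
  fix \<beta> and f :: "'a sfun"
  show "lookup (dmom i (single \<beta> f)) \<alpha> = of_nat (Suc (count \<alpha> i)) * lookup (single \<beta> f) (add_mset i \<alpha>)"
  proof (cases "i \<in># \<beta>")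
    case True
    then obtain \<gamma> where "\<beta> = add_mset i \<gamma>" by (metis insert_DiffM)
    then show ?thesis by (simp add: dmom_single lookup_single when_def)
  next
    case False
    then have "\<beta> \<noteq> add_mset i \<alpha>" by auto
    with False show ?thesis by (simp add: dmom_single lookup_single not_in_iff)
  qed
qed (simp_all add: dmom_linear lookup_add distrib_left)

lemma part_part: "part j (part k c) = (if j = k then part k c else 0)"
  by (rule poly_mapping_eqI) (simp add: lookup_part)

lemma part_part_same [simp]: "part k (part k c) = part k c"
  by (simp add: part_part)

lemma part_cst_mult: "part k (cst f * c) = cst f * part k c"
  by (rule additive_eqI[where s = c])
    (auto simp: distrib_left part_linear part_single cst_mult_single)

lemma part_mom_mult: "part (Suc k) (mom i * c) = mom i * part k c" "part 0 (mom i * c) = 0"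
  by (rule additive_eqI[where s = c];
    auto simp: distrib_left part_linear part_single mom_mult_single)+

lemma part_dpos: "part k (dpos i c) = dpos i (part k c)"
  by (rule additive_eqI[where s = c]) (auto simp: part_linear dpos_linear part_single dpos_single)

lemma part_at_pt: "part k (at_pt a c) = at_pt a (part k c)"
  by (rule additive_eqI[where s = c]) (auto simp: part_linear at_pt_linear part_single at_pt_single)

lemma part_dmom: "part k (dmom i c) = dmom i (part (Suc k) c)"
  by (rule poly_mapping_eqI) (simp add: lookup_part lookup_dmom)

lemma dmom_part_0 [simp]: "dmom i (part 0 c) = 0"
  by (rule poly_mapping_eqI) (simp add: lookup_part lookup_dmom)

lemma part_mom_dmom: "part k (mom j * dmom i c) = mom j * dmom i (part k c)"
  by (cases k) (simp_all add: part_mom_mult part_dmom)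

section \<open>The filtration by degree in the momenta\<close>

text \<open>The bound is strict, so that \<open>below 0\<close> is trivial and inductions can start
  there; operators of order at most \<open>n\<close> correspond to
  \<open>below (Suc n)\<close>.\<close>

definition below :: "nat \<Rightarrow> 'd::finite sym set" where
  "below k = {c. \<forall>\<alpha>. k \<le> size \<alpha> \<longrightarrow> lookup c \<alpha> = 0}"

lemma subspace_below: "subspace (below k)"
  by (rule subspaceI) (auto simp: below_def lookup_add lookup_scaleR)

lemma part_below: "k < n \<Longrightarrow> part k c \<in> below n"
  by (auto simp: below_def lookup_part)

lemma below_part: "c \<in> below n \<Longrightarrow> n \<le> k \<Longrightarrow> part k c = 0"
  by (rule poly_mapping_eqI) (auto simp: below_def lookup_part)

lemma below_0: "below 0 = {0}"
  by (auto simp: below_def poly_mapping_eq_iff fun_eq_iff)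

lemma below_mono: "m \<le> n \<Longrightarrow> below m \<subseteq> below n"
  by (auto simp: below_def)

lemma below_sum_part: "c \<in> below n \<Longrightarrow> c = (\<Sum>k<n. part k c)"
  by (rule poly_mapping_eqI) (auto simp: below_def lookup_sum lookup_part leI)

lemma below_SucI: "c \<in> below (Suc n) \<Longrightarrow> part n c = 0 \<Longrightarrow> c \<in> below n"
  unfolding below_def by (auto simp: poly_mapping_eq_iff fun_eq_iff lookup_part)
    (metis Suc_leI le_neq_implies_less)

lemma ex_below: "\<exists>n. c \<in> below n"
proof (induction c rule: pm_induct)
  case (single k v)
  have "single k v \<in> below (Suc (size k))" by (auto simp: below_def lookup_single when_def)
  then show ?case ..
next
  case (add s t)
  then obtain m n where "s \<in> below m" "t \<in> below n" by blast
  then have "s \<in> below (max m n)" "t \<in> below (max m n)"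
    using below_mono[of m "max m n"] below_mono[of n "max m n"] by auto
  then show ?case using subspace_add[OF subspace_below] by blast
qed

lemma dmom_below: "c \<in> below (Suc n) \<Longrightarrow> dmom i c \<in> below n"
  by (auto simp: below_def lookup_dmom)

lemma mom_below: "c \<in> below n \<Longrightarrow> mom i * c \<in> below (Suc n)"
proof -
  assume c: "c \<in> below n"
  have "mom i * c = (\<Sum>k<n. mom i * part k c)"
    by (subst below_sum_part[OF c]) (simp add: sum_distrib_left)
  moreover have "mom i * part k c \<in> below (Suc n)" if "k < n" for k
    using part_below[of "Suc k" "Suc n" "mom i * c"] that by (simp add: part_mom_mult)
  ultimately show ?thesis by (simp only:) (rule subspace_sum[OF subspace_below], auto)
qed

lemma of_nat_mult_sfun_eq_0:
  fixes f :: "'d::finite sfun"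
  assumes "of_nat k * f = 0" "k \<noteq> 0"
  shows "f = 0"
proof -
  have "real k *\<^sub>R f = 0" using assms(1) by (simp add: scaleR_conv_of_real)
  with assms(2) show ?thesis by simp
qed

lemma dmom_eq_0_imp_cst:
  assumes "\<And>i. dmom i c = 0"
  shows "c = cst (lookup c {#})"
proof (rule poly_mapping_eqI)
  fix \<alpha>
  show "lookup c \<alpha> = lookup (cst (lookup c {#})) \<alpha>"
  proof (cases \<alpha>)
    case empty
    then show ?thesis by (simp add: cst_def)
  next
    case (add i \<beta>)
    have "of_nat (Suc (count \<beta> i)) * lookup c (add_mset i \<beta>) = 0"
      unfolding lookup_dmom[symmetric] assms by simp
    then have "lookup c (add_mset i \<beta>) = 0"
      by (rule of_nat_mult_sfun_eq_0) simp
    then show ?thesis using add by (simp add: cst_def lookup_single)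
  qed
qed

text \<open>Differentiate in the momenta until the degree drops to zero.\<close>

lemma symbol_eq_0_by_dmom:
  assumes cst: "\<And>f. Z (cst f) \<Longrightarrow> f = 0" and dmom: "\<And>i c. Z c \<Longrightarrow> Z (dmom i c)" and "Z c"
  shows "c = 0"
proof -
  have "Z c \<Longrightarrow> c = 0" if "c \<in> below n" for n
    using that
  proof (induction n arbitrary: c)
    case 0
    then show ?case by (simp add: below_0)
  next
    case (Suc n)
    have "dmom i c = 0" for i
      using Suc dmom_below dmom by blast
    then have "c = cst (lookup c {#})" by (rule dmom_eq_0_imp_cst)
    with Suc.prems cst show ?case by (metis cst_simps(1))
  qed
  with \<open>Z c\<close> ex_below show ?thesis by blast
qed

text \<open>Euler's identity for polynomials homogeneous of degree \<open>k\<close> in the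
  momenta.\<close>

lemma sum_mom_dmom_part: "(\<Sum>j\<in>UNIV. mom j * dmom j (part k c)) = of_nat k * part k c"
proof -
  have single: "(\<Sum>j\<in>UNIV. mom j * dmom j (single \<alpha> f)) = of_nat (size \<alpha>) * single \<alpha> f" for \<alpha> and f :: "'a sfun"
  proof (induction \<alpha>)
    case empty
    then show ?case by (simp add: cst_def[symmetric])
  next
    case (add i \<alpha>)
    have "(\<Sum>j\<in>UNIV. mom j * dmom j (mom i * single \<alpha> f))
      = (\<Sum>j\<in>UNIV. (if j = i then mom i * single \<alpha> f else 0) + mom i * (mom j * dmom j (single \<alpha> f)))"
      by (intro sum.cong refl) (simp add: distrib_left mult.left_commute)
    also have "\<dots> = mom i * single \<alpha> f + mom i * (of_nat (size \<alpha>) * single \<alpha> f)"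
      by (simp only: sum.distrib sum_distrib_left[symmetric] add.IH) simp
    finally show ?case
      by (simp only: mom_mult_single size_add_mset of_nat_Suc distrib_right mult_1 mult.left_commute[of "mom i"])
  qed
  show ?thesis
  proof (rule additive_eqI[where s = c])
    fix \<alpha> and f :: "'a sfun"
    show "(\<Sum>j\<in>UNIV. mom j * dmom j (part k (single \<alpha> f))) = of_nat k * part k (single \<alpha> f)"
      using single[of \<alpha> f] by (auto simp: part_single dmom_linear)
  qed (simp_all only: part_linear dmom_linear distrib_left sum.distrib)
qed

section \<open>Normal ordering\<close>

text \<open>Symmetry of second derivatives is what makes a derivative indexed by a multiset well
  defined.\<close>

interpretation partial: comp_fun_commute partial
  by standard (simp add: fun_eq_iff partial_commute)

definition mpartial :: "'d::finite multiset \<Rightarrow> 'd sfun \<Rightarrow> 'd sfun" where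
  "mpartial \<alpha> g = fold_mset partial g \<alpha>"

lemma mpartial_empty [simp]: "mpartial {#} g = g"
  by (simp add: mpartial_def)

lemma mpartial_add_mset [simp]: "mpartial (add_mset i \<alpha>) g = mpartial \<alpha> (partial i g)"
  by (simp add: mpartial_def partial.fold_mset_fun_left_comm)

lemma mpartial_mset: "mpartial (mset is) g = partials is g"
  by (induction "is" arbitrary: g) auto

lemma linear_mpartial: "linear (mpartial \<alpha>)"
proof (induction \<alpha>)
  case empty
  show ?case using linear_id by (simp add: id_def mpartial_def)
next
  case (add i \<alpha>)
  from linear_compose[OF linear_partial[of i] this] show ?case by (simp add: o_def)
qed

definition normal_op :: "'d::finite sym \<Rightarrow> 'd sfun \<Rightarrow> 'd sfun" where
  "normal_op c g = pm_sum (\<lambda>\<alpha> f. f * mpartial \<alpha> g) c"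

lemma linear_normal_op_sym: "linear (\<lambda>c. normal_op c g)"
  unfolding normal_op_def using linear_pm_sum[OF linear_mult_right] .

lemma linear_normal_op: "linear (normal_op c)"
  unfolding normal_op_def pm_sum_def
  by (intro linear_compose_sum ballI linear_compose[OF linear_mpartial linear_mult_left, unfolded o_def])

lemmas normal_op_linear = linear_0[OF linear_normal_op] linear_add[OF linear_normal_op]
  linear_diff[OF linear_normal_op] linear_neg[OF linear_normal_op] linear_scale[OF linear_normal_op]
  linear_sum[OF linear_normal_op]
  linear_0[OF linear_normal_op_sym] linear_add[OF linear_normal_op_sym]
  linear_diff[OF linear_normal_op_sym] linear_neg[OF linear_normal_op_sym]
  linear_scale[OF linear_normal_op_sym] linear_sum[OF linear_normal_op_sym]

lemma normal_op_single: "normal_op (single \<alpha> f) g = f * mpartial \<alpha> g"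
  by (simp add: normal_op_def pm_sum_single)

lemma normal_op_cst [simp]: "normal_op (cst f) g = f * g"
  by (simp add: cst_def normal_op_single)

lemma normal_op_cst_mult [simp]: "normal_op (cst f * c) g = f * normal_op c g"
  by (rule additive_eqI[where s = c])
    (simp_all add: distrib_left normal_op_linear cst_mult_single normal_op_single mult.assoc)

lemma normal_op_mom_mult [simp]: "normal_op (mom i * c) g = normal_op c (partial i g)"
  by (rule additive_eqI[where s = c])
    (simp_all add: distrib_left normal_op_linear mom_mult_single normal_op_single)

text \<open>Leibniz rule for composition with a derivative on the left. With its counterpart
  \<open>normal_op_coord\<close> for a coordinate on the right, it turns commutators with projective
  fields into computations on symbols.\<close>

lemma partial_normal_op: "partial i (normal_op c g) = normal_op (dpos i c + mom i * c) g"
proof (induction c arbitrary: g rule: sym_induct)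
  case (mom j c)
  then show ?case by (simp add: normal_op_linear partial_commute[of i j])
next
  case (cst f)
  have "mom i * cst f = cst f * mom i" by (rule mult.commute)
  then have "normal_op (mom i * cst f) g = f * partial i g" by simp
  then show ?case by (simp add: normal_op_linear partial_mult add.commute)
qed (simp add: normal_op_linear dpos_linear partial_add distrib_left)

lemma normal_op_coord: "normal_op c (coord k * g) = normal_op (cst (coord k) * c + dmom k c) g"
proof (induction c arbitrary: g rule: sym_induct)
  case (mom i c)
  have "partial i (coord k * g) = coord k * partial i g + (if k = i then g else 0)"
    by (simp add: partial_mult partial_coord)
  then have "normal_op (mom i * c) (coord k * g)
      = normal_op c (coord k * partial i g) + (if k = i then normal_op c g else 0)"
    by (simp add: normal_op_linear)
  then show ?case using mom[of "partial i g"]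
    by (auto simp: normal_op_linear)
qed (simp_all add: normal_op_linear dmom_linear algebra_simps)

text \<open>The commutator with a coordinate is the momentum derivative on symbols, so the symbols
  of the zero operator are stable under momentum derivatives; a symbol of degree zero is recovered
  by applying the operator to 1.\<close>

lemma normal_op_inject: "normal_op c = normal_op c' \<longleftrightarrow> c = c'"
proof
  assume eq: "normal_op c = normal_op c'"
  have "c - c' = 0"
  proof (rule symbol_eq_0_by_dmom[where Z = "\<lambda>c. \<forall>g. normal_op c g = 0"])
    show "f = 0" if "\<forall>g. normal_op (cst f) g = 0" for f :: "'a sfun"
      using that[rule_format, of 1] by simp
    show "\<forall>g. normal_op (dmom i c) g = 0" if "\<forall>g. normal_op c g = 0" for i and c :: "'a sym"
    proof
      fix g
      have "normal_op (dmom i c) g = normal_op c (coord i * g) - coord i * normal_op c g"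
        by (simp add: normal_op_coord normal_op_linear)
      then show "normal_op (dmom i c) g = 0" using that by simp
    qed
    show "\<forall>g. normal_op (c - c') g = 0" using eq by (simp add: normal_op_linear)
  qed
  then show "c = c'" by simp
qed simp

section \<open>Coefficients indexed by lists and by multisets\<close>

definition tensor :: "'d::finite list set \<Rightarrow> ('d list \<Rightarrow> 'd sfun) \<Rightarrow> 'd sym" where
  "tensor I S = (\<Sum>is\<in>I. single (mset is) (S is))"

lemma finite_lists_of_length: "finite {is :: 'd::finite list. length is \<le> n}"
  "finite {is :: 'd::finite list. length is < n}" "finite {is :: 'd::finite list. length is = n}"
proof -
  show le: "finite {is :: 'd list. length is \<le> n}"
    using finite_lists_length_le[of "UNIV :: 'd set" n] by simp
  show "finite {is :: 'd list. length is < n}" "finite {is :: 'd list. length is = n}"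
    by (auto intro: finite_subset[OF _ le])
qed

lemma lookup_tensor:
  "finite I \<Longrightarrow> lookup (tensor I S) \<alpha> = (\<Sum>is\<in>I. if mset is = \<alpha> then S is else 0)"
  unfolding tensor_def lookup_sum by (simp add: lookup_single when_def)

lemma ex_tensor:
  fixes c :: "'d::finite sym"
  assumes fin: "finite {is :: 'd list. P (length is)}" and c: "\<And>\<alpha>. lookup c \<alpha> \<noteq> 0 \<Longrightarrow> P (size \<alpha>)"
  shows "\<exists>S. c = tensor {is. P (length is)} S"
proof -
  \<comment> \<open>One chosen ordering of each multiset carries the whole coefficient; all other
    orderings get zero.\<close>
  define e :: "'d multiset \<Rightarrow> 'd list" where "e \<alpha> = (SOME is. mset is = \<alpha>)" for \<alpha>
  have e: "mset (e \<alpha>) = \<alpha>" for \<alpha>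
    unfolding e_def by (rule someI_ex) (rule ex_mset)
  define S where "S is = (if is = e (mset is) then lookup c (mset is) else 0)" for "is"
  have "c = tensor {is. P (length is)} S"
  proof (rule poly_mapping_eqI)
    fix \<alpha>
    have "lookup (tensor {is. P (length is)} S) \<alpha>
        = (\<Sum>is | P (length is). if is = e \<alpha> then lookup c \<alpha> else 0)"
      unfolding lookup_tensor[OF fin] by (intro sum.cong) (auto simp: S_def e)
    also have "\<dots> = lookup c \<alpha>"
      using c[of \<alpha>] e[of \<alpha>] fin by (auto simp: simp flip: size_mset)
    finally show "lookup c \<alpha> = lookup (tensor {is. P (length is)} S) \<alpha>" ..
  qed
  then show ?thesis by blast
qed

lemma range_tensor: "range (tensor {is :: 'd::finite list. length is < n}) = below n"
proof
  show "range (tensor {is :: 'd::finite list. length is < n}) \<subseteq> below n"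
    by (auto simp: below_def lookup_tensor finite_lists_of_length intro!: sum.neutral)
  show "below n \<subseteq> range (tensor {is :: 'd::finite list. length is < n})"
  proof
    fix c :: "'d sym"
    assume "c \<in> below n"
    then have "\<exists>S. c = tensor {is. length is < n} S"
      by (intro ex_tensor finite_lists_of_length) (auto simp: below_def not_less[symmetric])
    then show "c \<in> range (tensor {is. length is < n})" by blast
  qed
qed

lemma part_tensor: "part k (tensor {is. length is \<le> k} S) = tensor {is. length is = k} S"
proof (rule poly_mapping_eqI)
  fix \<alpha>
  have "(\<Sum>is | length is \<le> k. if mset is = \<alpha> then S is else 0)
      = (\<Sum>is | length is = k. if mset is = \<alpha> then S is else 0)" if "size \<alpha> = k"
    by (rule sum.mono_neutral_right) (use that in \<open>auto simp: finite_lists_of_length\<close>)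
  moreover have "(\<Sum>is | length is = k. if mset is = \<alpha> then S is else 0) = 0" if "size \<alpha> \<noteq> k"
    by (rule sum.neutral) (use that in auto)
  ultimately show "lookup (part k (tensor {is. length is \<le> k} S)) \<alpha> = lookup (tensor {is. length is = k} S) \<alpha>"
    by (simp add: lookup_part lookup_tensor finite_lists_of_length)
qed

lemma diff_op_eq: "diff_op n S = normal_op (tensor {is. length is \<le> n} S)"
  by (simp add: fun_eq_iff diff_op_def tensor_def normal_op_linear normal_op_single mpartial_mset)

lemma diff_ops_eq: "diff_ops n = normal_op ` below (Suc n)"
  unfolding diff_ops_def diff_op_eq range_tensor[symmetric] by (auto simp: less_Suc_eq_le)

section \<open>Symbols as functions\<close>

definition sym_fun :: "'d::finite sym \<Rightarrow> 'd symbol" where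
  "sym_fun c x \<xi> = pm_sum (\<lambda>\<alpha> f. val f x * (\<Prod>i\<in>#\<alpha>. \<xi> $ i)) c"

lemma linear_sym_fun: "linear (\<lambda>c. sym_fun c x \<xi>)"
  unfolding sym_fun_def
  by (rule linear_pm_sum, rule linearI) (simp_all add: algebra_simps)

lemmas sym_fun_linear = linear_0[OF linear_sym_fun] linear_add[OF linear_sym_fun]
  linear_diff[OF linear_sym_fun] linear_neg[OF linear_sym_fun]
  linear_scale[OF linear_sym_fun] linear_sum[OF linear_sym_fun]

lemma sym_fun_single: "sym_fun (single \<alpha> f) x \<xi> = val f x * (\<Prod>i\<in>#\<alpha>. \<xi> $ i)"
  by (simp add: sym_fun_def pm_sum_single)

lemma sym_fun_cst [simp]: "sym_fun (cst f) x \<xi> = val f x"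
  by (simp add: cst_def sym_fun_single)

lemma sym_fun_cst_mult [simp]: "sym_fun (cst f * c) x \<xi> = val f x * sym_fun c x \<xi>"
  by (rule additive_eqI[where s = c])
    (simp_all add: distrib_left sym_fun_linear cst_mult_single sym_fun_single)

lemma sym_fun_mom_mult [simp]: "sym_fun (mom i * c) x \<xi> = \<xi> $ i * sym_fun c x \<xi>"
  by (rule additive_eqI[where s = c])
    (simp_all add: distrib_left sym_fun_linear mom_mult_single sym_fun_single)

lemma smooth_sym_fun_pos:
  "smooth (\<lambda>y. sym_fun c y \<xi>) \<and> pderiv_at i (\<lambda>y. sym_fun c y \<xi>) = (\<lambda>x. sym_fun (dpos i c) x \<xi>)"
proof (induction c rule: sym_induct)
  case (cst f)
  then show ?case by (simp add: smooth_val val_partial)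
next
  case (mom j c)
  then show ?case
    using smooth_mult[OF smooth_const, of "\<lambda>y. sym_fun c y \<xi>" "\<xi> $ j"]
    by (auto simp: pderiv_at_mult smooth_differentiable pderiv_at_const)
next
  case (add c c')
  then show ?case
    by (simp add: sym_fun_linear dpos_linear smooth_add pderiv_at_add smooth_differentiable)
qed

lemma smooth_sym_fun_mom:
  "smooth (sym_fun c x) \<and> pderiv_at i (sym_fun c x) = sym_fun (dmom i c) x"
proof (induction c rule: sym_induct)
  case (cst f)
  have "sym_fun (cst f) x = (\<lambda>\<xi>. val f x)" by auto
  then show ?case by (simp add: smooth_const pderiv_at_const fun_eq_iff sym_fun_linear)
next
  case (mom j c)
  have eq: "sym_fun (mom j * c) x = (\<lambda>\<xi>. val (coord j) \<xi> * sym_fun c x \<xi>)" by auto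
  have "pderiv_at i (\<lambda>\<xi>. val (coord j) \<xi> * sym_fun c x \<xi>)
      = (\<lambda>\<xi>. val (coord j) \<xi> * pderiv_at i (sym_fun c x) \<xi> + pderiv_at i (val (coord j)) \<xi> * sym_fun c x \<xi>)"
    by (rule pderiv_at_mult) (use mom smooth_val smooth_differentiable in blast)+
  then show ?case
    using mom smooth_mult[OF smooth_val[of "coord j"], of "sym_fun c x"]
    by (auto simp: eq fun_eq_iff sym_fun_linear val_partial[symmetric] partial_coord)
next
  case (add c c')
  have eq: "sym_fun (c + c') x = (\<lambda>\<xi>. sym_fun c x \<xi> + sym_fun c' x \<xi>)" by (auto simp: sym_fun_linear)
  show ?case using add
    by (auto simp: eq smooth_add pderiv_at_add smooth_differentiable fun_eq_iff dmom_linear sym_fun_linear)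
qed

definition lieS :: "'d::finite vfield \<Rightarrow> 'd sym \<Rightarrow> 'd sym" where
  "lieS K c = (\<Sum>i\<in>UNIV. cst (K $ i) * dpos i c)
    - (\<Sum>i\<in>UNIV. \<Sum>j\<in>UNIV. cst (partial i (K $ j)) * (mom j * dmom i c))"

lemma lie_symbol_sym_fun: "lie_symbol K (sym_fun c) = sym_fun (lieS K c)"
proof (intro ext)
  fix x \<xi>
  show "lie_symbol K (sym_fun c) x \<xi> = sym_fun (lieS K c) x \<xi>"
    unfolding lie_symbol_def lieS_def
    by (simp add: sym_fun_linear smooth_sym_fun_pos smooth_sym_fun_mom val_partial mult.assoc)
qed

lemma sym_fun_inject: "sym_fun c = sym_fun c' \<longleftrightarrow> c = c'"
proof
  assume eq: "sym_fun c = sym_fun c'"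
  have "c - c' = 0"
  proof (rule symbol_eq_0_by_dmom[where Z = "\<lambda>c. sym_fun c = (\<lambda>x \<xi>. 0)"])
    show "f = 0" if "sym_fun (cst f) = (\<lambda>x \<xi>. 0)" for f :: "'a sfun"
      using that by (intro sfun_eqI) (metis sym_fun_cst val_simps(1))
    show "sym_fun (dmom i c) = (\<lambda>x \<xi>. 0)" if "sym_fun c = (\<lambda>x \<xi>. 0)" for i and c :: "'a sym"
      using smooth_sym_fun_mom[of c _ i] that by (auto simp: fun_eq_iff pderiv_at_const)
    show "sym_fun (c - c') = (\<lambda>x \<xi>. 0)" using eq by (simp add: fun_eq_iff sym_fun_linear)
  qed
  then show "c = c'" by simp
qed simp

lemma tensor_symbol_eq: "tensor_symbol I S = sym_fun (tensor I S)"
  by (simp add: fun_eq_iff tensor_symbol_def tensor_def sym_fun_linear sym_fun_single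
      flip: prod_mset_prod_list)

lemma symbols_below_eq: "symbols_below n = sym_fun ` below n"
  unfolding symbols_below_def tensor_symbol_eq range_tensor[symmetric] by auto

lemma symbols_eq: "symbols = range sym_fun"
  unfolding symbols_def symbols_below_eq using ex_below by blast

text \<open>The coefficients \<open>S\<close> of an operator are not unique, since permuted lists
  contribute to the same derivative. Only their sums over permutations are determined, and the
  principal symbol depends on nothing else, so the definite description denotes.\<close>

lemma principal_symbol_normal_op:
  assumes "c \<in> below (Suc k)"
  shows "principal_symbol k (normal_op c) = sym_fun (part k c)"
proof -
  have *: "tensor_symbol {is. length is = k} S = sym_fun (part k c)"
    if "normal_op c = diff_op k S" for S
    using that by (simp add: diff_op_eq normal_op_inject part_tensor tensor_symbol_eq)
  obtain S where S: "c = tensor {is. length is < Suc k} S"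
    using assms unfolding range_tensor[symmetric] by blast
  then have S': "normal_op c = diff_op k S" by (simp add: diff_op_eq less_Suc_eq_le)
  show ?thesis
    unfolding principal_symbol_def
  proof (rule the_equality)
    show "\<exists>S. normal_op c = diff_op k S \<and> sym_fun (part k c) = tensor_symbol {is. length is = k} S"
      using S' *[OF S'] by auto
  qed (use * in auto)
qed

section \<open>Equivariant quantisation\<close>

definition euler_pos :: "real ^ 'd::finite \<Rightarrow> 'd sym \<Rightarrow> 'd sym" where
  "euler_pos a c = (\<Sum>i\<in>UNIV. cst (pos a i) * dpos i c)"

definition euler_mom :: "'d::finite sym \<Rightarrow> 'd sym" where
  "euler_mom c = (\<Sum>i\<in>UNIV. mom i * dmom i c)"

text \<open>The pairing of \<open>x - a\<close> with the momentum, that is, the Hamiltonian of the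
  Euler field centred at \<open>a\<close>.\<close>

definition contraction :: "real ^ 'd::finite \<Rightarrow> 'd sym" where
  "contraction a = (\<Sum>i\<in>UNIV. cst (pos a i) * mom i)"

definition divergence :: "'d::finite sym \<Rightarrow> 'd sym" where
  "divergence c = (\<Sum>i\<in>UNIV. dpos i (dmom i c))"

definition quad :: "real ^ 'd::finite \<Rightarrow> 'd \<Rightarrow> 'd vfield" where
  "quad a k = (\<chi> i. pos a k * pos a i)"

lemma linear_lieS: "linear (lieS K)"
  by (rule linearI) (simp_all add: lieS_def dpos_linear dmom_linear distrib_left sum.distrib
      scaleR_sum_right scaleR_diff_right)

lemma linear_euler_pos: "linear (euler_pos a)"
  by (rule linearI) (simp_all add: euler_pos_def dpos_linear distrib_left sum.distrib scaleR_sum_right)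

lemma linear_euler_mom: "linear euler_mom"
  by (rule linearI) (simp_all add: euler_mom_def dmom_linear distrib_left sum.distrib scaleR_sum_right)

lemma linear_divergence: "linear divergence"
  by (rule linearI) (simp_all add: divergence_def dpos_linear dmom_linear sum.distrib scaleR_sum_right)

lemmas euler_mom_linear = linear_0[OF linear_euler_mom] linear_add[OF linear_euler_mom]
  linear_diff[OF linear_euler_mom] linear_scale[OF linear_euler_mom] linear_sum[OF linear_euler_mom]
lemmas euler_pos_linear = linear_0[OF linear_euler_pos] linear_add[OF linear_euler_pos]
  linear_diff[OF linear_euler_pos] linear_scale[OF linear_euler_pos] linear_sum[OF linear_euler_pos]
lemmas divergence_linear = linear_0[OF linear_divergence] linear_add[OF linear_divergence]
  linear_diff[OF linear_divergence] linear_scale[OF linear_divergence] linear_sum[OF linear_divergence]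
lemmas lieS_linear = linear_0[OF linear_lieS] linear_add[OF linear_lieS]
  linear_diff[OF linear_lieS] linear_scale[OF linear_lieS] linear_sum[OF linear_lieS]

lemma linear_lieS_field: "linear (\<lambda>K. lieS K c)"
  by (rule linearI) (simp_all add: lieS_def cst_simps partial_add partial_scaleR distrib_right
      sum.distrib scaleR_sum_right scaleR_diff_right)

lemma linear_lie_density_field: "linear (\<lambda>K. lie_density K \<mu> f)"
  by (rule linearI) (simp_all add: lie_density_def partial_add partial_scaleR distrib_right
      sum.distrib scaleR_add_right flip: scaleR_sum_right)

lemma linear_lie_density: "linear (lie_density K \<mu>)"
  by (rule linearI) (simp_all add: lie_density_def partial_add partial_scaleR distrib_left
      sum.distrib scaleR_add_right scaleR_left_commute flip: scaleR_sum_right)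

lemma linear_ad_op_field:
  assumes "linear D"
  shows "linear (\<lambda>K. ad_op \<mu> K D f)"
  unfolding ad_op_def
  by (intro linear_compose_sub linear_lie_density_field
      linear_compose[OF linear_lie_density_field assms, unfolded o_def])

lemma part_lieS: "part k (lieS K c) = lieS K (part k c)"
  by (simp add: lieS_def part_linear part_cst_mult part_dpos part_mom_dmom)

lemma euler_mom_part: "euler_mom (part k c) = real k *\<^sub>R part k c"
  unfolding euler_mom_def sum_mom_dmom_part by (simp add: scaleR_conv_of_real)

lemma euler_mom_dmom_part: "euler_mom (dmom i (part k c)) = (real k - 1) *\<^sub>R dmom i (part k c)"
  by (cases k) (simp_all add: euler_mom_part euler_mom_linear flip: part_dmom)

lemma lieS_axis: "lieS (axis i f) c = cst f * dpos i c - mom i * (\<Sum>k\<in>UNIV. cst (partial k f) * dmom k c)"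
proof -
  have a: "(axis i f :: 'a vfield) $ j = (if j = i then f else 0)" for j by (simp add: axis_def)
  have 1: "(\<Sum>j\<in>UNIV. cst ((axis i f :: 'a vfield) $ j) * dpos j c) = cst f * dpos i c"
    by (simp add: a if_distrib[of cst] if_distrib[of "\<lambda>x. x * _"] cst_simps cong: if_cong)
  have "cst (partial k ((axis i f :: 'a vfield) $ j)) * (mom j * dmom k c)
     = (if j = i then mom i * (cst (partial k f) * dmom k c) else 0)" for j k
    by (simp add: a cst_simps mult.left_commute)
  then have 2: "(\<Sum>j\<in>UNIV. cst (partial k ((axis i f :: 'a vfield) $ j)) * (mom j * dmom k c))
     = mom i * (cst (partial k f) * dmom k c)" for k
    by simp
  show ?thesis unfolding lieS_def 1 2 by (simp add: sum_distrib_left)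
qed

lemma lieS_const: "lieS (axis i 1) c = dpos i c"
  by (simp add: lieS_axis cst_simps)

lemma lieS_coord: "lieS (axis i (coord k)) c = cst (coord k) * dpos i c - mom i * dmom k c"
proof -
  have "(\<Sum>j\<in>UNIV. cst (partial j (coord k)) * dmom j c) = dmom k c"
    by (simp add: partial_coord if_distrib[of cst] if_distrib[of "\<lambda>x. x * _"] cst_simps cong: if_cong)
  then show ?thesis by (simp add: lieS_axis)
qed

text \<open>In this form every term visibly vanishes at \<open>a\<close>. Evaluated there,
  equivariance under the quadratic fields therefore becomes a homogeneous linear relation.\<close>

lemma lieS_quad:
  "lieS (quad a k) c = cst (pos a k) * (euler_pos a c - euler_mom c) - contraction a * dmom k c"
proof -
  have 1: "(\<Sum>i\<in>UNIV. cst (quad a k $ i) * dpos i c) = cst (pos a k) * euler_pos a c"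
    by (simp add: quad_def euler_pos_def cst_simps sum_distrib_left mult.assoc)
  have "cst (partial i (quad a k $ j)) * (mom j * dmom i c)
      = (if j = i then cst (pos a k) * (mom i * dmom i c) else 0)
        + (if i = k then cst (pos a j) * mom j * dmom k c else 0)" for i j
    by (auto simp: quad_def partial_mult cst_simps distrib_right mult.assoc)
  then have "(\<Sum>i\<in>UNIV. \<Sum>j\<in>UNIV. cst (partial i (quad a k $ j)) * (mom j * dmom i c))
      = (\<Sum>i\<in>UNIV. cst (pos a k) * (mom i * dmom i c))
        + (\<Sum>i\<in>UNIV. \<Sum>j\<in>UNIV. if i = k then cst (pos a j) * mom j * dmom k c else 0)"
    by (simp add: sum.distrib)
  also have "(\<Sum>i\<in>UNIV. \<Sum>j\<in>UNIV. if i = k then cst (pos a j) * mom j * dmom k c else 0)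
      = (\<Sum>j\<in>UNIV. cst (pos a j) * mom j * dmom k c)"
    by (subst sum.swap) simp
  finally have 2: "(\<Sum>i\<in>UNIV. \<Sum>j\<in>UNIV. cst (partial i (quad a k $ j)) * (mom j * dmom i c))
      = cst (pos a k) * euler_mom c + contraction a * dmom k c"
    by (simp add: euler_mom_def contraction_def sum_distrib_left sum_distrib_right)
  show ?thesis unfolding lieS_def 1 2 by (simp add: right_diff_distrib)
qed

section \<open>Generators of the projective algebra centred at any point\<close>

lemma pos_0 [simp]: "pos 0 i = coord i"
  by (simp add: pos_def)

lemma proj_const: "axis i 1 \<in> proj" and proj_coord: "axis i (coord k) \<in> proj"
  and proj_quad_0: "quad 0 k \<in> proj"
proof -
  show "axis i 1 \<in> proj" "axis i (coord k) \<in> proj"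
    unfolding proj_def by (intro span_base; force)+
  have "(\<chi> i. coord k * coord i) \<in> proj" unfolding proj_def by (intro span_base) blast
  then show "quad 0 k \<in> proj" by (simp add: quad_def)
qed

lemma subspace_proj: "subspace proj"
  unfolding proj_def by (rule subspace_span)

lemma proj_pos: "axis i (pos a k) \<in> proj"
proof -
  have "axis i (pos a k) = axis i (coord k) - (a $ k) *\<^sub>R axis i 1"
    by (simp add: vec_eq_iff axis_def pos_def Real_Vector_Spaces.of_real_def)
  then show ?thesis
    by (simp only:) (intro subspace_diff subspace_scale subspace_proj proj_const proj_coord)
qed

lemma proj_euler: "(\<chi> i. pos a i) \<in> proj"
proof -
  have "(\<chi> i. pos a i) = (\<Sum>i\<in>UNIV. axis i (pos a i))"
    by (simp add: vec_eq_iff axis_def)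
  then show ?thesis by (simp only:) (intro subspace_sum subspace_proj proj_pos)
qed

text \<open>The projective algebra is invariant under translations: recentring a quadratic generator
  changes it by linear and constant fields.\<close>

lemma proj_quad: "quad a k \<in> proj"
proof -
  have "quad a k = quad 0 k - (\<Sum>i\<in>UNIV. (a $ i) *\<^sub>R axis i (coord k)) - (a $ k) *\<^sub>R (\<chi> i. pos a i)"
    by (simp add: vec_eq_iff axis_def quad_def sum_component if_distrib[of "(*\<^sub>R) _"] cong: if_cong)
      (simp add: pos_def algebra_simps scaleR_conv_of_real)
  then show ?thesis
    by (simp only:)
      (intro subspace_diff subspace_scale subspace_sum subspace_proj proj_coord proj_quad_0 proj_euler)
qed

lemma lieS_euler: "lieS (\<chi> i. pos a i) c = euler_pos a c - euler_mom c"
proof -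
  have "cst (partial i ((\<chi> i. pos a i) $ j)) * (mom j * dmom i c)
      = (if j = i then mom i * dmom i c else 0)" for i j
    by (auto simp: cst_simps)
  then show ?thesis by (simp add: lieS_def euler_pos_def euler_mom_def)
qed

lemma proj_induct [consumes 1, case_names const coord quad add scale]:
  assumes "K \<in> proj"
    and "\<And>i. P (axis i 1)" "\<And>i k. P (axis i (coord k))" "\<And>k. P (quad 0 k)"
    and "\<And>K K'. P K \<Longrightarrow> P K' \<Longrightarrow> P (K + K')" "\<And>r K. P K \<Longrightarrow> P (r *\<^sub>R K)"
  shows "P K"
proof -
  have "P 0" using assms(6)[OF assms(2), of 0] by simp
  then have sub: "subspace {K. P K}"
    using assms(5,6) by (intro subspaceI) auto
  have "P (\<chi> i. coord k * coord i)" for k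
    using assms(4)[of k] by (simp add: quad_def)
  then have "range (\<lambda>i. axis i 1) \<union> range (\<lambda>(k, i). axis i (coord k)) \<union> range (\<lambda>k. \<chi> i. coord k * coord i) \<subseteq> {K. P K}"
    using assms(2,3) by auto
  from span_minimal[OF this sub] assms(1) show ?thesis by (auto simp: proj_def)
qed

subsection \<open>Commutators with the Lie derivative\<close>

lemma lie_density_axis:
  "lie_density (axis i f) \<mu> g = f * partial i g + \<mu> *\<^sub>R (partial i f * g)"
  by (simp add: lie_density_def axis_def if_distrib[of "\<lambda>x. x * _"] if_distrib[of "partial _"] cong: if_cong)

lemma ad_op_const: "ad_op \<mu> (axis i 1) (normal_op c) = normal_op (dpos i c)"
  by (rule ext) (simp add: ad_op_def lie_density_axis partial_normal_op normal_op_linear)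

text \<open>A linear field has constant divergence, so the weight contributes a multiple of the
  identity and drops out of the commutator. Normal ordering is thus already equivariant under affine
  fields, for every weight.\<close>

lemma ad_op_coord:
  "ad_op \<mu> (axis i (coord k)) (normal_op c) = normal_op (lieS (axis i (coord k)) c)"
proof
  fix f
  have "normal_op c (coord k * partial i f) = normal_op (mom i * (cst (coord k) * c + dmom k c)) f"
    by (simp only: normal_op_coord normal_op_mom_mult)
  then show "ad_op \<mu> (axis i (coord k)) (normal_op c) f = normal_op (lieS (axis i (coord k)) c) f"
    by (auto simp: ad_op_def lie_density_axis lieS_coord partial_coord partial_normal_op normal_op_linear
        distrib_left)
qed

lemma lie_density_quad:
  "lie_density (quad 0 k) \<mu> (f :: 'd::finite sfun) = coord k * (\<Sum>i\<in>UNIV. coord i * partial i f)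
    + (\<mu> * (real CARD('d) + 1)) *\<^sub>R (coord k * f)"
proof -
  have "partial i (quad 0 k $ i) = coord k + (if i = k then coord k else 0)" for i :: 'd
    by (auto simp: quad_def partial_mult partial_coord)
  \<comment> \<open>The origin of the constant \<open>d + 1\<close> in the quantisation: it is the
    divergence of a quadratic field divided by the coordinate.\<close>
  then have "(\<Sum>i\<in>UNIV. partial i (quad 0 k $ i)) = (real CARD('d) + 1) *\<^sub>R coord k"
    by (simp add: sum.distrib scaleR_conv_of_real distrib_right)
  then show ?thesis
    by (simp add: lie_density_def quad_def sum_distrib_left mult.assoc)
qed

text \<open>The last two terms are the defect of normal ordering. On a homogeneous component both
  are multiples of \<open>dmom k\<close>, with a factor that depends on the weight and the
  degree.\<close>

lemma ad_op_quad:
  "ad_op \<mu> (quad 0 k) (normal_op (c :: 'd::finite sym)) = normal_op (lieS (quad 0 k) c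
    - (\<mu> * (real CARD('d) + 1)) *\<^sub>R dmom k c - euler_mom (dmom k c))"
proof
  fix f :: "'d sfun"
  let ?R = "\<lambda>i c. cst (coord i) * c + dmom i c"
  have L: "lie_density (quad 0 k) \<mu> (normal_op c f) = normal_op
     (cst (coord k) * (\<Sum>i\<in>UNIV. cst (coord i) * (dpos i c + mom i * c))
      + (\<mu> * (real CARD('d) + 1)) *\<^sub>R (cst (coord k) * c)) f"
    by (simp only: lie_density_quad partial_normal_op normal_op_cst_mult normal_op_linear)
  have "normal_op c (coord k * (\<Sum>i\<in>UNIV. coord i * partial i f))
     = (\<Sum>i\<in>UNIV. normal_op (mom i * ?R i (?R k c)) f)"
    unfolding sum_distrib_left linear_sum[OF linear_normal_op]
    by (simp only: normal_op_coord normal_op_mom_mult)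
  then have R: "normal_op c (lie_density (quad 0 k) \<mu> f) = normal_op ((\<Sum>i\<in>UNIV. mom i * ?R i (?R k c))
      + (\<mu> * (real CARD('d) + 1)) *\<^sub>R ?R k c) f"
    by (simp only: lie_density_quad normal_op_linear normal_op_coord)
  have "(\<Sum>i\<in>UNIV. mom i * ?R i (?R k c)) = cst (coord k) * (\<Sum>i\<in>UNIV. cst (coord i) * (mom i * c))
    + contraction 0 * dmom k c + cst (coord k) * euler_mom c + euler_mom (dmom k c)"
    by (simp add: contraction_def euler_mom_def dmom_linear distrib_left distrib_right sum.distrib
      sum_distrib_left sum_distrib_right mult.assoc mult.left_commute add_ac)
  then show "ad_op \<mu> (quad 0 k) (normal_op c) f = normal_op (lieS (quad 0 k) c
    - (\<mu> * (real CARD('d) + 1)) *\<^sub>R dmom k c - euler_mom (dmom k c)) f"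
    unfolding ad_op_def L R lieS_quad linear_diff[OF linear_normal_op_sym, symmetric]
    by (intro arg_cong[of _ _ "\<lambda>c. normal_op c f"])
      (simp add: euler_pos_def algebra_simps sum.distrib)
qed

lemma divergence_cst_pos_mult:
  "divergence (cst (pos a k) * c) = cst (pos a k) * divergence c + dmom k c"
proof -
  have "dpos i (dmom i (cst (pos a k) * c))
      = (if i = k then dmom k c else 0) + cst (pos a k) * dpos i (dmom i c)" for i
    by (auto simp: cst_simps)
  then show ?thesis by (simp add: divergence_def sum.distrib sum_distrib_left add.commute)
qed

lemma divergence_mom_mult: "divergence (mom k * c) = mom k * divergence c + dpos k c"
proof -
  have "dpos i (dmom i (mom k * c)) = (if i = k then dpos k c else 0) + mom k * dpos i (dmom i c)" for i
    by (auto simp: dpos_linear)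
  then show ?thesis by (simp add: divergence_def sum.distrib sum_distrib_left add.commute)
qed

lemma divergence_dpos: "divergence (dpos i c) = dpos i (divergence c)"
  by (simp add: divergence_def dpos_linear dpos_dmom_commute dpos_commute)

lemma divergence_dmom: "divergence (dmom i c) = dmom i (divergence c)"
  by (simp add: divergence_def dmom_linear dpos_dmom_commute dmom_commute)

lemma divergence_euler_pos: "divergence (euler_pos a c) = euler_pos a (divergence c) + divergence c"
  by (simp add: euler_pos_def divergence_linear divergence_cst_pos_mult divergence_dpos sum.distrib)
    (simp add: divergence_def dpos_dmom_commute)

lemma divergence_euler_mom: "divergence (euler_mom c) = euler_mom (divergence c) + divergence c"
  by (simp add: euler_mom_def divergence_linear divergence_mom_mult divergence_dmom sum.distrib)
    (simp add: divergence_def dpos_dmom_commute)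

lemma divergence_contraction:
  fixes c :: "'d::finite sym"
  shows "divergence (contraction a * c) = contraction a * divergence c + euler_pos a c
    + real CARD('d) *\<^sub>R c + euler_mom c"
proof -
  have "divergence (cst (pos a i) * mom i * c)
      = cst (pos a i) * mom i * divergence c + cst (pos a i) * dpos i c + c + mom i * dmom i c" for i
    by (simp add: mult.assoc divergence_cst_pos_mult divergence_mom_mult distrib_left)
  then show ?thesis
    by (simp add: contraction_def euler_pos_def euler_mom_def sum_distrib_right divergence_linear
        sum.distrib scaleR_conv_of_real)
qed

lemma dmom_euler_pos: "dmom k (euler_pos a c) = euler_pos a (dmom k c)"
  by (simp add: euler_pos_def dmom_linear dpos_dmom_commute)

lemma dmom_euler_mom: "dmom k (euler_mom c) = dmom k c + euler_mom (dmom k c)"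
proof -
  have "dmom k (mom i * dmom i c) = (if i = k then dmom k c else 0) + mom i * dmom i (dmom k c)" for i
    by (auto simp: dmom_commute)
  then show ?thesis by (simp add: euler_mom_def dmom_linear sum.distrib)
qed

text \<open>The divergence fails to commute with quadratic fields by terms of the same shape as the
  defect of normal ordering. Hence a series in the divergence can cancel that defect.\<close>

lemma divergence_lieS_quad:
  fixes c :: "'d::finite sym"
  shows "divergence (lieS (quad a k) c) = lieS (quad a k) (divergence c)
    - (real CARD('d) + 1) *\<^sub>R dmom k c - 2 *\<^sub>R euler_mom (dmom k c)"
  by (simp add: lieS_quad divergence_linear divergence_cst_pos_mult divergence_contraction
      divergence_euler_pos divergence_euler_mom dmom_linear dmom_euler_pos dmom_euler_mom
      divergence_dmom right_diff_distrib distrib_left)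
    (simp add: algebra_simps scaleR_2)

lemma divergence_lieS_const: "divergence (lieS (axis i 1) c) = lieS (axis i 1) (divergence c)"
  by (simp add: lieS_const divergence_dpos)

lemma divergence_lieS_coord:
  "divergence (lieS (axis i (coord k)) c) = lieS (axis i (coord k)) (divergence c)"
  using divergence_cst_pos_mult[of 0 k "dpos i c"]
  by (simp add: lieS_coord divergence_linear divergence_mom_mult divergence_dpos divergence_dmom
      dpos_dmom_commute)

lemma part_divergence: "part k (divergence c) = divergence (part (Suc k) c)"
  by (simp add: divergence_def part_linear part_dpos part_dmom)

lemma divergence_funpow_part: "r \<le> k \<Longrightarrow> (divergence ^^ r) (part k c) = part (k - r) ((divergence ^^ r) c)"
proof (induction r)
  case (Suc r)
  then have "Suc (k - Suc r) = k - r" by simp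
  with Suc show ?case by (simp add: part_divergence)
qed simp

lemma linear_divergence_funpow: "linear (divergence ^^ r)"
proof (induction r)
  case (Suc r)
  from linear_compose[OF this linear_divergence] show ?case by (simp add: o_def)
qed (auto intro: linearI)

section \<open>Quantisation as a series in the divergence\<close>

text \<open>
  The recursion makes \<open>\<Sum>r. quant_coeff d \<mu> k r *\<^sub>R (divergence ^^ r)\<close> absorb the defect terms in
  the commutator of the normal ordered operator with a quadratic field.
\<close>

primrec quant_coeff :: "real \<Rightarrow> real \<Rightarrow> nat \<Rightarrow> nat \<Rightarrow> real" where
  "quant_coeff d \<mu> k 0 = 1"
| "quant_coeff d \<mu> k (Suc r) =
    quant_coeff d \<mu> k r * (\<mu> * (d + 1) + real k - real r - 1) / ((real r + 1) * (2 * real k + d - real r - 1))"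

text \<open>The divisor is positive because \<open>r < k\<close> makes \<open>2 * k - r - 1\<close>
  at least \<open>k\<close>. Hence no resonance occurs, whatever the weight.\<close>

lemma quant_coeff_rec:
  assumes "r < k" "d \<ge> 0"
  shows "quant_coeff d \<mu> k (Suc r) * ((real r + 1) * (2 * real k + d - real r - 1))
    = quant_coeff d \<mu> k r * (\<mu> * (d + 1) + real k - real r - 1)"
proof -
  have "2 * real k + d - real r - 1 > 0" using assms by linarith
  then show ?thesis by simp
qed

definition qmap :: "real \<Rightarrow> 'd::finite sym \<Rightarrow> 'd sym" where
  "qmap \<mu> = pm_sum (\<lambda>\<alpha> f. \<Sum>r\<le>size \<alpha>.
     quant_coeff (real CARD('d)) \<mu> (size \<alpha>) r *\<^sub>R (divergence ^^ r) (single \<alpha> f))"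

lemma linear_qmap: "linear (qmap \<mu>)"
  unfolding qmap_def
  by (intro linear_pm_sum linear_compose_sum ballI linear_compose_scale_right
      linear_compose[OF linear_single linear_divergence_funpow, unfolded o_def])

lemmas qmap_linear = linear_0[OF linear_qmap] linear_add[OF linear_qmap]
  linear_diff[OF linear_qmap] linear_scale[OF linear_qmap] linear_sum[OF linear_qmap]

lemmas divergence_funpow_linear = linear_0[OF linear_divergence_funpow]
  linear_add[OF linear_divergence_funpow] linear_diff[OF linear_divergence_funpow]
  linear_scale[OF linear_divergence_funpow] linear_sum[OF linear_divergence_funpow]

lemma qmap_part:
  fixes c :: "'d::finite sym"
  shows "qmap \<mu> (part k c) = (\<Sum>r\<le>k. quant_coeff (real CARD('d)) \<mu> k r *\<^sub>R (divergence ^^ r) (part k c))"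
proof (rule additive_eqI[where s = c])
  fix \<alpha> and f :: "'d sfun"
  show "qmap \<mu> (part k (single \<alpha> f)) =
    (\<Sum>r\<le>k. quant_coeff (real CARD('d)) \<mu> k r *\<^sub>R (divergence ^^ r) (part k (single \<alpha> f)))"
  proof (cases "size \<alpha> = k")
    case True
    then show ?thesis
      by (auto simp: part_single qmap_def pm_sum_single divergence_funpow_linear)
  qed (simp add: part_single qmap_linear divergence_funpow_linear)
qed (simp_all add: part_linear qmap_linear divergence_funpow_linear scaleR_add_right sum.distrib)

lemma sym_part_induct [case_names part add]:
  assumes "\<And>k c. P (part k c)" "\<And>c c'. P c \<Longrightarrow> P c' \<Longrightarrow> P (c + c')"
  shows "P c"
proof (induction c rule: pm_induct)
  case (single \<alpha> f)
  have "part (size \<alpha>) (single \<alpha> f) = single \<alpha> f" by (simp add: part_single)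
  with assms(1) show ?case by metis
qed (rule assms)

definition qop :: "real \<Rightarrow> 'd::finite sym \<Rightarrow> 'd sfun \<Rightarrow> 'd sfun" where
  "qop \<mu> c = normal_op (qmap \<mu> c)"

lemma linear_qop_sym: "linear (\<lambda>c. qop \<mu> c f)"
  unfolding qop_def
  using linear_compose[OF linear_qmap linear_normal_op_sym] by (simp add: o_def)

lemma linear_qop: "linear (qop \<mu> c)"
  unfolding qop_def by (rule linear_normal_op)

lemmas qop_linear = linear_0[OF linear_qop_sym] linear_add[OF linear_qop_sym]
  linear_diff[OF linear_qop_sym] linear_scale[OF linear_qop_sym] linear_sum[OF linear_qop_sym]
  linear_0[OF linear_qop] linear_add[OF linear_qop] linear_scale[OF linear_qop]

text \<open>Each step \<open>s < r\<close> meets a symbol of degree \<open>m - s\<close> and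
  contributes \<open>(d + 1) + 2 * (m - s - 1)\<close>; these numbers add up to
  \<open>r * (2 * m + d - r)\<close>.\<close>

lemma divergence_funpow_lieS_quad:
  fixes c :: "'d::finite sym"
  assumes "r \<le> m"
  shows "(divergence ^^ r) (lieS (quad a k) (part m c)) = lieS (quad a k) ((divergence ^^ r) (part m c))
    - (real r * (2 * real m + real CARD('d) - real r)) *\<^sub>R dmom k ((divergence ^^ (r - 1)) (part m c))"
  using assms
proof (induction r)
  case (Suc r)
  let ?e = "(divergence ^^ r) (part m c)" and ?d = "real CARD('d)"
  have e: "?e = part (m - r) ((divergence ^^ r) c)"
    using Suc.prems by (intro divergence_funpow_part) simp
  \<comment> \<open>For \<open>r = 0\<close> the truncated exponent \<open>r - 1\<close> does no
    harm, since the factor \<open>real r\<close> vanishes.\<close>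
  have 1: "real r *\<^sub>R divergence (dmom k ((divergence ^^ (r - 1)) (part m c))) = real r *\<^sub>R dmom k ?e"
    by (cases r) (simp_all add: divergence_dmom)
  have 2: "euler_mom (dmom k ?e) = (real m - real r - 1) *\<^sub>R dmom k ?e"
    unfolding e euler_mom_dmom_part using Suc.prems by (simp add: of_nat_diff)
  have "(divergence ^^ Suc r) (lieS (quad a k) (part m c)) =
      divergence (lieS (quad a k) ?e)
      - (2 * real m + ?d - real r) *\<^sub>R (real r *\<^sub>R divergence (dmom k ((divergence ^^ (r - 1)) (part m c))))"
    using Suc by (simp add: divergence_linear mult.commute)
  also have "\<dots> = lieS (quad a k) (divergence ?e)
      - ((2 * real m + ?d - real r) * real r + (?d + 1) + 2 * (real m - real r - 1)) *\<^sub>R dmom k ?e"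
    unfolding 1 divergence_lieS_quad 2
    by (simp only: scaleR_scaleR scaleR_add_left diff_diff_eq) (simp only: add_ac)
  also have "(2 * real m + ?d - real r) * real r + (?d + 1) + 2 * (real m - real r - 1)
      = real (Suc r) * (2 * real m + ?d - real (Suc r))" by (simp add: algebra_simps)
  finally show ?case by simp
qed simp

text \<open>The defect of normal ordering on the r-th divergence and the defect of commuting
  \<open>r + 1\<close> divergences with the field are both multiples of \<open>dmom k\<close> on the
  r-th divergence. The recursion for \<open>quant_coeff\<close> makes them cancel.\<close>

lemma ad_op_qop_quad: "ad_op \<mu> (quad 0 k) (qop \<mu> (part m c)) = qop \<mu> (lieS (quad 0 k) (part m c))"
  for c :: "'d::finite sym"
proof -
  let ?e = "\<lambda>r. (divergence ^^ r) (part m c)" and ?d = "real CARD('d)"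
  let ?g = "\<lambda>r. quant_coeff ?d \<mu> m r"
  have em: "euler_mom (dmom k (?e r)) = (real m - real r - 1) *\<^sub>R dmom k (?e r)" if "r \<le> m" for r
    using that by (simp add: divergence_funpow_part euler_mom_dmom_part of_nat_diff)
  have "lieS (quad 0 k) (qmap \<mu> (part m c)) - (\<mu> * (?d + 1)) *\<^sub>R dmom k (qmap \<mu> (part m c))
      - euler_mom (dmom k (qmap \<mu> (part m c)))
    = (\<Sum>r\<le>m. ?g r *\<^sub>R (lieS (quad 0 k) (?e r) - (\<mu> * (?d + 1)) *\<^sub>R dmom k (?e r) - euler_mom (dmom k (?e r))))"
    by (simp add: qmap_part lieS_linear dmom_linear euler_mom_linear sum_subtractf
        scaleR_diff_right scaleR_sum_right mult_ac)
  also have "\<dots> = (\<Sum>r\<le>m. ?g r *\<^sub>R lieS (quad 0 k) (?e r)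
      - (?g r * (\<mu> * (?d + 1) + real m - real r - 1)) *\<^sub>R dmom k (?e r))"
    by (rule sum.cong) (simp_all add: em algebra_simps)
  \<comment> \<open>The defect at \<open>r = m\<close> disappears: after \<open>m\<close>
    divergences no momentum is left to differentiate. This is why the recursion is needed for
    \<open>r < m\<close> only.\<close>
  also have "\<dots> = (\<Sum>r\<le>m. ?g r *\<^sub>R lieS (quad 0 k) (?e r))
      - (\<Sum>r<m. (?g r * (\<mu> * (?d + 1) + real m - real r - 1)) *\<^sub>R dmom k (?e r))"
    by (simp add: sum_subtractf lessThan_Suc_atMost[symmetric] divergence_funpow_part)
  also have "(\<Sum>r<m. (?g r * (\<mu> * (?d + 1) + real m - real r - 1)) *\<^sub>R dmom k (?e r))
     = (\<Sum>r<m. (?g (Suc r) * ((real r + 1) * (2 * real m + ?d - real r - 1))) *\<^sub>R dmom k (?e r))"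
    by (rule sum.cong) (simp_all only: lessThan_iff quant_coeff_rec of_nat_0_le_iff refl)
  \<comment> \<open>After the shift of index the added term \<open>r = 0\<close> is zero, and the
    coefficients are those produced by moving the field past \<open>r\<close> divergences.\<close>
  also have "\<dots> = (\<Sum>r<Suc m. (?g r * (real r * (2 * real m + ?d - real r))) *\<^sub>R dmom k (?e (r - 1)))"
    unfolding sum.lessThan_Suc_shift by (simp add: algebra_simps del: quant_coeff.simps)
  also have "(\<Sum>r\<le>m. ?g r *\<^sub>R lieS (quad 0 k) (?e r)) - \<dots>
     = (\<Sum>r\<le>m. ?g r *\<^sub>R (divergence ^^ r) (lieS (quad 0 k) (part m c)))"
    unfolding lessThan_Suc_atMost sum_subtractf[symmetric]
    by (rule sum.cong) (simp_all add: divergence_funpow_lieS_quad scaleR_diff_right)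
  also have "\<dots> = qmap \<mu> (lieS (quad 0 k) (part m c))"
    by (simp add: qmap_part flip: part_lieS)
  finally show ?thesis unfolding qop_def ad_op_quad by simp
qed

text \<open>The series uses only the divergence and coefficients that depend on the degree, so any
  linear map respecting both passes through it.\<close>

lemma qmap_commute:
  fixes T :: "'d::finite sym \<Rightarrow> 'd sym"
  assumes "linear T" and div: "\<And>c. divergence (T c) = T (divergence c)"
    and part: "\<And>k c. part k (T c) = T (part k c)"
  shows "qmap \<mu> (T c) = T (qmap \<mu> c)"
proof (induction c rule: sym_part_induct)
  case (part k c)
  have *: "(divergence ^^ r) (T c) = T ((divergence ^^ r) c)" for r c
    by (induction r) (simp_all add: div)
  show ?case
    using qmap_part[of \<mu> k "T c"]
    by (simp only: assms(3) qmap_part * linear_sum[OF assms(1)] linear_scale[OF assms(1)])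
next
  case (add c c')
  then show ?case by (simp add: linear_add[OF assms(1)] qmap_linear)
qed

lemma ad_op_add:
  "ad_op \<mu> K (\<lambda>f. D f + E f) = (\<lambda>f. ad_op \<mu> K D f + ad_op \<mu> K E f)"
  by (simp add: fun_eq_iff ad_op_def linear_add[OF linear_lie_density])

text \<open>Constant and linear fields commute with the divergence and with the grading; the special
  choice of coefficients matters for the quadratic fields alone.\<close>

lemma ad_op_qop:
  assumes "K \<in> proj"
  shows "ad_op \<mu> K (qop \<mu> c) = qop \<mu> (lieS K c)"
  using assms
proof (induction K rule: proj_induct)
  case (const i)
  have "qmap \<mu> (lieS (axis i 1) c) = lieS (axis i 1) (qmap \<mu> c)"
    by (intro qmap_commute linear_lieS divergence_lieS_const part_lieS)
  then show ?case by (simp add: qop_def ad_op_const lieS_const)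
next
  case (coord i k)
  have "qmap \<mu> (lieS (axis i (coord k)) c) = lieS (axis i (coord k)) (qmap \<mu> c)"
    by (intro qmap_commute linear_lieS divergence_lieS_coord part_lieS)
  then show ?case by (simp add: qop_def ad_op_coord)
next
  case (quad k)
  show ?case
  proof (induction c rule: sym_part_induct)
    case (part m c)
    show ?case by (rule ad_op_qop_quad)
  next
    case (add c c')
    have "qop \<mu> (c + c') = (\<lambda>f. qop \<mu> c f + qop \<mu> c' f)" by (auto simp: qop_linear)
    then show ?case using add by (simp add: ad_op_add lieS_linear fun_eq_iff qop_linear)
  qed
next
  case (add K K')
  then show ?case
    by (simp add: fun_eq_iff linear_add[OF linear_lieS_field] linear_add[OF linear_ad_op_field[OF linear_qop]]
        qop_linear)
next
  case (scale r K)
  then show ?case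
    by (simp add: fun_eq_iff linear_scale[OF linear_lieS_field] linear_scale[OF linear_ad_op_field[OF linear_qop]]
        qop_linear)
qed

section \<open>Invertibility of the quantisation\<close>

lemma qmap_part_below: "qmap \<mu> (part k c) - part k c \<in> below k"
  for c :: "'d::finite sym"
proof -
  have "qmap \<mu> (part k c) - part k c
      = (\<Sum>r<k. quant_coeff (real CARD('d)) \<mu> k (Suc r) *\<^sub>R part (k - Suc r) ((divergence ^^ Suc r) c))"
    unfolding qmap_part lessThan_Suc_atMost[symmetric] sum.lessThan_Suc_shift
    by (simp add: divergence_funpow_part[symmetric] del: quant_coeff.simps(2) funpow.simps)
  also have "\<dots> \<in> below k"
    by (intro subspace_sum subspace_scale subspace_below part_below) auto
  finally show ?thesis .
qed

lemma qmap_below_diff: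
  assumes "c \<in> below (Suc n)"
  shows "qmap \<mu> c - c \<in> below n"
proof -
  have "qmap \<mu> c - c = (\<Sum>k<Suc n. qmap \<mu> (part k c) - part k c)"
    using below_sum_part[OF assms] by (simp add: sum_subtractf flip: linear_sum[OF linear_qmap])
  also have "\<dots> \<in> below n"
    by (intro subspace_sum subspace_below subsetD[OF below_mono qmap_part_below]) auto
  finally show ?thesis .
qed

lemma qmap_below: "c \<in> below n \<Longrightarrow> qmap \<mu> c \<in> below n"
proof (cases n)
  case (Suc m)
  assume c: "c \<in> below n"
  then have "qmap \<mu> c - c \<in> below n"
    using qmap_below_diff[of c m] below_mono[of m n] Suc by auto
  from subspace_add[OF subspace_below this c] show ?thesis by simp
qed (simp add: below_0 qmap_linear)

text \<open>The map is unitriangular in the degree: subtracting its value at \<open>c\<close> from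
  \<open>c\<close> lowers the degree, and the remainder is hit by induction.\<close>

lemma qmap_image_below: "qmap \<mu> ` below n = (below n :: 'd::finite sym set)"
proof
  show "below n \<subseteq> qmap \<mu> ` (below n :: 'd sym set)"
  proof (induction n)
    case (Suc n)
    show ?case
    proof
      fix c :: "'d sym"
      assume c: "c \<in> below (Suc n)"
      have "c - qmap \<mu> c \<in> below n"
        using subspace_neg[OF subspace_below qmap_below_diff[OF c], of \<mu>] by simp
      then obtain c' where c': "c' \<in> below n" "c - qmap \<mu> c = qmap \<mu> c'"
        using Suc by blast
      have "c = qmap \<mu> (c + c')" using c'(2) by (simp add: qmap_linear algebra_simps)
      moreover have "c + c' \<in> below (Suc n)"
        using c c'(1) below_mono[of n "Suc n"] by (intro subspace_add subspace_below) auto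
      ultimately show "c \<in> qmap \<mu> ` below (Suc n)" by blast
    qed
  qed (simp add: below_0 qmap_linear)
qed (auto intro: qmap_below)

lemma part_qmap: "c \<in> below (Suc n) \<Longrightarrow> part n (qmap \<mu> c) = part n c"
  using below_part[OF qmap_below_diff, of c n n \<mu>] by (simp add: part_linear)

lemma inj_qmap: "inj (qmap \<mu>)"
proof -
  have "c = 0" if "qmap \<mu> c = 0" "c \<in> below n" for c :: "'a sym" and n
    using that(2)
  proof (induction n)
    case (Suc n)
    have "part n c = 0" using part_qmap[OF Suc.prems, of \<mu>] that(1) by (simp add: part_linear)
    with Suc below_SucI show ?case by blast
  qed (simp add: below_0)
  then show ?thesis
    using ex_below linear_injective_0[OF linear_qmap] by blast
qed

lemma qop_inject: "qop \<mu> c = qop \<mu> c' \<longleftrightarrow> c = c'"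
  by (simp add: qop_def normal_op_inject inj_eq[OF inj_qmap])

text \<open>At every weight, operators of order at most \<open>n\<close> are parametrised by the
  same symbols. From here on operators are handled through this parametrisation.\<close>

lemma diff_ops_qop: "diff_ops n = qop \<mu> ` (below (Suc n) :: 'd::finite sym set)"
proof -
  have "qop \<mu> ` A = normal_op ` qmap \<mu> ` A" for A :: "'d sym set"
    unfolding qop_def image_image ..
  then show ?thesis by (simp only: qmap_image_below diff_ops_eq)
qed

lemma Union_diff_ops_qop: "(\<Union>k. diff_ops k) = range (qop \<mu>)"
proof -
  have "\<exists>k. c \<in> below (Suc k)" for c :: "'d::finite sym"
    using ex_below[of c] below_mono[of _ "Suc _"] by (meson le_SucI order_refl subsetD)
  then show ?thesis unfolding diff_ops_qop[of _ \<mu>] by blast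
qed

lemma principal_symbol_qop:
  "c \<in> below (Suc k) \<Longrightarrow> principal_symbol k (qop \<mu> c) = sym_fun (part k c)"
  by (simp add: qop_def principal_symbol_normal_op[OF qmap_below] part_qmap)

section \<open>Intertwiners between spaces of symbols\<close>

lemma lookup_dpos: "lookup (dpos i c) \<alpha> = partial i (lookup c \<alpha>)"
  by (rule additive_eqI[where s = c])
    (simp_all add: dpos_linear dpos_single lookup_add partial_add lookup_single when_def)

lemma lookup_mom_mult: "lookup (mom i * c) (add_mset i \<alpha>) = lookup c \<alpha>"
  by (rule additive_eqI[where s = c])
    (simp_all add: distrib_left mom_mult_single lookup_add lookup_single when_def)

lemma mom_mult_eq_0: "mom i * c = 0 \<Longrightarrow> c = 0"
  by (rule poly_mapping_eqI) (metis lookup_mom_mult lookup_zero)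

lemma constant_of_partial_eq_0:
  assumes "\<And>i. partial i f = 0"
  shows "f = of_real (val f a)"
proof (rule sfun_eqI)
  fix x
  have "pderiv_at i (val f) = (\<lambda>x. 0)" for i
    using assms[of i] by (metis val_partial val_simps(1) ext)
  then show "val f x = val (of_real (val f a)) x"
    using hadamard[OF smooth_val, of f x a] by (simp add: radial_mean_def)
qed

lemma at_pt_of_dpos_eq_0:
  assumes "\<And>i. dpos i c = 0"
  shows "at_pt a c = c"
  by (rule poly_mapping_eqI, unfold lookup_at_pt, rule constant_of_partial_eq_0[symmetric])
    (metis assms lookup_dpos lookup_zero)

lemma hadamard_sym: "\<exists>g. c = at_pt a c + (\<Sum>i\<in>UNIV. cst (pos a i) * g i)"
proof (induction c rule: pm_induct)
  case (single \<alpha> f)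
  obtain g where "f = of_real (val f a) + (\<Sum>i\<in>UNIV. pos a i * g i)"
    using hadamard_sfun by blast
  then have e: "single \<alpha> f = single \<alpha> (of_real (val f a)) + (\<Sum>i\<in>UNIV. single \<alpha> (pos a i * g i))"
    by (metis single_add linear_sum[OF linear_single])
  show ?case
    by (rule exI[of _ "\<lambda>i. single \<alpha> (g i)"], unfold at_pt_single cst_mult_single, rule e)
next
  case (add s t)
  then obtain g h where g: "s = at_pt a s + (\<Sum>i\<in>UNIV. cst (pos a i) * g i)"
    and h: "t = at_pt a t + (\<Sum>i\<in>UNIV. cst (pos a i) * h i)" by blast
  have "at_pt a (s + t) + (\<Sum>i\<in>UNIV. cst (pos a i) * (g i + h i))
    = (at_pt a s + (\<Sum>i\<in>UNIV. cst (pos a i) * g i)) + (at_pt a t + (\<Sum>i\<in>UNIV. cst (pos a i) * h i))"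
    by (simp add: at_pt_linear distrib_left sum.distrib)
  also have "\<dots> = s + t" unfolding g[symmetric] h[symmetric] ..
  finally show ?case by (intro exI[of _ "\<lambda>i. g i + h i"]) (rule sym)
qed

lemma radial_sym: "\<exists>u. euler_pos a u + real (Suc q) *\<^sub>R u = c"
proof (induction c rule: pm_induct)
  case (single \<alpha> f)
  obtain u where "(\<Sum>i\<in>UNIV. pos a i * partial i u) + of_nat (Suc q) * u = f"
    using radial_sfun by blast
  moreover have "of_nat (Suc q) * u = real (Suc q) *\<^sub>R u" by (simp add: scaleR_conv_of_real)
  ultimately have "single \<alpha> f = (\<Sum>i\<in>UNIV. single \<alpha> (pos a i * partial i u)) + single \<alpha> (real (Suc q) *\<^sub>R u)"
    by (metis single_add linear_sum[OF linear_single])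
  then have "euler_pos a (single \<alpha> u) + real (Suc q) *\<^sub>R single \<alpha> u = single \<alpha> f"
    by (simp only: euler_pos_def dpos_single cst_mult_single scaleR_single)
  then show ?case by blast
next
  case (add s t)
  then obtain u v where "euler_pos a u + real (Suc q) *\<^sub>R u = s" "euler_pos a v + real (Suc q) *\<^sub>R v = t"
    by blast
  then have "euler_pos a (u + v) + real (Suc q) *\<^sub>R (u + v) = s + t"
    by (auto simp: euler_pos_linear scaleR_add_right)
  then show ?case by blast
qed

lemma part_euler_pos: "part k (euler_pos a c) = euler_pos a (part k c)"
  by (simp add: euler_pos_def part_linear part_cst_mult part_dpos)

text \<open>The Euler field preserves the degree in the momenta, so the solution may be taken
  homogeneous.\<close>

lemma radial_sym_part: "\<exists>u. part k u = u \<and> euler_pos a u + real (Suc q) *\<^sub>R u = part k c"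
proof -
  obtain u where "euler_pos a u + real (Suc q) *\<^sub>R u = c" using radial_sym by blast
  then have "euler_pos a (part k u) + real (Suc q) *\<^sub>R part k u = part k c"
    by (auto simp: part_linear part_euler_pos)
  then show ?thesis by (intro exI[of _ "part k u"]) simp
qed

lemma euler_pos_mult: "euler_pos a (c * c') = euler_pos a c * c' + c * euler_pos a c'"
  by (simp add: euler_pos_def dpos_mult distrib_left sum.distrib sum_distrib_left sum_distrib_right
      mult.assoc mult.left_commute)

lemma euler_pos_cst_pos: "euler_pos a (cst (pos a i)) = cst (pos a i)"
proof -
  have "cst (pos a j) * cst (partial j (pos a i)) = (if j = i then cst (pos a i) else 0)" for j
    by (simp add: cst_simps)
  then show ?thesis by (simp add: euler_pos_def)
qed

lemma euler_pos_contraction: "euler_pos a (contraction a) = contraction a"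
proof -
  have "euler_pos a (mom i) = 0" for i by (simp add: euler_pos_def)
  then show ?thesis
    by (simp add: contraction_def euler_pos_linear euler_pos_mult euler_pos_cst_pos)
qed

lemma euler_pos_contraction_power: "euler_pos a (contraction a ^ p) = real p *\<^sub>R contraction a ^ p"
proof (induction p)
  case (Suc p)
  then show ?case
    by (simp add: euler_pos_mult euler_pos_contraction scaleR_add_left)
qed (simp add: euler_pos_def)

lemma dmom_contraction: "dmom i (contraction a) = cst (pos a i)"
proof -
  have "dmom i (cst (pos a j) * mom j) = (if j = i then cst (pos a i) else 0)" for j by auto
  then show ?thesis by (simp add: contraction_def dmom_linear)
qed

lemma dmom_contraction_power:
  "dmom i (contraction a ^ p) = real p *\<^sub>R (cst (pos a i) * contraction a ^ (p - 1))"
proof (induction p)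
  case (Suc p)
  have "contraction a * (real p *\<^sub>R (cst (pos a i) * contraction a ^ (p - 1)))
      = real p *\<^sub>R (cst (pos a i) * contraction a ^ p)"
    by (cases p) (simp_all add: mult.left_commute)
  then show ?case
    by (simp add: dmom_mult dmom_contraction Suc scaleR_add_left)
qed simp

lemma part_contraction_mult: "part (Suc k) (contraction a * c) = contraction a * part k c"
  by (simp add: contraction_def sum_distrib_right part_linear part_cst_mult part_mom_mult mult.assoc)

lemma part_contraction_power_mult: "part (k + p) (contraction a ^ p * c) = contraction a ^ p * part k c"
  by (induction p) (simp_all add: part_contraction_mult mult.assoc)

definition pos_mon :: "real ^ 'd::finite \<Rightarrow> 'd multiset \<Rightarrow> 'd sym" where
  "pos_mon a \<beta> = (\<Prod>i\<in>#\<beta>. cst (pos a i))"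

lemma pos_mon_simps [simp]: "pos_mon a {#} = 1" "pos_mon a (add_mset i \<beta>) = cst (pos a i) * pos_mon a \<beta>"
  by (simp_all add: pos_mon_def)

lemma euler_pos_pos_mon: "euler_pos a (pos_mon a \<beta>) = real (size \<beta>) *\<^sub>R pos_mon a \<beta>"
  by (induction \<beta>)
    (simp_all add: euler_pos_mult euler_pos_cst_pos scaleR_add_left, simp add: euler_pos_def)

lemma dmom_pos_mon_mult: "dmom i (pos_mon a \<beta> * c) = pos_mon a \<beta> * dmom i c"
  by (induction \<beta>) (simp_all add: mult.assoc)

lemma part_pos_mon_mult: "part k (pos_mon a \<beta> * c) = pos_mon a \<beta> * part k c"
  by (induction \<beta>) (simp_all add: mult.assoc part_cst_mult)

lemma at_pt_euler_pos: "at_pt a (euler_pos a c) = 0"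
  by (simp add: euler_pos_def at_pt_linear)

lemma at_pt_contraction_mult: "at_pt a (contraction a * c) = 0"
  by (simp add: contraction_def sum_distrib_right at_pt_linear mult.assoc)

lemma euler_pos_constant: "(\<And>i. dpos i t = 0) \<Longrightarrow> euler_pos a t = 0"
  by (simp add: euler_pos_def)

section \<open>Intertwiners evaluated at a point\<close>

text \<open>\<open>T\<close> is meant as a map from degree \<open>k\<close> to degree
  \<open>j\<close>; equivariance is demanded on degree \<open>k\<close> only. Beyond linearity there
  is no regularity hypothesis, so locality has to be derived.\<close>

locale intertwiner =
  fixes T :: "'d::finite sym \<Rightarrow> 'd sym" and k j :: nat
  assumes linear: "linear T"
    and degree: "\<And>c. part j (T c) = T c"
    and commute: "\<And>K c. K \<in> proj \<Longrightarrow> part k c = c \<Longrightarrow> T (lieS K c) = lieS K (T c)"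
begin

definition ev :: "real ^ 'd \<Rightarrow> 'd sym \<Rightarrow> 'd sym" where
  "ev a c = at_pt a (T c)"

lemma linear_ev: "linear (ev a)"
  unfolding ev_def using linear_compose[OF linear linear_at_pt] by (simp add: o_def)

lemmas ev_linear = linear_0[OF linear_ev] linear_add[OF linear_ev] linear_diff[OF linear_ev]
  linear_scale[OF linear_ev] linear_sum[OF linear_ev]

text \<open>At the centre the position part of the Euler field acts as zero on \<open>T c\<close>,
  and only the two momentum degrees remain.\<close>

lemma ev_euler:
  assumes c: "part k c = c"
  shows "ev a (euler_pos a c) = (real k - real j) *\<^sub>R ev a c"
proof -
  have "ev a (euler_pos a c - euler_mom c) = at_pt a (euler_pos a (T c) - euler_mom (T c))"
    using commute[OF proj_euler c] by (simp add: ev_def lieS_euler)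
  moreover have "euler_mom c = real k *\<^sub>R c" using euler_mom_part[of k c] c by simp
  moreover have "euler_mom (T c) = real j *\<^sub>R T c" using euler_mom_part[of j "T c"] degree by simp
  ultimately have "ev a (euler_pos a c) - real k *\<^sub>R ev a c = - (real j *\<^sub>R ev a c)"
    by (simp add: ev_linear at_pt_linear at_pt_euler_pos) (simp add: ev_def)
  then show ?thesis by (simp add: algebra_simps)
qed

lemma ev_quad:
  assumes c: "part k c = c"
  shows "ev a (cst (pos a i) * (euler_pos a c - real k *\<^sub>R c)) = ev a (contraction a * dmom i c)"
proof -
  have "euler_mom c = real k *\<^sub>R c" using euler_mom_part[of k c] c by simp
  then have "ev a (cst (pos a i) * (euler_pos a c - real k *\<^sub>R c) - contraction a * dmom i c)
      = at_pt a (lieS (quad a i) (T c))"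
    using commute[OF proj_quad c] by (simp add: ev_def lieS_quad)
  also have "\<dots> = 0" by (simp add: lieS_quad at_pt_linear at_pt_contraction_mult)
  finally show ?thesis by (simp add: ev_linear)
qed

text \<open>Evaluation at \<open>a\<close> annihilates the image of \<open>E + (j - k)\<close>, and
  for a positive shift that image is everything.\<close>

lemma eq_0_of_less:
  assumes "k < j"
  shows "T (part k c) = 0"
proof (rule at_pt_eqI)
  fix a
  \<comment> \<open>\<open>Suc (j - k - 1)\<close> is \<open>j - k\<close>, written so as to be
    visibly positive.\<close>
  obtain u where u: "part k u = u" "euler_pos a u + real (Suc (j - k - 1)) *\<^sub>R u = part k c"
    using radial_sym_part by blast
  have "ev a (part k c) = 0"
    unfolding u(2)[symmetric] ev_linear ev_euler[OF u(1)] scaleR_add_left[symmetric]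
    using assms by (simp add: of_nat_diff)
  then show "at_pt a (T (part k c)) = at_pt a 0" by (simp add: ev_def at_pt_linear)
qed

text \<open>Write \<open>c\<close> as \<open>E u + u\<close>. Since \<open>pos_mon a \<beta>\<close>
  is homogeneous of degree \<open>k - j + 1\<close>, its product with \<open>c\<close> is
  \<open>E - (k - j)\<close> applied to \<open>pos_mon a \<beta> * u\<close>, which evaluation
  annihilates. Thus only a Taylor polynomial of order \<open>k - j\<close> can matter.\<close>

lemma ev_pos_mon_top:
  assumes "j \<le> k" "part k c = c" "size \<beta> = Suc (k - j)"
  shows "ev a (pos_mon a \<beta> * c) = 0"
proof -
  obtain u where u: "part k u = u" "euler_pos a u + real (Suc 0) *\<^sub>R u = c"
    using radial_sym_part assms(2) by metis
  have "part k (pos_mon a \<beta> * u) = pos_mon a \<beta> * u" by (simp add: part_pos_mon_mult u(1))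
  from ev_euler[OF this, of a]
  have "(real k - real j + 1) *\<^sub>R ev a (pos_mon a \<beta> * u) + ev a (pos_mon a \<beta> * euler_pos a u)
      = (real k - real j) *\<^sub>R ev a (pos_mon a \<beta> * u)"
    using assms(1,3) by (simp add: euler_pos_mult euler_pos_pos_mon ev_linear of_nat_diff add.commute)
  then have "ev a (pos_mon a \<beta> * u) + ev a (pos_mon a \<beta> * euler_pos a u) = 0"
    by (simp add: scaleR_add_left)
  then show ?thesis unfolding u(2)[symmetric] by (simp add: distrib_left ev_linear add.commute)
qed

text \<open>
  The quadratic fields trade a coordinate for a factor \<open>contraction a\<close>.  Iterated, this reduces
  every monomial to a power of the contraction, where the same relation summed over \<open>i\<close> closes up.
\<close>

lemma ev_reduce:
  assumes m: "size \<gamma> + p + 1 = k - j" "j \<le> k"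
    and t: "part (k - p) t = t" "\<And>i. dpos i t = 0"
  shows "(real j + 1 + real p) *\<^sub>R ev a (cst (pos a i) * (pos_mon a \<gamma> * (contraction a ^ p * t)))
    = - ev a (pos_mon a \<gamma> * (contraction a ^ Suc p * dmom i t))"
proof -
  let ?s = "pos_mon a \<gamma> * (contraction a ^ p * t)"
  have "p \<le> k" using m by linarith
  then have s: "part k ?s = ?s"
    using part_contraction_power_mult[of "k - p" p a t] t(1) by (simp add: part_pos_mon_mult)
  have "euler_pos a ?s = (real (size \<gamma>) + real p) *\<^sub>R ?s"
    by (simp add: euler_pos_mult euler_pos_pos_mon euler_pos_contraction_power euler_pos_constant t(2)
        scaleR_add_left)
  \<comment> \<open>The symbol \<open>?s\<close> has degree
    \<open>size \<gamma> + p = k - j - 1\<close> in \<open>x - a\<close>, and this is its Euler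
    eigenvalue.\<close>
  moreover have "real (size \<gamma>) + real p - real k = - (real j + 1)"
    using arg_cong[OF m(1), of real] m(2) by (simp add: of_nat_diff)
  ultimately have "euler_pos a ?s - real k *\<^sub>R ?s = - (real j + 1) *\<^sub>R ?s"
    by (simp only: scaleR_diff_left[symmetric])
  with ev_quad[OF s, of a i]
  have 1: "- (real j + 1) *\<^sub>R ev a (cst (pos a i) * ?s) = ev a (contraction a * dmom i ?s)"
    by (simp only: mult_scaleR_right ev_linear)
  have "contraction a * dmom i ?s
      = pos_mon a \<gamma> * (real p *\<^sub>R (cst (pos a i) * (contraction a * contraction a ^ (p - 1))) * t)
        + pos_mon a \<gamma> * (contraction a ^ Suc p * dmom i t)"
    unfolding dmom_pos_mon_mult dmom_mult[of i "contraction a ^ p"] dmom_contraction_power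
    by (simp add: distrib_left mult.assoc mult.left_commute)
  also have "real p *\<^sub>R (cst (pos a i) * (contraction a * contraction a ^ (p - 1)))
      = real p *\<^sub>R (cst (pos a i) * contraction a ^ p)"
    by (cases p) simp_all
  also have "pos_mon a \<gamma> * (real p *\<^sub>R (cst (pos a i) * contraction a ^ p) * t)
      = real p *\<^sub>R (cst (pos a i) * ?s)" by (simp add: mult.assoc mult.left_commute)
  finally have 2: "ev a (contraction a * dmom i ?s) = real p *\<^sub>R ev a (cst (pos a i) * ?s)
      + ev a (pos_mon a \<gamma> * (contraction a ^ Suc p * dmom i t))"
    by (simp only: ev_linear)
  have "(real j + 1 + real p) *\<^sub>R E = - Z" if "- (real j + 1) *\<^sub>R E = real p *\<^sub>R E + Z" for E Z :: "'d sym"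
  proof -
    have "Z = - (real j + 1) *\<^sub>R E - real p *\<^sub>R E" using that by simp
    then show ?thesis by (simp add: scaleR_add_left scaleR_diff_left)
  qed
  from this[OF 1[unfolded 2]] show ?thesis .
qed

text \<open>Reduction applied to \<open>mom i * t\<close> and summed over \<open>i\<close> has the
  same power of the contraction on both sides, because the sum of \<open>dmom i (mom i * t)\<close>
  is \<open>(d + j)\<close> times \<open>t\<close>. The factors add up to a positive number, so the
  value is zero.\<close>

lemma ev_contraction_power:
  assumes "j < k" and t: "part j t = t" "\<And>i. dpos i t = 0"
  shows "ev a (contraction a ^ (k - j) * t) = 0"
proof -
  obtain p where p: "k - j = Suc p" using assms(1) by (metis Suc_diff_Suc)
  then have kp: "k - p = Suc j" by linarith
  have "(real j + 1 + real p) *\<^sub>R ev a (cst (pos a i) * (pos_mon a {#} * (contraction a ^ p * (mom i * t))))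
    = - ev a (pos_mon a {#} * (contraction a ^ Suc p * dmom i (mom i * t)))" for i
    by (rule ev_reduce) (use p assms(1) t kp in \<open>simp_all add: part_mom_mult\<close>)
  then have "(\<Sum>i\<in>UNIV. (real j + 1 + real p) *\<^sub>R ev a (cst (pos a i) * (contraction a ^ p * (mom i * t))))
    = (\<Sum>i\<in>UNIV. - ev a (contraction a ^ Suc p * dmom i (mom i * t)))" by simp
  then have "(real j + 1 + real p) *\<^sub>R ev a (\<Sum>i\<in>UNIV. cst (pos a i) * (contraction a ^ p * (mom i * t)))
    = - ev a (contraction a ^ Suc p * (\<Sum>i\<in>UNIV. dmom i (mom i * t)))"
    by (simp only: ev_linear sum_distrib_left scaleR_sum_right sum_negf)
  also have "(\<Sum>i\<in>UNIV. dmom i (mom i * t)) = (real CARD('d) + real j) *\<^sub>R t"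
    using euler_mom_part[of j t] t(1)
    by (simp add: sum.distrib euler_mom_def distrib_right scaleR_conv_of_real)
  also have "(\<Sum>i\<in>UNIV. cst (pos a i) * (contraction a ^ p * (mom i * t))) = contraction a ^ Suc p * t"
    by (simp add: contraction_def sum_distrib_right mult.assoc mult.left_commute)
  finally have "(real j + 1 + real p + (real CARD('d) + real j)) *\<^sub>R ev a (contraction a ^ Suc p * t) = 0"
    unfolding mult_scaleR_right ev_linear by (simp only: scaleR_add_left) simp
  moreover have "real j + 1 + real p + (real CARD('d) + real j) \<noteq> 0"
    by linarith
  ultimately show ?thesis unfolding p by simp
qed

text \<open>Each reduction step removes one coordinate factor, adds one contraction and lowers the
  degree of the constant symbol by one. The total order in \<open>x - a\<close> stays at
  \<open>k - j\<close> until only the contraction is left.\<close>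

lemma ev_pos_mon_contraction:
  assumes "j < k"
  shows "size \<gamma> + p = k - j \<Longrightarrow> part (k - p) t = t \<Longrightarrow> (\<And>i. dpos i t = 0) \<Longrightarrow>
    ev a (pos_mon a \<gamma> * (contraction a ^ p * t)) = 0"
proof (induction \<gamma> arbitrary: p t)
  case empty
  then have "k - p = j" "p = k - j" using assms by auto
  then show ?case using ev_contraction_power[OF assms, of t a] empty by simp
next
  case (add i \<gamma>)
  have "Suc (k - Suc p) = k - p" using add.prems(1) by simp
  then have "part (k - Suc p) (dmom i t) = dmom i t"
    using add.prems(2) by (simp add: part_dmom)
  then have "ev a (pos_mon a \<gamma> * (contraction a ^ Suc p * dmom i t)) = 0"
    using add.prems by (intro add.IH) (simp_all add: dpos_dmom_commute dmom_linear)
  then have "(real j + 1 + real p) *\<^sub>R ev a (cst (pos a i) * (pos_mon a \<gamma> * (contraction a ^ p * t))) = 0"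
    using ev_reduce[of \<gamma> p t a i] add.prems assms by simp
  moreover have "real j + 1 + real p \<noteq> 0" by linarith
  ultimately show ?case by (simp add: mult.assoc)
qed

lemma hadamard_part:
  assumes "part k c = c"
  obtains g where "\<And>i. part k (g i) = g i" "c = at_pt a c + (\<Sum>i\<in>UNIV. cst (pos a i) * g i)"
proof -
  obtain g where "c = at_pt a c + (\<Sum>i\<in>UNIV. cst (pos a i) * g i)" using hadamard_sym by blast
  then have "part k c = part k (at_pt a c + (\<Sum>i\<in>UNIV. cst (pos a i) * g i))" by simp
  then have "c = at_pt a c + (\<Sum>i\<in>UNIV. cst (pos a i) * part k (g i))"
    unfolding assms by (simp add: part_linear part_at_pt part_cst_mult assms)
  then show ?thesis by (rule that[rotated]) simp
qed

text \<open>Induction downwards from order \<open>k - j + 1\<close>. Hadamard's lemma splits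
  \<open>c\<close> into its value at \<open>a\<close> and terms with one more coordinate, which the
  induction hypothesis kills. The remaining symbol has Euler eigenvalue \<open>size \<beta>\<close>,
  which forces zero unless it equals \<open>k - j\<close>; that critical order is the one settled by
  the quadratic fields.\<close>

lemma ev_pos_mon:
  assumes "j < k" "part k c = c" "size \<beta> \<le> Suc (k - j)"
  shows "ev a (pos_mon a \<beta> * c) = 0"
  using assms(3,2)
proof (induction "Suc (k - j) - size \<beta>" arbitrary: \<beta> c)
  case 0
  then show ?case using ev_pos_mon_top[of c \<beta> a] assms(1) by simp
next
  case (Suc N)
  obtain g where g: "\<And>i. part k (g i) = g i" "c = at_pt a c + (\<Sum>i\<in>UNIV. cst (pos a i) * g i)"
    using hadamard_part[OF Suc.prems(2)] by blast
  have "ev a (pos_mon a (add_mset i \<beta>) * g i) = 0" for i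
    using Suc.hyps(2) g(1) by (intro Suc.hyps(1)) auto
  then have "ev a (\<Sum>i\<in>UNIV. pos_mon a \<beta> * (cst (pos a i) * g i)) = 0"
    by (simp add: ev_linear mult.assoc mult.left_commute)
  then have c: "ev a (pos_mon a \<beta> * c) = ev a (pos_mon a \<beta> * at_pt a c)"
    by (subst g(2)) (simp add: distrib_left ev_linear sum_distrib_left)
  have t: "part k (at_pt a c) = at_pt a c" using Suc.prems(2) by (simp add: part_at_pt)
  show ?case
  proof (cases "size \<beta> = k - j")
    case True
    then show ?thesis unfolding c
      using ev_pos_mon_contraction[OF assms(1), of \<beta> 0 "at_pt a c" a] t by simp
  next
    case False
    have "part k (pos_mon a \<beta> * at_pt a c) = pos_mon a \<beta> * at_pt a c" by (simp add: part_pos_mon_mult t)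
    from ev_euler[OF this, of a]
    have "(real (size \<beta>) - (real k - real j)) *\<^sub>R ev a (pos_mon a \<beta> * at_pt a c) = 0"
      by (simp add: euler_pos_mult euler_pos_pos_mon euler_pos_constant ev_linear scaleR_diff_left)
    moreover have "real (size \<beta>) - (real k - real j) \<noteq> 0"
      using False assms(1) by (simp add: of_nat_diff[symmetric] del: of_nat_diff)
    ultimately show ?thesis unfolding c by simp
  qed
qed

lemma eq_0_of_greater:
  assumes "j < k"
  shows "T (part k c) = 0"
  by (rule at_pt_eqI)
    (use ev_pos_mon[OF assms, of "part k c" "{#}"] in \<open>simp add: ev_def at_pt_linear\<close>)

lemma eq_0: "j \<noteq> k \<Longrightarrow> T (part k c) = 0"
  using eq_0_of_less eq_0_of_greater by (metis linorder_neqE_nat)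

end

section \<open>Equal degrees: constant symbols under the linear group\<close>

text \<open>For equal degrees one coordinate factor already suffices for vanishing, so by Hadamard's
  lemma the map is of order zero.\<close>

lemma (in intertwiner) ev_constant:
  assumes "j = k"
  shows "at_pt a (T (part k c)) = at_pt a (T (at_pt a (part k c)))"
proof -
  obtain g where g: "\<And>i. part k (g i) = g i"
    "part k c = at_pt a (part k c) + (\<Sum>i\<in>UNIV. cst (pos a i) * g i)"
    using hadamard_part[of "part k c" a] by auto
  have "ev a (cst (pos a i) * g i) = 0" for i
    using ev_pos_mon_top[of "g i" "{#i#}" a] assms g(1) by simp
  then have "ev a (\<Sum>i\<in>UNIV. cst (pos a i) * g i) = 0" by (simp add: ev_linear)
  then have "ev a (at_pt a (part k c) + (\<Sum>i\<in>UNIV. cst (pos a i) * g i)) = ev a (at_pt a (part k c))"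
    by (simp add: ev_linear)
  then show ?thesis unfolding g(2)[symmetric] ev_def .
qed

text \<open>On constant symbols the linear fields act through \<open>mom q * dmom p\<close>, which
  is the action of gl(d) on polynomials in the momenta.\<close>

lemma (in intertwiner) commute_mom_dmom:
  assumes t: "part k t = t" "\<And>i. dpos i t = 0"
  shows "dpos i (T t) = 0" "T (mom q * dmom p t) = mom q * dmom p (T t)"
proof -
  show const: "dpos i (T t) = 0" for i
    using commute[OF proj_const t(1), of i] by (simp add: lieS_const t(2) linear_0[OF linear])
  show "T (mom q * dmom p t) = mom q * dmom p (T t)"
    using commute[OF proj_coord t(1), of q p]
    by (simp add: lieS_coord t(2) const linear_neg[OF linear])
qed

text \<open>A weight argument: for \<open>p \<noteq> i0\<close> the operator
  \<open>mom p * dmom p\<close> annihilates the pure power, hence also its image, which therefore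
  involves no momentum other than the one of \<open>i0\<close>.\<close>

lemma (in intertwiner) monomial_eigenvector:
  fixes i0 :: 'd
  assumes "j = k"
  shows "\<exists>r. T (single (replicate_mset k i0) 1) = r *\<^sub>R single (replicate_mset k i0) 1"
proof -
  let ?v = "single (replicate_mset k i0) 1 :: 'd sym"
  have v: "part k ?v = ?v" "\<And>i. dpos i ?v = 0" by (simp_all add: part_single dpos_single)
  have dm: "dmom p (T ?v) = 0" if "p \<noteq> i0" for p
  proof (rule mom_mult_eq_0)
    have "dmom p ?v = 0" using that by (simp add: dmom_single)
    then show "mom p * dmom p (T ?v) = 0"
      using commute_mom_dmom(2)[OF v, of p p] by (simp add: linear_0[OF linear])
  qed
  have const: "lookup (T ?v) \<alpha> = of_real (val (lookup (T ?v) \<alpha>) 0)" for \<alpha>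
    using at_pt_of_dpos_eq_0[OF commute_mom_dmom(1)[OF v], of 0] by (metis lookup_at_pt)
  define r where "r = val (lookup (T ?v) (replicate_mset k i0)) 0"
  have "T ?v = r *\<^sub>R ?v"
  proof (rule poly_mapping_eqI)
    fix \<alpha>
    consider "\<alpha> = replicate_mset k i0" | "size \<alpha> \<noteq> k" | p where "p \<noteq> i0" "p \<in># \<alpha>"
      by (metis set_mset_subset_singletonD singleton_iff subsetI)
    then show "lookup (T ?v) \<alpha> = lookup (r *\<^sub>R ?v) \<alpha>"
    proof cases
      case 1
      show ?thesis
        unfolding 1 lookup_scaleR lookup_single_eq r_def Real_Vector_Spaces.of_real_def[symmetric]
        by (rule const)
    next
      case 2
      then have "lookup (T ?v) \<alpha> = 0" using degree[of ?v] assms lookup_part[of j "T ?v" \<alpha>] by simp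
      with 2 show ?thesis by (auto simp: lookup_scaleR lookup_single)
    next
      case 3
      then obtain \<beta> where b: "\<alpha> = add_mset p \<beta>" by (metis insert_DiffM)
      have "of_nat (Suc (count \<beta> p)) * lookup (T ?v) \<alpha> = 0"
        using dm[OF 3(1)] lookup_dmom[of p "T ?v" \<beta>] by (simp only: b lookup_zero)
      then have "lookup (T ?v) \<alpha> = 0" by (rule of_nat_mult_sfun_eq_0) simp
      moreover have "\<alpha> \<noteq> replicate_mset k i0" using 3 by (auto split: if_splits)
      ultimately show ?thesis by (simp add: lookup_scaleR lookup_single when_def)
    qed
  qed
  then show ?thesis ..
qed

text \<open>A Schur argument in explicit form: gl(d) carries the pure power to every monomial, so
  its eigenvalue propagates to all constant symbols, and order zero extends it to variable
  coefficients.\<close>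

lemma (in intertwiner) scalar:
  assumes jk: "j = k"
  shows "\<exists>r. \<forall>c. T (part k c) = r *\<^sub>R part k c"
proof -
  fix i0 :: 'd
  obtain r where r: "T (single (replicate_mset k i0) 1) = r *\<^sub>R single (replicate_mset k i0) 1"
    using monomial_eigenvector[OF jk] by blast
  have mono: "T (single \<alpha> 1) = r *\<^sub>R single \<alpha> 1" if "size \<alpha> = k" for \<alpha>
    using that
  proof (induction "size (filter_mset (\<lambda>i. i \<noteq> i0) \<alpha>)" arbitrary: \<alpha>)
    case 0
    then have "set_mset {#i \<in># \<alpha>. i \<noteq> i0#} = {}" by simp
    then have "set_mset \<alpha> \<subseteq> {i0}" by auto
    then have "\<alpha> = replicate_mset k i0" using set_mset_subset_singletonD 0 by metis
    then show ?case using r by simp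
  next
    case (Suc n)
    then have "set_mset {#i \<in># \<alpha>. i \<noteq> i0#} \<noteq> {}"
      by (metis nat.distinct(1) set_mset_eq_empty_iff size_empty)
    then obtain b where b: "b \<in># \<alpha>" "b \<noteq> i0" by auto
    then obtain \<beta> where beta: "\<alpha> = add_mset b \<beta>" by (metis insert_DiffM)
    \<comment> \<open>One foreign index is replaced by \<open>i0\<close>;
      \<open>mom b * dmom i0\<close> puts it back, up to the multiplicity \<open>?N\<close> of
      \<open>i0\<close>.\<close>
    let ?a = "add_mset i0 \<beta>" and ?N = "real (Suc (count \<beta> i0))"
    have IH: "T (single ?a 1) = r *\<^sub>R single ?a 1"
      using Suc b(2) unfolding beta by (intro Suc.hyps(1)) auto
    have "part k (single ?a 1) = (single ?a 1 :: 'd sym)" "\<And>i. dpos i (single ?a 1 :: 'd sym) = 0"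
      using Suc.prems by (simp_all add: part_single dpos_single beta)
    from commute_mom_dmom(2)[OF this, of b i0]
    have "T (mom b * dmom i0 (single ?a 1)) = r *\<^sub>R (mom b * dmom i0 (single ?a 1))"
      by (simp add: IH dmom_linear)
    moreover have "mom b * dmom i0 (single ?a 1) = ?N *\<^sub>R single \<alpha> 1"
      by (simp add: dmom_single mom_mult_single beta scaleR_single del: of_nat_Suc)
        (simp add: scaleR_conv_of_real)
    ultimately have "?N *\<^sub>R T (single \<alpha> 1) = ?N *\<^sub>R (r *\<^sub>R single \<alpha> 1)"
      by (simp only: linear_scale[OF linear] scaleR_left_commute)
    then show ?case by (rule scaleR_left_imp_eq[rotated]) simp
  qed
  have const: "T (at_pt a (part k c)) = r *\<^sub>R at_pt a (part k c)" for a c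
  proof (induction c rule: pm_induct)
    case (single \<alpha> f)
    have "single \<alpha> (of_real (val f a)) = val f a *\<^sub>R single \<alpha> (1 :: 'd sfun)"
      by (simp only: scaleR_single Real_Vector_Spaces.of_real_def)
    then show ?case
      using mono[of \<alpha>] by (simp add: part_single at_pt_single at_pt_linear linear_0[OF linear]
        linear_scale[OF linear] scaleR_left_commute)
  next
    case (add s t)
    then show ?case by (simp add: part_linear at_pt_linear linear_add[OF linear] scaleR_add_right)
  qed
  have "T (part k c) = r *\<^sub>R part k c" for c
  proof (rule at_pt_eqI)
    fix a
    show "at_pt a (T (part k c)) = at_pt a (r *\<^sub>R part k c)"
      by (simp add: ev_constant[OF jk, of a c] const at_pt_linear)
  qed
  then show ?thesis by blast
qed

section \<open>The full symbol map\<close>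

lemma sym_fun_diff: "(\<lambda>x \<xi>. sym_fun c x \<xi> - sym_fun c' x \<xi>) = sym_fun (c - c')"
  by (simp add: fun_eq_iff sym_fun_linear)

lemma full_symbol_map_exists:
  "full_symbol_map \<mu> (\<lambda>D. sym_fun (inv (qop \<mu>) D))"
proof -
  have inv: "inv (qop \<mu>) (qop \<mu> c) = c" for c :: "'a sym"
    by (rule inv_f_f) (simp add: inj_def qop_inject)
  have lin: "(\<lambda>f. a *\<^sub>R qop \<mu> c f + b *\<^sub>R qop \<mu> c' f) = qop \<mu> (a *\<^sub>R c + b *\<^sub>R c')" for a b and c c' :: "'a sym"
    by (simp add: fun_eq_iff qop_linear)
  show ?thesis
    unfolding full_symbol_map_def Union_diff_ops_qop[of \<mu>]
  proof (intro conjI ballI allI)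
    fix D E :: "'a sfun \<Rightarrow> 'a sfun" and a b
    assume "D \<in> range (qop \<mu>)" "E \<in> range (qop \<mu>)"
    then show "sym_fun (inv (qop \<mu>) (\<lambda>f. a *\<^sub>R D f + b *\<^sub>R E f))
      = (\<lambda>x \<xi>. a * sym_fun (inv (qop \<mu>) D) x \<xi> + b * sym_fun (inv (qop \<mu>) E) x \<xi>)"
      by (auto simp: lin inv sym_fun_linear fun_eq_iff)
  next
    fix k and D :: "'a sfun \<Rightarrow> 'a sfun"
    assume "D \<in> diff_ops k"
    then obtain c where c: "D = qop \<mu> c" "c \<in> below (Suc k)" unfolding diff_ops_qop[of _ \<mu>] by blast
    have "c - part k c \<in> below (Suc k)"
      using c(2) by (intro subspace_diff subspace_below part_below) auto
    then have "c - part k c \<in> below k" by (rule below_SucI) (simp add: part_linear)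
    then show "(\<lambda>x \<xi>. sym_fun (inv (qop \<mu>) D) x \<xi> - principal_symbol k D x \<xi>) \<in> symbols_below k"
      using c(2) by (simp add: c(1) inv principal_symbol_qop sym_fun_diff symbols_below_eq)
  next
    fix K :: "'a vfield" and D :: "'a sfun \<Rightarrow> 'a sfun"
    assume "K \<in> proj" "D \<in> range (qop \<mu>)"
    then show "sym_fun (inv (qop \<mu>) (ad_op \<mu> K D)) = lie_symbol K (sym_fun (inv (qop \<mu>) D))"
      by (auto simp: ad_op_qop inv lie_symbol_sym_fun)
  qed (simp add: symbols_eq)
qed

text \<open>Composed with the quantisation, a full symbol map becomes an equivariant endomorphism
  \<open>T\<close> of symbols. Its normalisation makes \<open>T\<close> the identity up to lower
  degree, and the corrections are intertwiners between distinct degrees, hence zero.\<close>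

lemma full_symbol_map_unique:
  assumes "full_symbol_map \<mu> \<sigma>"
  shows "\<sigma> (qop \<mu> c) = sym_fun (c :: 'd::finite sym)"
proof -
  have symb: "\<sigma> (qop \<mu> c) \<in> range sym_fun" for c :: "'d sym"
    using assms unfolding full_symbol_map_def Union_diff_ops_qop[of \<mu>] symbols_eq by blast
  define T where "T c = inv sym_fun (\<sigma> (qop \<mu> c))" for c
  have T: "\<sigma> (qop \<mu> c) = sym_fun (T c)" for c
    unfolding T_def by (rule f_inv_into_f[symmetric, OF symb])
  have lin: "T (a *\<^sub>R c + b *\<^sub>R c') = a *\<^sub>R T c + b *\<^sub>R T c'" for a b c c'
  proof -
    have "\<sigma> (\<lambda>f. a *\<^sub>R qop \<mu> c f + b *\<^sub>R qop \<mu> c' f)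
        = (\<lambda>x \<xi>. a * \<sigma> (qop \<mu> c) x \<xi> + b * \<sigma> (qop \<mu> c') x \<xi>)"
      using assms unfolding full_symbol_map_def Union_diff_ops_qop[of \<mu>] by blast
    moreover have "(\<lambda>f. a *\<^sub>R qop \<mu> c f + b *\<^sub>R qop \<mu> c' f) = qop \<mu> (a *\<^sub>R c + b *\<^sub>R c')"
      by (simp add: fun_eq_iff qop_linear)
    ultimately have "sym_fun (T (a *\<^sub>R c + b *\<^sub>R c')) = sym_fun (a *\<^sub>R T c + b *\<^sub>R T c')"
      by (simp add: T sym_fun_linear fun_eq_iff)
    then show ?thesis by (simp add: sym_fun_inject)
  qed
  have linT: "linear T"
    using lin[of 1 _ 1] lin[of _ _ 0] by (intro linearI) simp_all
  have lieT: "T (lieS K c) = lieS K (T c)" if "K \<in> proj" for K c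
  proof -
    have "\<sigma> (ad_op \<mu> K (qop \<mu> c)) = lie_symbol K (\<sigma> (qop \<mu> c))"
      using assms that unfolding full_symbol_map_def Union_diff_ops_qop[of \<mu>] by blast
    then show ?thesis by (simp add: ad_op_qop[OF that] T lie_symbol_sym_fun sym_fun_inject)
  qed
  have top: "T (part k c) - part k c \<in> below k" for k c
  proof -
    have b: "part k c \<in> below (Suc k)" by (rule part_below) simp
    then have "qop \<mu> (part k c) \<in> diff_ops k" unfolding diff_ops_qop[of _ \<mu>] by blast
    then have "(\<lambda>x \<xi>. \<sigma> (qop \<mu> (part k c)) x \<xi> - principal_symbol k (qop \<mu> (part k c)) x \<xi>) \<in> symbols_below k"
      using assms unfolding full_symbol_map_def by blast
    then show ?thesis
      by (auto simp: T principal_symbol_qop[OF b] sym_fun_diff symbols_below_eq sym_fun_inject)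
  qed
  have "T (part k c) = part k c" for k c
  proof -
    have "part j (T (part k c)) = 0" if "j < k" for j
    proof -
      interpret intertwiner "\<lambda>c. part j (T c)" k j
        by (rule intertwiner.intro)
          (use linear_compose[OF linT linear_part] in \<open>simp_all add: o_def lieT part_lieS\<close>)
      show ?thesis using eq_0 that by simp
    qed
    then have "part j (T (part k c) - part k c) = 0" if "j < k" for j
      using that by (simp add: part_linear part_part)
    then have "T (part k c) - part k c = 0"
      using below_sum_part[OF top, of k c] by simp
    then show ?thesis by simp
  qed
  then have "T c = c"
    by (induction c rule: sym_part_induct) (simp_all add: linear_add[OF linT])
  then show ?thesis by (simp add: T)
qed

text \<open>Existence makes the chosen map a full symbol map, and uniqueness then fixes its values
  on all differential operators.\<close>

lemma symbol_map_qop [simp]: "symbol_map \<mu> (qop \<mu> c) = sym_fun c"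
  unfolding symbol_map_def
  by (rule full_symbol_map_unique) (rule someI[where P = "full_symbol_map \<mu>"], rule full_symbol_map_exists)

lemma quantisation_sym_fun [simp]: "quantisation \<mu> (sym_fun c) = qop \<mu> c"
proof -
  have "inj_on (symbol_map \<mu>) (range (qop \<mu> :: 'a sym \<Rightarrow> _))"
    by (auto simp: inj_on_def sym_fun_inject)
  from inv_into_f_f[OF this rangeI[of _ c]] show ?thesis
    by (simp add: quantisation_def Union_diff_ops_qop[of \<mu>])
qed

text \<open>Quantisation preserves principal symbols, so peeling off quantised principal symbols is,
  on the symbol at weight \<open>l\<close>, the removal of the homogeneous components from the
  top.\<close>

lemma canonical_part_qop:
  assumes "c \<in> below (Suc n)"
  shows "i \<le> n \<Longrightarrow> canonical_part l n (qop l c) i = qop l (part (n - i) c)"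
proof (induction i rule: less_induct)
  case (less i)
  let ?e = "c - (\<Sum>j<i. part (n - j) c)"
  have "(\<lambda>f. qop l c f - (\<Sum>j<i. canonical_part l n (qop l c) j f)) = qop l ?e"
    using less by (simp add: fun_eq_iff qop_linear)
  moreover have "?e \<in> below (Suc (n - i))"
  proof -
    have "lookup ?e \<alpha> = 0" if "Suc (n - i) \<le> size \<alpha>" for \<alpha>
    proof (cases "size \<alpha> \<le> n")
      case True
      \<comment> \<open>Exactly one subtracted component, the one with
        \<open>j = n - size \<alpha>\<close>, contains this monomial.\<close>
      then have eq: "size \<alpha> = n - j \<longleftrightarrow> j = n - size \<alpha>" if "j < i" for j
        using that less.prems by auto
      then have "(\<Sum>j<i. lookup (part (n - j) c) \<alpha>) = (\<Sum>j<i. if j = n - size \<alpha> then lookup c \<alpha> else 0)"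
        by (intro sum.cong refl) (simp add: lookup_part eq)
      also have "\<dots> = lookup c \<alpha>" using that True less.prems by auto
      finally show ?thesis by (simp add: lookup_minus lookup_sum)
    next
      case False
      then have "lookup c \<alpha> = 0" using assms by (simp add: below_def)
      moreover have "(\<Sum>j<i. lookup (part (n - j) c) \<alpha>) = 0"
        by (rule sum.neutral) (use False in \<open>auto simp: lookup_part\<close>)
      ultimately show ?thesis by (simp add: lookup_minus lookup_sum)
    qed
    then show ?thesis by (simp add: below_def)
  qed
  moreover have "part (n - i) ?e = part (n - i) c"
  proof -
    have "part (n - i) (part (n - j) c) = 0" if "j < i" for j
      using that less.prems by (simp add: part_part)
    then show ?thesis by (simp add: part_linear)
  qed
  ultimately show ?case
    by (subst canonical_part.simps) (simp add: principal_symbol_qop)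
qed

section \<open>Operators on the algebra of densities\<close>

lemma graded_op_eq: "graded_op A = pm_sum (\<lambda>\<mu> f. single \<mu> (A \<mu> f))"
  by (simp add: fun_eq_iff graded_op_def pm_sum_def)

lemma linear_graded_op:
  assumes "\<And>\<mu>. linear (A \<mu>)"
  shows "linear (graded_op A)"
  unfolding graded_op_eq
  by (intro linear_pm_sum linear_compose[OF assms linear_single, unfolded o_def])

lemma graded_op_single:
  assumes "linear (A \<mu>)"
  shows "graded_op A (single \<mu> f) = single \<mu> (A \<mu> f)"
  by (simp add: graded_op_eq pm_sum_single linear_0[OF assms])

lemma restrict_weight_graded_op:
  "linear (A \<mu>) \<Longrightarrow> restrict_weight \<mu> (graded_op A) = A \<mu>"
  by (simp add: fun_eq_iff restrict_weight_def graded_op_single)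

lemma weight_zero_single:
  "weight_zero L \<Longrightarrow> L (single \<mu> f) = single \<mu> (restrict_weight \<mu> L f)"
  unfolding weight_zero_def restrict_weight_def by (metis lookup_single_eq)

lemma linear_restrict_weight:
  assumes "linear L"
  shows "linear (restrict_weight \<mu> L)"
  unfolding restrict_weight_def
  by (rule linearI)
    (simp_all add: single_add linear_add[OF assms] lookup_add lookup_scaleR linear_scale[OF assms]
      flip: scaleR_single)

lemma weight_zero_eq_graded_op:
  assumes "linear L" "weight_zero L"
  shows "L = graded_op (\<lambda>\<mu>. restrict_weight \<mu> L)"
proof
  fix s
  show "L s = graded_op (\<lambda>\<mu>. restrict_weight \<mu> L) s"
    by (rule linear_eqI[OF assms(1)])
      (simp_all add: linear_graded_op linear_restrict_weight assms weight_zero_single graded_op_single)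
qed

lemma graded_op_compose:
  assumes "\<And>\<mu>. linear (A \<mu>)" "\<And>\<mu>. linear (B \<mu>)"
  shows "graded_op A (graded_op B s) = graded_op (\<lambda>\<mu> f. A \<mu> (B \<mu> f)) s"
proof (rule linear_eqI[where s = s])
  show "linear (\<lambda>s. graded_op A (graded_op B s))"
    using linear_compose[OF linear_graded_op[OF assms(2)] linear_graded_op[OF assms(1)]] by (simp add: o_def)
  have lin: "linear (\<lambda>f. A \<mu> (B \<mu> f))" for \<mu>
    using linear_compose[OF assms(2) assms(1)] by (simp add: o_def)
  show "linear (graded_op (\<lambda>\<mu> f. A \<mu> (B \<mu> f)))"
    using lin by (rule linear_graded_op)
  show "graded_op A (graded_op B (single k v)) = graded_op (\<lambda>\<mu> f. A \<mu> (B \<mu> f)) (single k v)" for k v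
    by (simp add: graded_op_single assms lin)
qed

lemma linear_scale_id: "linear (\<lambda>f. r *\<^sub>R f)"
  by (rule linearI) (simp_all add: scaleR_add_right)

lemma linear_weight_op: "linear weight_op"
  unfolding weight_op_def by (rule linear_graded_op) (rule linear_scale_id)

lemma weight_op_funpow: "(weight_op ^^ j) s = graded_op (\<lambda>\<mu> f. \<mu> ^ j *\<^sub>R f) s"
proof (induction j)
  case 0
  have lin: "linear (\<lambda>s :: 'a density. s)" "linear (\<lambda>f :: 'a sfun. f)" by (auto intro: linearI)
  show ?case
    by (rule linear_eqI[where s = s]) (simp_all add: lin graded_op_single linear_graded_op linear_scale_id)
next
  case (Suc j)
  then show ?case
    by (simp add: weight_op_def graded_op_compose linear_scale_id)
qed

lemma ad_hat_graded_op:
  assumes "\<And>\<mu>. linear (A \<mu>)"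
  shows "ad_hat K (graded_op A) = graded_op (\<lambda>\<mu>. ad_op \<mu> K (A \<mu>))"
proof
  fix s
  have lin: "linear (\<lambda>f. lie_density K \<mu> (A \<mu> f))" "linear (\<lambda>f. A \<mu> (lie_density K \<mu> f))" for \<mu>
    using linear_compose[OF assms linear_lie_density] linear_compose[OF linear_lie_density assms]
    by (simp_all add: o_def)
  then have lin': "linear (\<lambda>f. lie_density K \<mu> (A \<mu> f) - A \<mu> (lie_density K \<mu> f))" for \<mu>
    by (rule linear_compose_sub)
  have "linear (ad_hat K (graded_op A))"
    unfolding ad_hat_def lie_densities_def graded_op_compose[OF linear_lie_density assms]
      graded_op_compose[OF assms linear_lie_density]
    by (intro linear_compose_sub linear_graded_op lin)
  then show "ad_hat K (graded_op A) s = graded_op (\<lambda>\<mu>. ad_op \<mu> K (A \<mu>)) s"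
    unfolding ad_op_def[abs_def]
    by (rule linear_eqI) (simp_all add: linear_graded_op lin' ad_hat_def lie_densities_def
      graded_op_single assms linear_lie_density single_diff)
qed

subsection \<open>Order of operators\<close>

lemma order_le_zero: "order_le k (\<lambda>s. 0)"
  by (induction k) (auto intro: exI[of _ 0])

lemma order_le_mult: "order_le k (\<lambda>s. m * s)"
  by (cases k) (auto simp: mult.left_commute order_le_zero)

lemma order_le_Suc: "order_le k L \<Longrightarrow> order_le (Suc k) L"
proof (induction k arbitrary: L)
  case 0
  then obtain m where "L = (\<lambda>s. m * s)" by auto
  then show ?case using order_le_mult by blast
next
  case (Suc k)
  then show ?case by (subst order_le.simps(2)) auto
qed

lemma order_le_mono: "k \<le> n \<Longrightarrow> order_le k L \<Longrightarrow> order_le n L"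
  by (induction rule: dec_induct) (auto intro: order_le_Suc simp del: order_le.simps)

lemma order_le_add: "order_le k L \<Longrightarrow> order_le k M \<Longrightarrow> order_le k (\<lambda>s. L s + M s)"
proof (induction k arbitrary: L M)
  case 0
  then obtain m m' where "L = (\<lambda>s. m * s)" "M = (\<lambda>s. m' * s)" by auto
  then show ?case by (auto intro!: exI[of _ "m + m'"] simp: distrib_right)
next
  case (Suc k)
  have "order_le k (\<lambda>s. (L (m * s) - m * L s) + (M (m * s) - m * M s))" for m
    using Suc by simp
  moreover have "(\<lambda>s. (L (m * s) - m * L s) + (M (m * s) - m * M s))
      = (\<lambda>s. (L (m * s) + M (m * s)) - m * (L s + M s))" for m
    by (simp add: algebra_simps)
  ultimately show ?case by simp
qed

lemma order_le_sum: "(\<And>t. t \<in> S \<Longrightarrow> order_le k (L t)) \<Longrightarrow> order_le k (\<lambda>s. \<Sum>t\<in>S. L t s)"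
  by (induction S rule: infinite_finite_induct)
    (simp_all add: order_le_zero order_le_add del: order_le.simps)

text \<open>The commutator of a composite with \<open>m\<close> is
  \<open>L [M, m] + [L, m] M\<close>; each summand has total order one less. The hypothesis on
  differences serves to split the argument of \<open>L\<close>.\<close>

lemma order_le_compose:
  assumes "\<And>x y. L (x - y) = L x - L y" "order_le a L" "order_le b M"
  shows "order_le (a + b) (\<lambda>s. L (M s))"
proof -
  have "a + b = n \<Longrightarrow> (\<forall>x y. L (x - y) = L x - L y) \<Longrightarrow> order_le a L \<Longrightarrow> order_le b M \<Longrightarrow>
      order_le n (\<lambda>s. L (M s))" for n
  proof (induction n arbitrary: a b L M)
    case 0
    then obtain m m' where "L = (\<lambda>s. m * s)" "M = (\<lambda>s. m' * s)" by auto
    then show ?case by (auto intro!: exI[of _ "m * m'"] simp: mult.assoc)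
  next
    case (Suc n)
    show ?case
      unfolding order_le.simps(2)
    proof
      fix m
      have "order_le n (\<lambda>s. L (M (m * s) - m * M s))"
      \<comment> \<open>For \<open>b = 0\<close> there is no order to lower, but then
        \<open>M\<close> commutes with \<open>m\<close>; the case \<open>a = 0\<close> below is
        similar.\<close>
      proof (cases b)
        case 0
        then obtain m' where "M = (\<lambda>s. m' * s)" using Suc.prems by auto
        moreover have "L 0 = 0" using Suc.prems(2) by (metis diff_self)
        ultimately show ?thesis by (simp add: mult.left_commute order_le_zero)
      next
        case (Suc b')
        then show ?thesis using Suc.prems \<open>a + b = Suc n\<close>
          by (intro Suc.IH[of a b' L "\<lambda>s. M (m * s) - m * M s"]) auto
      qed
      moreover have "order_le n (\<lambda>s. L (m * M s) - m * L (M s))"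
      proof (cases a)
        case 0
        then obtain m' where "L = (\<lambda>s. m' * s)" using Suc.prems by auto
        then show ?thesis by (simp add: mult.left_commute order_le_zero)
      next
        case (Suc a')
        then show ?thesis using Suc.prems \<open>a + b = Suc n\<close>
          by (intro Suc.IH[of a' b "\<lambda>s. L (m * s) - m * L s" M]) (auto simp: right_diff_distrib)
      qed
      ultimately have "order_le n (\<lambda>s. L (M (m * s) - m * M s) + (L (m * M s) - m * L (M s)))"
        by (rule order_le_add)
      then show "order_le n (\<lambda>s. L (M (m * s)) - m * L (M s))"
        using Suc.prems(2) by simp
    qed
  qed
  then show ?thesis using assms by blast
qed

lemma order_le_left_mult: "order_le k L \<Longrightarrow> order_le k (\<lambda>s. m * L s)"
  using order_le_compose[of "\<lambda>s. m * s" 0 k L] order_le_mult[of 0 m]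
  by (simp add: right_diff_distrib del: order_le.simps)

lemma order_le_scaleR: "order_le k L \<Longrightarrow> order_le k (\<lambda>s. r *\<^sub>R L s)"
  for L :: "'a::{comm_ring_1, real_algebra_1} \<Rightarrow> 'a"
  using order_le_left_mult[of k L "of_real r"] by (simp add: scaleR_conv_of_real)

lemma order_le_derivation: "(\<And>m s. L (m * s) = m * L s + L m * s) \<Longrightarrow> order_le (Suc 0) L"
  by (auto simp: algebra_simps)

lemma order_le_graded_partial: "order_le (Suc 0) (graded_op (\<lambda>\<mu>. partial i))"
proof (rule order_le_derivation)
  let ?L = "graded_op (\<lambda>\<mu>. partial i)"
  have add: "?L (x + y) = ?L x + ?L y" for x y
    using linear_add[OF linear_graded_op[OF linear_partial]] .
  fix m s
  show "?L (m * s) = m * ?L s + ?L m * s"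
  proof (rule additive_eqI[where s = s])
    fix \<nu> g
    show "?L (m * single \<nu> g) = m * ?L (single \<nu> g) + ?L m * single \<nu> g"
      by (rule additive_eqI[where s = m])
        (simp_all add: add distrib_right linear_partial graded_op_single mult_single
          partial_mult single_add algebra_simps)
  qed (simp_all add: add distrib_left algebra_simps)
qed

text \<open>Weights add under multiplication, so the weight operator is a derivation of the algebra
  of densities.\<close>

lemma order_le_weight_op: "order_le (Suc 0) weight_op"
proof (rule order_le_derivation)
  have add: "weight_op (x + y) = weight_op x + weight_op y" for x y :: "'a density"
    using linear_add[OF linear_weight_op] .
  have single: "weight_op (single \<mu> f) = single \<mu> (\<mu> *\<^sub>R f)" for \<mu> and f :: "'a sfun"
    unfolding weight_op_def by (simp add: graded_op_single linear_scale_id)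
  fix m s :: "'a density"
  show "weight_op (m * s) = m * weight_op s + weight_op m * s"
  proof (rule additive_eqI[where s = s])
    fix \<nu> and g :: "'a sfun"
    show "weight_op (m * single \<nu> g) = m * weight_op (single \<nu> g) + weight_op m * single \<nu> g"
      by (rule additive_eqI[where s = m])
        (simp_all add: add distrib_right single mult_single single_add[symmetric] scaleR_add_left
          add.commute)
  qed (simp_all add: add distrib_left add_ac)
qed

lemma linear_funpow: "linear L \<Longrightarrow> linear (L ^^ j)"
  for L :: "'a::real_vector \<Rightarrow> 'a"
proof (induction j)
  case (Suc j)
  from linear_compose[OF Suc.IH[OF Suc.prems] Suc.prems] show ?case by (simp add: o_def)
qed (auto intro: linearI)

lemma order_le_weight_op_funpow: "order_le j (weight_op ^^ j)"
proof (induction j)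
  case 0
  show ?case using order_le_mult[of 0 1] by (simp add: id_def)
next
  case (Suc j)
  from order_le_compose[OF linear_diff[OF linear_weight_op] order_le_weight_op this]
  show ?case by (simp add: o_def del: order_le.simps)
qed

lemma order_le_graded_mult: "order_le 0 (graded_op (\<lambda>\<mu> f. m * f))"
proof -
  have "graded_op (\<lambda>\<mu> f. m * f) s = single 0 m * s" for s
    by (rule linear_eqI[where s = s])
      (simp_all add: linear_graded_op linear_mult_left graded_op_single mult_single)
  then show ?thesis by auto
qed

lemma order_le_graded_mpartial: "order_le (size \<alpha>) (graded_op (\<lambda>\<mu>. mpartial \<alpha>))"
proof (induction \<alpha>)
  case empty
  then show ?case using order_le_graded_mult[of 1] by (simp del: order_le.simps)
next
  case (add i \<alpha>)
  have eq: "graded_op (\<lambda>\<mu>. mpartial (add_mset i \<alpha>))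
      = (\<lambda>s. graded_op (\<lambda>\<mu>. mpartial \<alpha>) (graded_op (\<lambda>\<mu>. partial i) s))"
    by (simp add: fun_eq_iff graded_op_compose linear_mpartial linear_partial mpartial_add_mset[abs_def])
  have "order_le (size \<alpha> + Suc 0) (\<lambda>s. graded_op (\<lambda>\<mu>. mpartial \<alpha>) (graded_op (\<lambda>\<mu>. partial i) s))"
    by (rule order_le_compose[OF linear_diff[OF linear_graded_op[OF linear_mpartial]] add
        order_le_graded_partial])
  then show ?case unfolding eq by (simp del: order_le.simps)
qed

lemma order_le_graded_normal_op:
  assumes "c \<in> below (Suc k)"
  shows "order_le k (graded_op (\<lambda>\<mu>. normal_op c))"
proof -
  have eq: "graded_op (\<lambda>\<mu>. normal_op c) s
    = (\<Sum>\<alpha>\<in>keys c. graded_op (\<lambda>\<mu> f. lookup c \<alpha> * f) (graded_op (\<lambda>\<mu>. mpartial \<alpha>) s))" for s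
  proof (rule linear_eqI[where s = s])
    show "linear (graded_op (\<lambda>\<mu>. normal_op c))" by (rule linear_graded_op[OF linear_normal_op])
    show "linear (\<lambda>s. \<Sum>\<alpha>\<in>keys c. graded_op (\<lambda>\<mu> f. lookup c \<alpha> * f) (graded_op (\<lambda>\<mu>. mpartial \<alpha>) s))"
      by (intro linear_compose_sum ballI
        linear_compose[OF linear_graded_op[OF linear_mpartial] linear_graded_op[OF linear_mult_left], unfolded o_def])
    show "graded_op (\<lambda>\<mu>. normal_op c) (single \<nu> f)
      = (\<Sum>\<alpha>\<in>keys c. graded_op (\<lambda>\<mu> f. lookup c \<alpha> * f) (graded_op (\<lambda>\<mu>. mpartial \<alpha>) (single \<nu> f)))" for \<nu> f
      by (simp add: graded_op_single linear_normal_op linear_mpartial linear_mult_left normal_op_def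
        pm_sum_def linear_sum[OF linear_single])
  qed
  have "order_le k (\<lambda>s. graded_op (\<lambda>\<mu> f. lookup c \<alpha> * f) (graded_op (\<lambda>\<mu>. mpartial \<alpha>) s))"
    if "\<alpha> \<in> keys c" for \<alpha>
  proof -
    have "size \<alpha> \<le> k" using that assms by (auto simp: below_def in_keys_iff not_less_eq_eq[symmetric])
    then show ?thesis
      using order_le_compose[OF linear_diff[OF linear_graded_op[OF linear_mult_left]]
          order_le_graded_mult[of "lookup c \<alpha>"] order_le_graded_mpartial[of \<alpha>]]
      by (intro order_le_mono[of "size \<alpha>" k]) simp_all
  qed
  then show ?thesis unfolding eq by (rule order_le_sum)
qed

lemma poly_eq_sum:
  fixes x :: real
  assumes "degree p \<le> n"
  shows "poly p x = (\<Sum>j\<le>n. coeff p j * x ^ j)"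
  unfolding poly_altdef
  by (rule sum.mono_neutral_left) (use assms in \<open>auto simp: coeff_eq_0\<close>)

lemma graded_op_poly:
  assumes "degree p \<le> n"
  shows "graded_op (\<lambda>\<mu> f. poly p \<mu> *\<^sub>R f) s = (\<Sum>j\<le>n. coeff p j *\<^sub>R (weight_op ^^ j) s)"
proof (rule linear_eqI[where s = s])
  show "linear (graded_op (\<lambda>\<mu> f. poly p \<mu> *\<^sub>R f))" by (rule linear_graded_op[OF linear_scale_id])
  show "linear (\<lambda>s. \<Sum>j\<le>n. coeff p j *\<^sub>R (weight_op ^^ j) s)"
    by (intro linear_compose_sum ballI linear_compose_scale_right linear_funpow linear_weight_op)
  show "graded_op (\<lambda>\<mu> f. poly p \<mu> *\<^sub>R f) (single \<nu> f) = (\<Sum>j\<le>n. coeff p j *\<^sub>R (weight_op ^^ j) (single \<nu> f))" for \<nu> f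
    unfolding weight_op_funpow graded_op_single[OF linear_scale_id]
    by (simp add: poly_eq_sum[OF assms] scaleR_single scaleR_sum_left linear_sum[OF linear_single])
qed

text \<open>A polynomial in the weight is a polynomial in a first-order operator, so its degree is
  paid for in order.\<close>

lemma order_le_graded_poly:
  assumes "degree p \<le> r" "linear A" "order_le k (graded_op (\<lambda>\<mu>. A))"
  shows "order_le (r + k) (graded_op (\<lambda>\<mu> f. poly p \<mu> *\<^sub>R A f))"
proof -
  have "order_le r (graded_op (\<lambda>\<mu> f. poly p \<mu> *\<^sub>R f))"
    unfolding graded_op_poly[OF assms(1)]
    by (intro order_le_sum order_le_scaleR order_le_mono[OF _ order_le_weight_op_funpow]) auto
  from order_le_compose[OF linear_diff[OF linear_graded_op[OF linear_scale_id]] this assms(3)]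
  show ?thesis by (simp add: graded_op_compose linear_scale_id assms(2) del: order_le.simps)
qed

section \<open>The liftings given by a matrix\<close>

definition reweight :: "(nat \<Rightarrow> nat \<Rightarrow> real) \<Rightarrow> nat \<Rightarrow> real \<Rightarrow> real \<Rightarrow> 'd::finite sym \<Rightarrow> 'd sym" where
  "reweight a n l \<mu> c = (\<Sum>i\<le>n. (row_poly a n i \<mu> / row_poly a n i l) *\<^sub>R part (n - i) c)"

lemma linear_reweight: "linear (reweight a n l \<mu>)"
  by (rule linearI) (simp_all add: reweight_def part_linear scaleR_add_right sum.distrib
      scaleR_sum_right mult.commute)

lemma reweight_lieS: "reweight a n l \<mu> (lieS K c) = lieS K (reweight a n l \<mu> c)"
  by (simp add: reweight_def part_lieS lieS_linear)

lemma sum_part_reverse: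
  assumes "c \<in> below (Suc n)"
  shows "(\<Sum>i\<le>n. part (n - i) c) = c"
  using below_sum_part[OF assms] sum.nat_diff_reindex[of "\<lambda>k. part k c" "Suc n"]
  by (simp add: lessThan_Suc_atMost)

lemma reweight_same:
  assumes "admissible_matrix n l a" "c \<in> below (Suc n)"
  shows "reweight a n l l c = c"
proof -
  have "reweight a n l l c = (\<Sum>i\<le>n. part (n - i) c)"
    unfolding reweight_def
    by (rule sum.cong) (use assms(1) in \<open>simp_all add: admissible_matrix_def\<close>)
  then show ?thesis using sum_part_reverse[OF assms(2)] by simp
qed

lemma linear_row_poly_weight: "linear (row_poly_weight a n i)"
  unfolding row_poly_weight_def
  by (intro linear_compose_sum ballI linear_compose_scale_right linear_funpow linear_weight_op)

lemma row_poly_weight_single: "row_poly_weight a n i (single \<mu> f) = single \<mu> (row_poly a n i \<mu> *\<^sub>R f)"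
  unfolding row_poly_weight_def weight_op_funpow graded_op_single[OF linear_scale_id]
  by (simp add: row_poly_def scaleR_single scaleR_sum_left linear_sum[OF linear_single])

lemma dlo_lifting_qop: "dlo_lifting l (qop l c) = graded_op (\<lambda>\<mu>. qop \<mu> c)"
  by (simp add: dlo_lifting_def)

text \<open>The canonical parts are the homogeneous components of the symbol at weight
  \<open>l\<close>, so on symbols the lifting is diagonal: rescale each component, then quantise at
  the new weight.\<close>

lemma matrix_lifting_qop:
  assumes "c \<in> below (Suc n)"
  shows "matrix_lifting a n l (qop l c) = graded_op (\<lambda>\<mu>. qop \<mu> (reweight a n l \<mu> c))"
proof
  fix s
  have eq: "matrix_lifting a n l (qop l c) = (\<lambda>s. \<Sum>i\<le>n. (1 / row_poly a n i l) *\<^sub>R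
      row_poly_weight a n i (graded_op (\<lambda>\<mu>. qop \<mu> (part (n - i) c)) s))"
    unfolding matrix_lifting_def fun_eq_iff
    by (intro allI sum.cong) (simp_all add: canonical_part_qop[OF assms] dlo_lifting_qop)
  have "linear (matrix_lifting a n l (qop l c))"
    unfolding eq
    by (intro linear_compose_sum ballI linear_compose_scale_right
      linear_compose[OF linear_graded_op linear_row_poly_weight, unfolded o_def] linear_qop)
  then show "matrix_lifting a n l (qop l c) s = graded_op (\<lambda>\<mu>. qop \<mu> (reweight a n l \<mu> c)) s"
  proof (rule linear_eqI)
    show "linear (graded_op (\<lambda>\<mu>. qop \<mu> (reweight a n l \<mu> c)))" by (rule linear_graded_op[OF linear_qop])
    show "matrix_lifting a n l (qop l c) (single \<nu> f) = graded_op (\<lambda>\<mu>. qop \<mu> (reweight a n l \<mu> c)) (single \<nu> f)" for \<nu> f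
      unfolding eq graded_op_single[OF linear_qop] row_poly_weight_single
      by (simp add: reweight_def qop_linear scaleR_single linear_sum[OF linear_single])
  qed
qed

text \<open>Each step of the recursion contributes one factor affine in the weight.\<close>

lemma quant_coeff_poly: "\<exists>p. degree p \<le> r \<and> (\<forall>\<mu>. quant_coeff d \<mu> k r = poly p \<mu>)"
proof (induction r)
  case 0
  show ?case by (intro exI[of _ 1]) simp
next
  case (Suc r)
  then obtain p where p: "degree p \<le> r" "\<And>\<mu>. quant_coeff d \<mu> k r = poly p \<mu>" by blast
  let ?a = "[:real k - real r - 1, d + 1:]"
  let ?q = "smult (1 / ((real r + 1) * (2 * real k + d - real r - 1))) (p * ?a)"
  have "degree ?q \<le> degree (p * ?a)" by (rule degree_smult_le)
  also have "\<dots> \<le> degree p + degree ?a" by (rule degree_mult_le)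
  also have "\<dots> \<le> r + 1" by (rule add_mono[OF p(1)]) simp
  finally have "degree ?q \<le> Suc r" by simp
  moreover have "quant_coeff d \<mu> k (Suc r) = poly ?q \<mu>" for \<mu>
    by (simp add: p(2) divide_simps algebra_simps)
  ultimately show ?case by blast
qed

lemma row_poly_poly:
  assumes "admissible_matrix n l a" "i \<le> n"
  shows "\<exists>p. degree p \<le> i \<and> (\<forall>\<mu>. row_poly a n i \<mu> = poly p \<mu>)"
proof (intro exI conjI allI)
  let ?p = "\<Sum>j\<le>n. monom (a i j) j"
  have "degree (monom (a i j) j) \<le> i" if "j \<le> n" for j
  proof (cases "i < j")
    case True
    then have "a i j = 0" using assms that by (auto simp: admissible_matrix_def)
    then show ?thesis by simp
  next
    case False
    then show ?thesis using degree_monom_le[of "a i j" j] by linarith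
  qed
  then show "degree ?p \<le> i" by (intro degree_sum_le) auto
  show "row_poly a n i \<mu> = poly ?p \<mu>" for \<mu>
    by (simp add: row_poly_def poly_sum poly_monom)
qed

lemma qop_part:
  fixes c :: "'d::finite sym"
  shows "qop \<mu> (part k c) f
    = (\<Sum>r\<le>k. quant_coeff (real CARD('d)) \<mu> k r *\<^sub>R normal_op ((divergence ^^ r) (part k c)) f)"
  by (simp add: qop_def qmap_part normal_op_linear)

text \<open>Separates the dependence on the weight, collected in the polynomials
  \<open>p i r\<close>, from operators that do not depend on it, so that order and polynomiality can
  be read off term by term.\<close>

lemma qop_reweight_expansion:
  assumes "admissible_matrix n l a"
  obtains p where "\<And>i r. i \<le> n \<Longrightarrow> degree (p i r) \<le> i + r"
    "\<And>\<mu> (c :: 'd::finite sym) f. qop \<mu> (reweight a n l \<mu> c) f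
      = (\<Sum>(i, r)\<in>(SIGMA i:{..n}. {..n - i}). poly (p i r) \<mu> *\<^sub>R normal_op ((divergence ^^ r) (part (n - i) c)) f)"
proof -
  have "\<forall>i. \<exists>p. i \<le> n \<longrightarrow> degree p \<le> i \<and> (\<forall>\<mu>. row_poly a n i \<mu> = poly p \<mu>)"
    using row_poly_poly[OF assms] by blast
  then obtain P where P: "\<And>i. i \<le> n \<Longrightarrow> degree (P i) \<le> i"
    "\<And>i \<mu>. i \<le> n \<Longrightarrow> row_poly a n i \<mu> = poly (P i) \<mu>" by metis
  have "\<forall>i r. \<exists>p. degree p \<le> r \<and> (\<forall>\<mu>. quant_coeff (real CARD('d)) \<mu> (n - i) r = poly p \<mu>)"
    using quant_coeff_poly by blast
  then obtain R where R: "\<And>i r. degree (R i r) \<le> r"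
    "\<And>i r \<mu>. quant_coeff (real CARD('d)) \<mu> (n - i) r = poly (R i r) \<mu>" by metis
  define p where "p i r = smult (1 / row_poly a n i l) (P i * R i r)" for i r
  show ?thesis
  proof (rule that)
    show "degree (p i r) \<le> i + r" if "i \<le> n" for i r
    proof -
      have "degree (p i r) \<le> degree (P i * R i r)" unfolding p_def by (rule degree_smult_le)
      also have "\<dots> \<le> degree (P i) + degree (R i r)" by (rule degree_mult_le)
      also have "\<dots> \<le> i + r" by (intro add_mono P R that)
      finally show ?thesis .
    qed
    fix \<mu> and c :: "'d sym" and f
    have "qop \<mu> (reweight a n l \<mu> c) f
      = (\<Sum>i\<le>n. \<Sum>r\<le>n - i. poly (p i r) \<mu> *\<^sub>R normal_op ((divergence ^^ r) (part (n - i) c)) f)"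
      unfolding reweight_def qop_linear qop_part scaleR_sum_right
      by (intro sum.cong refl) (simp add: P(2) R(2) p_def)
    then show "qop \<mu> (reweight a n l \<mu> c) f
      = (\<Sum>(i, r)\<in>(SIGMA i:{..n}. {..n - i}). poly (p i r) \<mu> *\<^sub>R normal_op ((divergence ^^ r) (part (n - i) c)) f)"
      by (simp add: sum.Sigma)
  qed
qed

lemma graded_op_sum:
  assumes "\<And>t \<mu>. linear (A t \<mu>)"
  shows "graded_op (\<lambda>\<mu> f. \<Sum>t\<in>S. A t \<mu> f) s = (\<Sum>t\<in>S. graded_op (A t) s)"
proof (rule linear_eqI[where s = s])
  have lin: "linear (\<lambda>f. \<Sum>t\<in>S. A t \<mu> f)" for \<mu> by (intro linear_compose_sum ballI assms)
  then show "linear (graded_op (\<lambda>\<mu> f. \<Sum>t\<in>S. A t \<mu> f))" by (rule linear_graded_op)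
  show "linear (\<lambda>s. \<Sum>t\<in>S. graded_op (A t) s)" by (intro linear_compose_sum ballI linear_graded_op assms)
  show "graded_op (\<lambda>\<mu> f. \<Sum>t\<in>S. A t \<mu> f) (single \<nu> g) = (\<Sum>t\<in>S. graded_op (A t) (single \<nu> g))" for \<nu> g
    by (simp add: graded_op_single lin assms linear_sum[OF linear_single])
qed

lemma polynomial_in_weight_graded_op:
  assumes "finite S" "\<And>t. linear (X t)"
  shows "polynomial_in_weight (graded_op (\<lambda>\<mu> f. \<Sum>t\<in>S. poly (p t) \<mu> *\<^sub>R X t f))"
  unfolding polynomial_in_weight_def
proof (intro exI allI)
  fix \<mu> f
  \<comment> \<open>The sum of the degrees is a common bound that also makes sense for an empty
    index set.\<close>
  let ?N = "\<Sum>t\<in>S. degree (p t)"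
  let ?A = "\<lambda>\<mu> f. \<Sum>t\<in>S. poly (p t) \<mu> *\<^sub>R X t f"
  have lin: "linear (?A \<mu>)"
    by (intro linear_compose_sum ballI linear_compose_scale_right assms)
  have "poly (p t) \<mu> = (\<Sum>j\<le>?N. coeff (p t) j * \<mu> ^ j)" if "t \<in> S" for t
    using assms(1) that by (intro poly_eq_sum member_le_sum[where f = "\<lambda>t. degree (p t)"]) auto
  then have "(\<Sum>t\<in>S. poly (p t) \<mu> *\<^sub>R X t f) = (\<Sum>t\<in>S. \<Sum>j\<le>?N. \<mu> ^ j *\<^sub>R (coeff (p t) j *\<^sub>R X t f))"
    by (intro sum.cong refl) (simp add: scaleR_sum_left mult.commute)
  also have "\<dots> = (\<Sum>j\<le>?N. \<mu> ^ j *\<^sub>R (\<Sum>t\<in>S. coeff (p t) j *\<^sub>R X t f))"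
    by (subst sum.swap) (simp add: scaleR_sum_right)
  finally show "restrict_weight \<mu> (graded_op (\<lambda>\<mu> f. \<Sum>t\<in>S. poly (p t) \<mu> *\<^sub>R X t f)) f
      = (\<Sum>j\<le>?N. \<mu> ^ j *\<^sub>R (\<Sum>t\<in>S. coeff (p t) j *\<^sub>R X t f))"
    by (subst restrict_weight_graded_op[of ?A, OF lin])
qed

lemma weight_zero_graded_op: "(\<And>\<mu>. linear (A \<mu>)) \<Longrightarrow> weight_zero (graded_op A)"
  unfolding weight_zero_def by (metis graded_op_single)

text \<open>In each term the weight polynomial costs at most \<open>i + r\<close>, while the
  operator left after dropping to degree \<open>n - i\<close> and taking \<open>r\<close>
  divergences has order at most \<open>n - i - r\<close>; together they stay within
  \<open>n\<close>.\<close>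

lemma matrix_lifting_in_diff_ops_hat:
  assumes a: "admissible_matrix n l a" and c: "(c :: 'd::finite sym) \<in> below (Suc n)"
  shows "graded_op (\<lambda>\<mu>. qop \<mu> (reweight a n l \<mu> c)) \<in> diff_ops_hat n"
proof -
  obtain p where p: "\<And>i r. i \<le> n \<Longrightarrow> degree (p i r) \<le> i + r"
    "\<And>\<mu> (c :: 'd sym) f. qop \<mu> (reweight a n l \<mu> c) f
      = (\<Sum>(i, r)\<in>(SIGMA i:{..n}. {..n - i}). poly (p i r) \<mu> *\<^sub>R normal_op ((divergence ^^ r) (part (n - i) c)) f)"
    using qop_reweight_expansion[OF a] by blast
  let ?S = "SIGMA i:{..n}. {..n - i}"
  define X where "X t = normal_op ((divergence ^^ snd t) (part (n - fst t) c))" for t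
  have X: "linear (X t)" for t unfolding X_def by (rule linear_normal_op)
  have eq: "(\<lambda>\<mu>. qop \<mu> (reweight a n l \<mu> c))
      = (\<lambda>\<mu> f. \<Sum>t\<in>?S. poly (p (fst t) (snd t)) \<mu> *\<^sub>R X t f)"
    by (simp add: fun_eq_iff p(2) X_def split_beta)
  have "graded_op (\<lambda>\<mu>. qop \<mu> (reweight a n l \<mu> c)) \<in> pencils"
    unfolding pencils_def mem_Collect_eq
  proof (intro conjI)
    show "polynomial_in_weight (graded_op (\<lambda>\<mu>. qop \<mu> (reweight a n l \<mu> c)))"
      unfolding eq by (rule polynomial_in_weight_graded_op) (simp_all add: X)
  qed (intro linear_graded_op weight_zero_graded_op linear_qop)+
  moreover have "order_le n (graded_op (\<lambda>\<mu>. qop \<mu> (reweight a n l \<mu> c)))"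
  proof -
    have "order_le n (graded_op (\<lambda>\<mu> f. poly (p (fst t) (snd t)) \<mu> *\<^sub>R X t f))" if "t \<in> ?S" for t
    proof -
      obtain i r where ir: "t = (i, r)" by (rule prod.exhaust)
      with that have t: "t = (i, r)" "i \<le> n" "r \<le> n - i" by simp_all
      have "(divergence ^^ r) (part (n - i) c) \<in> below (Suc (n - i - r))"
        using t(3) by (simp add: divergence_funpow_part part_below)
      then have "order_le (n - i - r) (graded_op (\<lambda>\<mu>. X t))"
        unfolding X_def t(1) fst_conv snd_conv by (rule order_le_graded_normal_op)
      from order_le_graded_poly[OF p(1)[OF t(2), of r] X this]
      have "order_le (i + r + (n - i - r)) (graded_op (\<lambda>\<mu> f. poly (p i r) \<mu> *\<^sub>R X t f))" .
      moreover have "i + r + (n - i - r) = n" using t by simp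
      ultimately show ?thesis by (simp only: t(1) fst_conv snd_conv)
    qed
    then show ?thesis
      unfolding eq graded_op_sum[OF linear_compose_scale_right[OF X]] by (rule order_le_sum)
  qed
  ultimately show ?thesis by (simp add: diff_ops_hat_def)
qed

lemma lieS_below: "c \<in> below n \<Longrightarrow> lieS K c \<in> below n"
proof -
  assume "c \<in> below n"
  then have "lieS K c = (\<Sum>k<n. part k (lieS K c))"
    using below_sum_part[of c n] by (metis (no_types, lifting) lieS_linear(5) part_lieS sum.cong)
  also have "\<dots> \<in> below n" by (intro subspace_sum subspace_below part_below) auto
  finally show ?thesis .
qed

lemma matrix_lifting_correct:
  fixes \<Phi> :: "('d::finite sfun \<Rightarrow> 'd sfun) \<Rightarrow> 'd density \<Rightarrow> 'd density"
  assumes a: "admissible_matrix n l a" and \<Phi>: "\<And>D. D \<in> diff_ops n \<Longrightarrow> \<Phi> D = matrix_lifting a n l D"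
  shows "pencil_lifting n l \<Phi>" "regular_lifting n \<Phi>" "equivariant_lifting proj n l \<Phi>"
proof -
  have D: "qop l c \<in> diff_ops n" if "c \<in> below (Suc n)" for c :: "'d sym"
    using that unfolding diff_ops_qop[of n l] by blast
  have Phi: "\<Phi> (qop l c) = graded_op (\<lambda>\<mu>. qop \<mu> (reweight a n l \<mu> c))" if "c \<in> below (Suc n)" for c
    using \<Phi>[OF D[OF that]] matrix_lifting_qop[OF that] by simp
  have hat: "\<Phi> (qop l c) \<in> diff_ops_hat n" if "c \<in> below (Suc n)" for c
    unfolding Phi[OF that] by (rule matrix_lifting_in_diff_ops_hat[OF a that])
  show "regular_lifting n \<Phi>"
    using hat unfolding regular_lifting_def diff_ops_qop[of n l] by blast
  show "equivariant_lifting proj n l \<Phi>"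
    unfolding equivariant_lifting_def
  proof (intro ballI)
    fix K :: "'d vfield" and E :: "'d sfun \<Rightarrow> 'd sfun"
    assume K: "K \<in> proj" and "E \<in> diff_ops n"
    then obtain c where c: "E = qop l c" "c \<in> below (Suc n)" unfolding diff_ops_qop[of n l] by blast
    show "ad_hat K (\<Phi> E) = \<Phi> (ad_op l K E)"
      unfolding c(1) ad_op_qop[OF K] Phi[OF c(2)] Phi[OF lieS_below[OF c(2)]]
      by (simp add: ad_hat_graded_op linear_qop ad_op_qop[OF K] reweight_lieS)
  qed
  show "pencil_lifting n l \<Phi>"
    unfolding pencil_lifting_def
  proof (intro conjI ballI allI)
    fix E :: "'d sfun \<Rightarrow> 'd sfun" assume "E \<in> diff_ops n"
    then obtain c where c: "E = qop l c" "c \<in> below (Suc n)" unfolding diff_ops_qop[of n l] by blast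
    show "\<Phi> E \<in> pencils" using hat[OF c(2)] c(1) by (simp add: diff_ops_hat_def)
    show "restrict_weight l (\<Phi> E) = E"
      unfolding c(1) Phi[OF c(2)] restrict_weight_graded_op[OF linear_qop] reweight_same[OF a c(2)] ..
  next
    fix E E' :: "'d sfun \<Rightarrow> 'd sfun" and u v assume "E \<in> diff_ops n" "E' \<in> diff_ops n"
    then obtain c c' where c: "E = qop l c" "c \<in> below (Suc n)" "E' = qop l c'" "c' \<in> below (Suc n)"
      unfolding diff_ops_qop[of n l] by blast
    have b: "u *\<^sub>R c + v *\<^sub>R c' \<in> below (Suc n)"
      using c by (intro subspace_add subspace_scale subspace_below) auto
    have "(\<lambda>f. u *\<^sub>R E f + v *\<^sub>R E' f) = qop l (u *\<^sub>R c + v *\<^sub>R c')"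
      by (simp add: c fun_eq_iff qop_linear)
    moreover have "graded_op (\<lambda>\<mu>. qop \<mu> (reweight a n l \<mu> (u *\<^sub>R c + v *\<^sub>R c'))) s
      = u *\<^sub>R graded_op (\<lambda>\<mu>. qop \<mu> (reweight a n l \<mu> c)) s
        + v *\<^sub>R graded_op (\<lambda>\<mu>. qop \<mu> (reweight a n l \<mu> c')) s" for s
      by (rule linear_eqI[where s = s])
        (simp_all add: linear_graded_op linear_qop linear_compose_add linear_compose_scale_right
          graded_op_single linear_add[OF linear_reweight] linear_scale[OF linear_reweight] qop_linear
          single_add scaleR_single)
    ultimately show "\<Phi> (\<lambda>f. u *\<^sub>R E f + v *\<^sub>R E' f) = (\<lambda>s. u *\<^sub>R \<Phi> E s + v *\<^sub>R \<Phi> E' s)"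
      using Phi[OF b] Phi[OF c(2)] Phi[OF c(4)] by (simp add: c(1,3) fun_eq_iff)
  qed
qed

section \<open>Classification\<close>

text \<open>By Hadamard's lemma \<open>f\<close> differs from its value at \<open>a\<close> by
  multiples of the centred coordinates. These pass through \<open>B\<close> and vanish at
  \<open>a\<close>, so only \<open>val f a\<close> is left.\<close>

lemma commuting_with_coordinates_is_multiplication:
  fixes B :: "'d::finite sfun \<Rightarrow> 'd sfun"
  assumes "linear B" and comm: "\<And>i f. B (coord i * f) = coord i * B f"
  shows "B f = f * B 1"
proof (rule sfun_eqI)
  fix a
  obtain g where g: "f = of_real (val f a) + (\<Sum>i\<in>UNIV. pos a i * g i)"
    using hadamard_sfun by blast
  have "B (pos a i * h) = pos a i * B h" for i h
    using comm[of i h]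
    by (simp add: pos_def left_diff_distrib linear_diff[OF assms(1)] linear_scale[OF assms(1)]
        flip: scaleR_conv_of_real)
  moreover have "B (of_real r) = of_real r * B 1" for r
    using linear_scale[OF assms(1), of r 1] by (simp add: scaleR_conv_of_real)
  ultimately have "B f = of_real (val f a) * B 1 + (\<Sum>i\<in>UNIV. pos a i * B (g i))"
    by (subst g) (simp add: linear_add[OF assms(1)] linear_sum[OF assms(1)])
  then show "val (B f) a = val (f * B 1) a" by (simp add: val_sum)
qed

lemma normal_op_dmom: "normal_op (dmom i c) f = normal_op c (coord i * f) - coord i * normal_op c f"
  by (simp add: normal_op_coord normal_op_linear)

text \<open>The Poincare lemma in the momenta: contract the closed form with the momentum and divide
  its degree \<open>k\<close> component by \<open>k + 1\<close>.\<close>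

lemma dmom_potential:
  fixes g :: "'d::finite \<Rightarrow> 'd sym"
  assumes below: "\<And>i. g i \<in> below n" and closed: "\<And>i j. dmom j (g i) = dmom i (g j)"
  shows "\<exists>c \<in> below (Suc n). \<forall>i. dmom i c = g i"
proof (intro bexI allI)
  let ?c = "\<Sum>k<n. (1 / real (Suc k)) *\<^sub>R (\<Sum>i\<in>UNIV. mom i * part k (g i))"
  show "?c \<in> below (Suc n)"
  proof (intro subspace_sum subspace_scale subspace_below)
    fix k i assume "k \<in> {..<n}"
    then have "part k (g i) \<in> below n" by (intro part_below) simp
    then show "mom i * part k (g i) \<in> below (Suc n)" by (rule mom_below)
  qed
  fix j
  have "dmom j (\<Sum>i\<in>UNIV. mom i * part k (g i)) = real (Suc k) *\<^sub>R part k (g j)" for k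
  proof -
    have d: "dmom j (part k (g i)) = dmom i (part k (g j))" for i
      using closed[of j i] by (cases k) (simp_all flip: part_dmom)
    have "dmom j (\<Sum>i\<in>UNIV. mom i * part k (g i))
      = (\<Sum>i\<in>UNIV. (if i = j then part k (g j) else 0) + mom i * dmom i (part k (g j)))"
      unfolding dmom_linear by (intro sum.cong refl) (simp add: d)
    also have "\<dots> = part k (g j) + real k *\<^sub>R part k (g j)"
      using euler_mom_part[of k "g j"] by (simp add: sum.distrib euler_mom_def)
    finally show ?thesis by (simp add: scaleR_add_left)
  qed
  then have "dmom j ?c = (\<Sum>k<n. part k (g j))"
    by (simp add: dmom_linear del: of_nat_Suc)
  then show "dmom j ?c = g j" using below_sum_part[OF below] by simp
qed

text \<open>Commutators with the coordinates have lower order, hence symbols by induction. A common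
  potential \<open>c\<close> of these symbols gives an operator with the same commutators, and the
  difference is a multiplication operator.\<close>

lemma order_le_imp_normal_op:
  fixes B :: "'d::finite sfun \<Rightarrow> 'd sfun"
  assumes "linear B" "order_le n B"
  shows "\<exists>c \<in> below (Suc n). B = normal_op c"
  using assms
proof (induction n arbitrary: B)
  case 0
  then obtain m where "B = (\<lambda>f. m * f)" by auto
  then have "B = normal_op (cst m)" by (simp add: fun_eq_iff)
  moreover have "cst m \<in> below (Suc 0)" by (auto simp: below_def cst_def lookup_single when_def)
  ultimately show ?case by blast
next
  case (Suc n)
  have lin: "linear (\<lambda>f. B (m * f) - m * B f)" for m
    by (intro linear_compose_sub linear_compose[OF linear_mult_left Suc.prems(1), unfolded o_def]
        linear_compose[OF Suc.prems(1) linear_mult_left, unfolded o_def])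
  have "\<exists>c \<in> below (Suc n). (\<lambda>f. B (coord i * f) - coord i * B f) = normal_op c" for i
    using Suc.IH[OF lin] Suc.prems(2) by simp
  then obtain g where g: "\<And>i. g i \<in> below (Suc n)"
    "\<And>i. (\<lambda>f. B (coord i * f) - coord i * B f) = normal_op (g i)" by metis
  have g2: "normal_op (g i) f = B (coord i * f) - coord i * B f" for i f
    using g(2)[of i] by (simp add: fun_eq_iff)
  \<comment> \<open>Closedness holds because multiplications by two coordinates commute, so iterated
    commutators with them do not depend on the order.\<close>
  have "dmom j (g i) = dmom i (g j)" for i j
    unfolding normal_op_inject[symmetric] fun_eq_iff
    by (simp add: normal_op_dmom g2 algebra_simps)
  then obtain c where c: "c \<in> below (Suc (Suc n))" "\<And>i. dmom i c = g i"
    using dmom_potential[of g "Suc n"] g(1) by blast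
  let ?E = "\<lambda>f. B f - normal_op c f"
  have E: "?E f = f * ?E 1" for f
  proof (rule commuting_with_coordinates_is_multiplication)
    show "linear ?E" by (intro linear_compose_sub linear_normal_op Suc.prems(1))
    show "?E (coord i * f) = coord i * ?E f" for i f
      using normal_op_dmom[of i c f] g2[of i f] c(2)[of i] by (simp add: algebra_simps)
  qed
  have "B = normal_op (c + cst (?E 1))"
  proof
    fix f
    show "B f = normal_op (c + cst (?E 1)) f"
      using E[of f] by (simp only: normal_op_linear normal_op_cst mult.commute) (simp add: algebra_simps)
  qed
  moreover have "cst (?E 1) \<in> below (Suc (Suc n))"
    by (auto simp: below_def cst_def lookup_single when_def)
  ultimately show ?case using c(1) subspace_add[OF subspace_below] by blast
qed

lemma lookup_mult_single:
  "lookup (M * single \<nu> f) (\<mu> + \<nu>) = lookup M \<mu> * f"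
  for M :: "real \<Rightarrow>\<^sub>0 'b::comm_ring_1"
  by (rule additive_eqI[where s = M])
    (simp_all add: distrib_right lookup_add mult_single lookup_single when_def)

text \<open>Multipliers of weight zero preserve the fibre of weight \<mu>, so testing with them
  alone bounds the order there.\<close>

lemma order_le_restrict_weight:
  assumes "order_le n L"
  shows "order_le n (restrict_weight \<mu> L)"
  using assms
proof (induction n arbitrary: L)
  case 0
  then obtain m where "L = (\<lambda>s. m * s)" by auto
  then have "restrict_weight \<mu> L = (\<lambda>f. lookup m 0 * f)"
    using lookup_mult_single[of m \<mu> _ 0] by (simp add: fun_eq_iff restrict_weight_def)
  then show ?case by auto
next
  case (Suc n)
  have "order_le n (restrict_weight \<mu> (\<lambda>s. L (single 0 m * s) - single 0 m * L s))" for m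
    using Suc by simp
  moreover have "lookup (single 0 m * x) \<mu> = m * lookup x \<mu>" for m and x :: "'a density"
    by (rule additive_eqI[where s = x])
      (simp_all add: distrib_left lookup_add mult_single lookup_single when_def)
  then have "restrict_weight \<mu> (\<lambda>s. L (single 0 m * s) - single 0 m * L s)
      = (\<lambda>f. restrict_weight \<mu> L (m * f) - m * restrict_weight \<mu> L f)" for m
    by (simp add: fun_eq_iff restrict_weight_def mult_single lookup_minus)
  ultimately show ?case by simp
qed

lemma restrict_weight_ad_hat:
  assumes "weight_zero L"
  shows "restrict_weight \<mu> (ad_hat K L) = ad_op \<mu> K (restrict_weight \<mu> L)"
  by (simp add: fun_eq_iff restrict_weight_def[of _ "ad_hat K L"] ad_hat_def lie_densities_def
      graded_op_single linear_lie_density weight_zero_single[OF assms] ad_op_def lookup_minus)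

section \<open>Degree in the weight from finite differences\<close>

lemma coeff_pcompose_shift:
  fixes p :: "real poly"
  assumes "degree p \<le> Suc N"
  shows "coeff (pcompose p [:1, 1:]) (Suc N) = coeff p (Suc N) \<and>
    coeff (pcompose p [:1, 1:]) N = coeff p N + real (Suc N) * coeff p (Suc N)"
  using assms
proof (induction p arbitrary: N)
  case 0
  then show ?case by simp
next
  case (pCons a p)
  have eq: "pcompose (pCons a p) [:1, 1:] = [:a:] + pcompose p [:1, 1:] + pCons 0 (pcompose p [:1, 1:])"
    by (simp add: pcompose_pCons)
  show ?case
  proof (cases N)
    case 0
    then have "degree p = 0" using pCons.prems by (cases "p = 0") auto
    then obtain b where "p = [:b:]" by (metis degree_eq_zeroE)
    then show ?thesis using 0 by (simp add: pcompose_pCons coeff_pCons)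
  next
    case (Suc M)
    then have "degree p \<le> Suc M" using pCons.prems by (cases "p = 0") auto
    then have IH: "coeff (pcompose p [:1, 1:]) (Suc M) = coeff p (Suc M)"
      "coeff (pcompose p [:1, 1:]) M = coeff p M + real (Suc M) * coeff p (Suc M)"
      using pCons.IH[OF \<open>degree p \<le> Suc M\<close>] by blast+
    have "coeff p (Suc (Suc M)) = 0" "coeff (pcompose p [:1, 1:]) (Suc (Suc M)) = 0"
      using \<open>degree p \<le> Suc M\<close> by (intro coeff_eq_0, simp add: degree_pcompose)+
    with IH show ?thesis unfolding eq Suc by (simp add: coeff_pCons algebra_simps)
  qed
qed

text \<open>For degree \<open>N + 1\<close>, the coefficient of the difference at \<open>N\<close>
  is \<open>N + 1\<close> times the leading coefficient, so a finite difference lowers a positive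
  degree by exactly one.\<close>

lemma degree_le_of_shift_difference:
  fixes p :: "real poly"
  assumes "degree (pcompose p [:1, 1:] - p) \<le> m"
  shows "degree p \<le> Suc m"
proof (rule ccontr)
  assume "\<not> degree p \<le> Suc m"
  then obtain N where N: "degree p = Suc N" "m < N" by (metis Suc_less_eq2 not_le)
  have "coeff (pcompose p [:1, 1:] - p) N = real (Suc N) * coeff p (Suc N)"
    using coeff_pcompose_shift[of p N] N(1) by simp
  moreover have "coeff p (Suc N) \<noteq> 0" using N(1) by (metis degree_0 leading_coeff_0_iff nat.distinct(1))
  moreover have "coeff (pcompose p [:1, 1:] - p) N = 0"
    using assms N(2) by (intro coeff_eq_0) linarith
  ultimately show False by simp
qed

text \<open>Commutators with \<open>single 1 1\<close>, of weight one, are finite differences in the weight.\<close>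

lemma degree_le_of_order_le:
  assumes "order_le m (graded_op (\<lambda>\<mu> f. poly p \<mu> *\<^sub>R f) :: 'd::finite density \<Rightarrow> 'd density)"
  shows "degree p \<le> m"
  using assms
proof (induction m arbitrary: p)
  case 0
  then obtain M where M: "graded_op (\<lambda>\<mu> f. poly p \<mu> *\<^sub>R f) = (\<lambda>s :: 'd density. M * s)" by auto
  \<comment> \<open>A multiplication that preserves weights acts on every fibre through the same
    weight-zero component of \<open>M\<close>, so \<open>p\<close> cannot vary with the
    weight.\<close>
  have "poly p \<mu> *\<^sub>R (1 :: 'd sfun) = lookup M 0" for \<mu>
  proof -
    have "single \<mu> (poly p \<mu> *\<^sub>R (1 :: 'd sfun)) = M * single \<mu> 1"
      using fun_cong[OF M, of "single \<mu> 1"] by (simp add: graded_op_single linear_scale_id)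
    then have "poly p \<mu> *\<^sub>R (1 :: 'd sfun) = lookup (M * single \<mu> 1) (0 + \<mu>)"
      by (metis add_0 lookup_single_eq)
    then show ?thesis unfolding lookup_mult_single by simp
  qed
  then have "poly p \<mu> *\<^sub>R (1 :: 'd sfun) = poly p 0 *\<^sub>R 1" for \<mu> by metis
  then have "poly p \<mu> = poly [:poly p 0:] \<mu>" for \<mu> by (simp only: scaleR_cancel_right) simp
  then have "p = [:poly p 0:]" by (simp add: poly_eq_poly_eq_iff[symmetric] fun_eq_iff)
  then show ?case by (metis degree_pCons_0 le_refl)
next
  case (Suc m)
  let ?L = "\<lambda>p. graded_op (\<lambda>\<mu> f. poly p \<mu> *\<^sub>R f) :: 'd density \<Rightarrow> 'd density"
  let ?q = "pcompose p [:1, 1:] - p"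
  have lin: "linear (?L p)" for p by (rule linear_graded_op[OF linear_scale_id])
  have single: "?L p (single \<nu> f) = single \<nu> (poly p \<nu> *\<^sub>R f)" for p \<nu> f
    by (simp only: graded_op_single linear_scale_id)
  have eq: "?L p (single 1 1 * s) - single 1 1 * ?L p s = single 1 1 * ?L ?q s" for s
  proof (rule linear_eqI[where s = s])
    show "linear (\<lambda>s. ?L p (single 1 1 * s) - single 1 1 * ?L p s)"
      by (intro linear_compose_sub linear_compose[OF linear_mult_left lin, unfolded o_def]
          linear_compose[OF lin linear_mult_left, unfolded o_def])
    show "linear (\<lambda>s. single 1 1 * ?L ?q s)"
      by (rule linear_compose[OF lin linear_mult_left, unfolded o_def])
    show "?L p (single 1 1 * single k v) - single 1 1 * ?L p (single k v) = single 1 1 * ?L ?q (single k v)" for k v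
      unfolding mult_single single
      by (simp add: mult_single single_diff[symmetric] poly_pcompose scaleR_diff_left)
  qed
  have "order_le m (\<lambda>s. ?L p (single 1 1 * s) - single 1 1 * ?L p s)"
    using Suc.prems unfolding order_le.simps(2) by blast
  then have "order_le m (\<lambda>s. single 1 1 * ?L ?q s)" unfolding eq .
  \<comment> \<open>The density \<open>single (-1) 1\<close> is inverse to
    \<open>single 1 1\<close>, so it strips the factor left by the commutator without raising the
    order.\<close>
  from order_le_left_mult[OF this, of "single (-1) 1"]
  have "order_le m (?L ?q)"
    by (simp add: mult.assoc[symmetric] mult_single flip: one_poly_mapping_def)
  then show ?case by (intro degree_le_of_shift_difference Suc.IH)
qed

section \<open>Test operators and test functions\<close>

lemma mpartial_replicate_coord:
  "mpartial (replicate_mset (Suc k) i) (coord i * f)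
    = coord i * mpartial (replicate_mset (Suc k) i) f + real (Suc k) *\<^sub>R mpartial (replicate_mset k i) f"
  using normal_op_coord[of "single (replicate_mset (Suc k) i) 1" i f]
  by (simp add: normal_op_linear normal_op_single dmom_single scaleR_conv_of_real)

text \<open>Every commutator with the coordinate removes one derivative together with one unit of
  order. After \<open>k\<close> of them only the dependence on the weight remains, with what is left
  of the order bound.\<close>

lemma order_le_strip_derivatives:
  fixes i :: "'d::finite"
  assumes "order_le (m + k) (graded_op (\<lambda>\<mu> f. p \<mu> *\<^sub>R mpartial (replicate_mset k i) f))"
  shows "order_le m (graded_op (\<lambda>\<mu> f. (fact k * p \<mu>) *\<^sub>R f) :: 'd density \<Rightarrow> 'd density)"
  using assms
proof (induction k arbitrary: p)
  case (Suc k)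
  let ?L = "\<lambda>k p. graded_op (\<lambda>\<mu> f. p \<mu> *\<^sub>R mpartial (replicate_mset k i) f)"
  have lin1: "linear (\<lambda>f. p \<mu> *\<^sub>R mpartial (replicate_mset k i) f)" for p :: "real \<Rightarrow> real" and \<mu> k
    by (intro linear_compose_scale_right linear_mpartial)
  have lin: "linear (?L k p)" for k p by (rule linear_graded_op[OF lin1])
  have single: "?L k p (single \<nu> f) = single \<nu> (p \<nu> *\<^sub>R mpartial (replicate_mset k i) f)" for k p \<nu> f
    by (simp add: graded_op_single lin1)
  have "?L (Suc k) p (single 0 (coord i) * s) - single 0 (coord i) * ?L (Suc k) p s
      = ?L k (\<lambda>\<mu>. real (Suc k) * p \<mu>) s" for s
  proof (rule linear_eqI[where s = s])
    show "linear (\<lambda>s. ?L (Suc k) p (single 0 (coord i) * s) - single 0 (coord i) * ?L (Suc k) p s)"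
      by (intro linear_compose_sub linear_compose[OF linear_mult_left lin, unfolded o_def]
          linear_compose[OF lin linear_mult_left, unfolded o_def])
    show "?L (Suc k) p (single 0 (coord i) * single \<nu> v) - single 0 (coord i) * ?L (Suc k) p (single \<nu> v)
      = ?L k (\<lambda>\<mu>. real (Suc k) * p \<mu>) (single \<nu> v)" for \<nu> v
      unfolding mult_single single mpartial_replicate_coord
      by (simp add: mult_single single_diff[symmetric] scaleR_add_right mult.commute del: of_nat_Suc)
  qed (rule lin)
  moreover have "order_le (m + k) (\<lambda>s. ?L (Suc k) p (single 0 (coord i) * s) - single 0 (coord i) * ?L (Suc k) p s)"
    using Suc.prems by simp
  ultimately have "order_le (m + k) (?L k (\<lambda>\<mu>. real (Suc k) * p \<mu>))" by simp
  from Suc.IH[OF this] show ?case by (simp add: algebra_simps)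
qed simp

lemma mpartial_power: "mpartial (replicate_mset k i) (coord i ^ k) = of_nat (fact k)"
proof (induction k)
  case (Suc k)
  have "partial i (coord i ^ Suc k) = real (Suc k) *\<^sub>R coord i ^ k" for k
  proof (induction k)
    case 0
    then show ?case by (simp add: partial_coord)
  next
    case (Suc k)
    have "partial i (coord i ^ Suc (Suc k)) = coord i * partial i (coord i ^ Suc k) + coord i ^ Suc k"
      unfolding power_Suc[of _ "Suc k"] by (simp add: partial_mult partial_coord)
    then show ?case
      unfolding Suc
      by (simp only: mult_scaleR_right power_Suc of_nat_Suc scaleR_add_left scaleR_one add_ac distrib_left)
  qed
  then have "mpartial (replicate_mset (Suc k) i) (coord i ^ Suc k) = real (Suc k) *\<^sub>R of_nat (fact k)"
    by (simp only: replicate_mset_Suc mpartial_add_mset linear_scale[OF linear_mpartial] Suc)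
  then show ?case by (simp add: scaleR_conv_of_real distrib_right)
qed simp

lemma divergence_monomial: "(divergence ^^ Suc r) (single \<alpha> 1) = 0"
proof -
  have "divergence (single \<alpha> 1) = 0"
    by (simp add: divergence_def dmom_single dpos_single)
      (simp add: partial_of_real[of _ "of_nat _", simplified])
  then show ?thesis by (simp only: funpow_Suc_right o_apply divergence_funpow_linear)
qed

text \<open>A monomial with constant coefficient has no divergence, so its quantisation is the plain
  derivative at every weight: a test operator in which the only dependence on the weight is the one
  introduced by the lifting.\<close>

lemma qop_monomial: "qop \<mu> (single (replicate_mset k i) 1) = mpartial (replicate_mset k i)"
proof -
  let ?v = "single (replicate_mset k i) 1 :: 'a sym"
  have v: "part k ?v = ?v" by (simp add: part_single)
  have "qmap \<mu> ?v = ?v"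
    using qmap_part[of \<mu> k ?v]
    unfolding lessThan_Suc_atMost[symmetric] sum.lessThan_Suc_shift v divergence_monomial by simp
  then show ?thesis by (simp add: v qop_def fun_eq_iff normal_op_single)
qed

lemma row_poly_coeff:
  fixes \<mu> :: real
  assumes "degree p \<le> i" "i \<le> n"
  shows "(\<Sum>j\<le>n. coeff p j * \<mu> ^ j) = poly p \<mu>"
  using poly_eq_sum[of p n \<mu>] assms by simp

section \<open>Classification weight by weight\<close>

locale regular_equivariant_lifting =
  fixes n :: nat and l :: real and \<Phi> :: "('d::finite sfun \<Rightarrow> 'd sfun) \<Rightarrow> 'd density \<Rightarrow> 'd density"
  assumes pencil: "pencil_lifting n l \<Phi>" and regular: "regular_lifting n \<Phi>"
    and equivariant: "equivariant_lifting proj n l \<Phi>"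
begin

definition fibre_op :: "real \<Rightarrow> 'd sym \<Rightarrow> 'd sfun \<Rightarrow> 'd sfun" where
  "fibre_op \<mu> c = restrict_weight \<mu> (\<Phi> (qop l c))"

lemma qop_in_diff_ops: "c \<in> below (Suc n) \<Longrightarrow> qop l c \<in> diff_ops n"
  unfolding diff_ops_qop[of n l] by blast

lemma lifting_facts:
  assumes "c \<in> below (Suc n)"
  shows "linear (\<Phi> (qop l c))" "weight_zero (\<Phi> (qop l c))" "polynomial_in_weight (\<Phi> (qop l c))"
    "order_le n (\<Phi> (qop l c))" "fibre_op l c = qop l c"
  using pencil regular qop_in_diff_ops[OF assms]
  by (auto simp: pencil_lifting_def regular_lifting_def diff_ops_hat_def pencils_def fibre_op_def)

lemma lifting_eq: "c \<in> below (Suc n) \<Longrightarrow> \<Phi> (qop l c) = graded_op (\<lambda>\<mu>. fibre_op \<mu> c)"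
  unfolding fibre_op_def by (intro weight_zero_eq_graded_op lifting_facts)

lemma fibre_op_linear:
  assumes "c \<in> below (Suc n)" "c' \<in> below (Suc n)"
  shows "fibre_op \<mu> (a *\<^sub>R c + b *\<^sub>R c') f = a *\<^sub>R fibre_op \<mu> c f + b *\<^sub>R fibre_op \<mu> c' f"
proof -
  have "\<Phi> (\<lambda>f. a *\<^sub>R qop l c f + b *\<^sub>R qop l c' f) = (\<lambda>s. a *\<^sub>R \<Phi> (qop l c) s + b *\<^sub>R \<Phi> (qop l c') s)"
    using pencil qop_in_diff_ops assms unfolding pencil_lifting_def by blast
  moreover have "(\<lambda>f. a *\<^sub>R qop l c f + b *\<^sub>R qop l c' f) = qop l (a *\<^sub>R c + b *\<^sub>R c')"
    by (simp add: fun_eq_iff qop_linear)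
  ultimately show ?thesis
    by (simp add: fibre_op_def restrict_weight_def lookup_add lookup_scaleR)
qed

lemma fibre_op_lieS:
  assumes "c \<in> below (Suc n)" "K \<in> proj"
  shows "fibre_op \<mu> (lieS K c) = ad_op \<mu> K (fibre_op \<mu> c)"
proof -
  have "ad_hat K (\<Phi> (qop l c)) = \<Phi> (ad_op l K (qop l c))"
    using equivariant qop_in_diff_ops assms unfolding equivariant_lifting_def by blast
  then show ?thesis
    using restrict_weight_ad_hat[OF lifting_facts(2)[OF assms(1)], of \<mu> K] by (simp add: fibre_op_def ad_op_qop[OF assms(2)])
qed

text \<open>Regularity bounds the algebraic order on the whole algebra, hence on each fibre, where
  it makes the operator differential and so the quantisation of a symbol.\<close>

lemma fibre_op_in_qop:
  assumes "c \<in> below (Suc n)"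
  shows "\<exists>e \<in> below (Suc n). fibre_op \<mu> c = qop \<mu> e"
proof -
  have "\<exists>e \<in> below (Suc n). fibre_op \<mu> c = normal_op e"
    unfolding fibre_op_def
    by (intro order_le_imp_normal_op linear_restrict_weight order_le_restrict_weight lifting_facts assms)
  then have "fibre_op \<mu> c \<in> diff_ops n" unfolding diff_ops_eq by blast
  then show ?thesis unfolding diff_ops_qop[of n \<mu>] by blast
qed

text \<open>\<open>T\<close> compares symbols at the weights \<open>l\<close> and \<mu>. Both
  quantisations and the lifting are equivariant, so the components of \<open>T\<close> are
  intertwiners: zero between distinct degrees, a scalar on the diagonal.\<close>

lemma fibre_op_part_scalar:
  assumes "k \<le> n"
  shows "\<exists>r. \<forall>c. fibre_op \<mu> (part k c) = qop \<mu> (r *\<^sub>R part k c)"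
proof -
  have pk: "part k c \<in> below (Suc n)" for c using assms by (intro part_below) simp
  \<comment> \<open>Projecting to degree \<open>k\<close> first makes \<open>T\<close> a linear map
    on all symbols, although the lifting is controlled only on operators of order at most
    \<open>n\<close>.\<close>
  define T where "T c = inv (qop \<mu>) (fibre_op \<mu> (part k c))" for c
  have T: "qop \<mu> (T c) = fibre_op \<mu> (part k c)" "T c \<in> below (Suc n)" for c
  proof -
    obtain e where e: "e \<in> below (Suc n)" "fibre_op \<mu> (part k c) = qop \<mu> e" using fibre_op_in_qop[OF pk] by blast
    then have "T c = e" unfolding T_def by (simp add: inv_f_f inj_def qop_inject)
    with e show "qop \<mu> (T c) = fibre_op \<mu> (part k c)" "T c \<in> below (Suc n)" by auto
  qed
  have lin: "T (a *\<^sub>R c + b *\<^sub>R c') = a *\<^sub>R T c + b *\<^sub>R T c'" for a b c c'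
  proof -
    have "qop \<mu> (T (a *\<^sub>R c + b *\<^sub>R c')) = qop \<mu> (a *\<^sub>R T c + b *\<^sub>R T c')"
      unfolding T(1) part_linear fun_eq_iff fibre_op_linear[OF pk pk] by (simp add: qop_linear T(1))
    then show ?thesis by (simp add: qop_inject)
  qed
  have linT: "linear T"
    using lin[of 1 _ 1] lin[of _ _ 0] by (intro linearI) simp_all
  have lieT: "T (lieS K c) = lieS K (T c)" if "K \<in> proj" for K c
  proof -
    have "qop \<mu> (T (lieS K c)) = qop \<mu> (lieS K (T c))"
      by (simp only: T(1) part_lieS fibre_op_lieS[OF pk that] flip: ad_op_qop[OF that])
    then show ?thesis by (simp add: qop_inject)
  qed
  have tw: "intertwiner (\<lambda>c. part j (T c)) k j" for j
    by (rule intertwiner.intro)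
      (use linear_compose[OF linT linear_part] in \<open>simp_all add: o_def lieT part_lieS\<close>)
  obtain r where r: "\<And>c. part k (T (part k c)) = r *\<^sub>R part k c"
    using intertwiner.scalar[OF tw] by metis
  have "part j (T (part k c)) = 0" if "j \<noteq> k" for j c
    using intertwiner.eq_0[OF tw that] .
  then have "part j (T (part k c)) = (if j = k then r *\<^sub>R part k c else 0)" for j c
    using r by simp
  then have "T (part k c) = r *\<^sub>R part k c" for c
    using below_sum_part[OF T(2), of "part k c"] assms by simp
  then show ?thesis using T(1)[of "part k _"] by (metis part_part_same)
qed

definition weight_factor :: "nat \<Rightarrow> real \<Rightarrow> real" where
  "weight_factor k \<mu> = (SOME r. \<forall>c. fibre_op \<mu> (part k c) = qop \<mu> (r *\<^sub>R part k c))"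

lemma fibre_op_part: "k \<le> n \<Longrightarrow> fibre_op \<mu> (part k c) = qop \<mu> (weight_factor k \<mu> *\<^sub>R part k c)"
  unfolding weight_factor_def using someI_ex[OF fibre_op_part_scalar] by blast

lemma fibre_op_monomial:
  assumes "k \<le> n"
  shows "fibre_op \<mu> (single (replicate_mset k i) 1) = (\<lambda>f. weight_factor k \<mu> *\<^sub>R mpartial (replicate_mset k i) f)"
proof -
  have "part k (single (replicate_mset k i) 1 :: 'd sym) = single (replicate_mset k i) 1"
    by (simp add: part_single)
  then show ?thesis
    using fibre_op_part[OF assms, of \<mu> "single (replicate_mset k i) 1"]
    by (simp add: fun_eq_iff qop_linear qop_monomial)
qed

lemma monomial_below: "k \<le> n \<Longrightarrow> single (replicate_mset k i) 1 \<in> (below (Suc n) :: 'd sym set)"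
  by (auto simp: below_def lookup_single when_def)

text \<open>The lifting passes through the given operator at weight \<open>l\<close>. Applied to the
  \<open>k\<close>-th power of a coordinate, whose \<open>k\<close>-fold derivative is the nonzero
  constant \<open>fact k\<close>, this becomes an equation between numbers.\<close>

lemma weight_factor_l:
  assumes "k \<le> n"
  shows "weight_factor k l = 1"
proof -
  fix i :: 'd
  have "fibre_op l (single (replicate_mset k i) 1) (coord i ^ k) = qop l (single (replicate_mset k i) 1) (coord i ^ k)"
    using lifting_facts(5)[OF monomial_below[OF assms]] by simp
  then have "weight_factor k l *\<^sub>R of_nat (fact k) = (of_nat (fact k) :: 'd sfun)"
    by (simp only: fibre_op_monomial[OF assms] qop_monomial mpartial_power)
  then have "val (weight_factor k l *\<^sub>R of_nat (fact k) :: 'd sfun) 0 = val (of_nat (fact k) :: 'd sfun) 0"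
    by (simp only:)
  then show ?thesis by (simp only: val_simps val_of_nat) simp
qed

text \<open>Evaluating the pencil of the test operator on the \<open>k\<close>-th power of a
  coordinate, at the origin, exhibits the factor as a polynomial. Its \<open>k\<close> derivatives
  use up \<open>k\<close> of the order \<open>n\<close>, so \<open>n - k\<close> bounds the
  degree.\<close>

lemma weight_factor_poly:
  assumes "k \<le> n"
  shows "\<exists>p. degree p \<le> n - k \<and> (\<forall>\<mu>. weight_factor k \<mu> = poly p \<mu>)"
proof -
  fix i :: 'd
  let ?v = "single (replicate_mset k i) 1 :: 'd sym"
  have v: "?v \<in> below (Suc n)" by (rule monomial_below[OF assms])
  obtain N B where B: "\<And>\<mu> f. fibre_op \<mu> ?v f = (\<Sum>j\<le>N. \<mu> ^ j *\<^sub>R B j f)"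
    using lifting_facts(3)[OF v] unfolding polynomial_in_weight_def fibre_op_def by blast
  define p where "p = (\<Sum>j\<le>N. monom (val (B j (coord i ^ k)) 0 / fact k) j)"
  have p: "weight_factor k \<mu> = poly p \<mu>" for \<mu>
  proof -
    have "val (weight_factor k \<mu> *\<^sub>R of_nat (fact k) :: 'd sfun) 0 = val (\<Sum>j\<le>N. \<mu> ^ j *\<^sub>R B j (coord i ^ k)) 0"
      using B[of \<mu> "coord i ^ k"] by (simp only: fibre_op_monomial[OF assms] mpartial_power)
    then have "weight_factor k \<mu> * real (fact k) = (\<Sum>j\<le>N. \<mu> ^ j * val (B j (coord i ^ k)) 0)"
      by (simp only: val_simps val_of_nat val_sum)
    then have "weight_factor k \<mu> = (\<Sum>j\<le>N. \<mu> ^ j * val (B j (coord i ^ k)) 0) / fact k"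
      by (simp add: nonzero_eq_divide_eq)
    then show ?thesis by (simp add: p_def poly_sum poly_monom sum_divide_distrib mult.commute)
  qed
  have "order_le (n - k + k) (graded_op (\<lambda>\<mu> f. weight_factor k \<mu> *\<^sub>R mpartial (replicate_mset k i) f))"
    using lifting_facts(4)[OF v] assms by (simp only: lifting_eq[OF v] fibre_op_monomial[OF assms] le_add_diff_inverse2)
  from order_le_strip_derivatives[OF this]
  have "order_le (n - k) (graded_op (\<lambda>\<mu> f. poly (smult (fact k) p) \<mu> *\<^sub>R f) :: 'd density \<Rightarrow> 'd density)"
    by (simp only: p poly_smult)
  then have "degree (smult (fact k) p) \<le> n - k" by (rule degree_le_of_order_le)
  then show ?thesis using p by auto
qed

lemma fibre_op_sum_part: "c \<in> below (Suc n) \<Longrightarrow> fibre_op \<mu> c f = (\<Sum>i\<le>n. fibre_op \<mu> (part (n - i) c) f)"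
proof -
  assume c: "c \<in> below (Suc n)"
  have "fibre_op \<mu> (\<Sum>i\<in>S. part (n - i) c) f = (\<Sum>i\<in>S. fibre_op \<mu> (part (n - i) c) f)" if "finite S" for S
    using that
  proof (induction S)
    case empty
    show ?case using fibre_op_linear[OF c c, of \<mu> 0 0 f] by simp
  next
    case (insert i S)
    have "(\<Sum>i\<in>S. part (n - i) c) \<in> below (Suc n)" "part (n - i) c \<in> below (Suc n)"
      by (intro subspace_sum subspace_below part_below, simp)+
    from fibre_op_linear[OF this(2,1), of \<mu> 1 1 f] insert show ?case by simp
  qed
  from this[of "{..n}"] show ?thesis by (simp add: sum_part_reverse[OF c])
qed

lemma eq_matrix_lifting:
  "\<exists>a. admissible_matrix n l a \<and> (\<forall>D \<in> diff_ops n. \<Phi> D = matrix_lifting a n l D)"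
proof -
  have "\<forall>i. \<exists>p. i \<le> n \<longrightarrow> degree p \<le> i \<and> (\<forall>\<mu>. weight_factor (n - i) \<mu> = poly p \<mu>)"
    using weight_factor_poly[of "n - _"] by (metis diff_diff_cancel diff_le_self)
  then obtain p where p: "\<And>i. i \<le> n \<Longrightarrow> degree (p i) \<le> i"
    "\<And>i \<mu>. i \<le> n \<Longrightarrow> weight_factor (n - i) \<mu> = poly (p i) \<mu>" by metis
  \<comment> \<open>Row \<open>i\<close> belongs to the component of degree \<open>n - i\<close>.
    Each row polynomial takes the value 1 at \<open>l\<close>, which picks one representative among
    proportional rows.\<close>
  define a where "a i j = coeff (p i) j" for i j
  have row: "row_poly a n i \<mu> = weight_factor (n - i) \<mu>" if "i \<le> n" for i \<mu>
    unfolding row_poly_def a_def p(2)[OF that] using row_poly_coeff[OF p(1)[OF that] that] .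
  have row_l: "row_poly a n i l = 1" if "i \<le> n" for i
    using row[OF that] weight_factor_l[of "n - i"] by simp
  have adm: "admissible_matrix n l a"
    unfolding admissible_matrix_def
  proof (intro conjI allI impI)
    show "a i j = 0" if "i \<le> n" "i < j" for i j
      unfolding a_def using p(1)[OF that(1)] that(2) by (intro coeff_eq_0) simp
    show "\<exists>j\<le>n. a i j \<noteq> 0" if "i \<le> n" for i
    proof (rule ccontr)
      assume "\<not> (\<exists>j\<le>n. a i j \<noteq> 0)"
      then have "row_poly a n i l = 0" by (simp add: row_poly_def)
      then show False using row_l[OF that] by simp
    qed
    show "row_poly a n i l \<noteq> 0" if "i \<le> n" for i using row_l[OF that] by simp
  qed
  have "\<Phi> D = matrix_lifting a n l D" if "D \<in> diff_ops n" for D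
  proof -
    obtain c where c: "D = qop l c" "c \<in> below (Suc n)"
      using \<open>D \<in> diff_ops n\<close> unfolding diff_ops_qop[of n l] by blast
    have "fibre_op \<mu> c = qop \<mu> (reweight a n l \<mu> c)" for \<mu>
      by (rule ext) (simp add: fibre_op_sum_part[OF c(2)] fibre_op_part reweight_def qop_linear row weight_factor_l)
    then show ?thesis unfolding c(1) lifting_eq[OF c(2)] matrix_lifting_qop[OF c(2)] by simp
  qed
  with adm show ?thesis by blast
qed

end

text \<open>All three properties of a lifting constrain \<Phi> only on operators of order at most
  \<open>n\<close>, whence agreement with a matrix lifting is asked on
  \<open>diff_ops n\<close>.\<close>

theorem proposition3:
  fixes n :: nat and l :: real
    and \<Phi> :: "('d::finite sfun \<Rightarrow> 'd sfun) \<Rightarrow> ('d density \<Rightarrow> 'd density)"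
  shows "(pencil_lifting n l \<Phi> \<and> regular_lifting n \<Phi> \<and> equivariant_lifting proj n l \<Phi>) \<longleftrightarrow>
    (\<exists>a. admissible_matrix n l a \<and> (\<forall>D \<in> diff_ops n. \<Phi> D = matrix_lifting a n l D))"
proof
  assume "pencil_lifting n l \<Phi> \<and> regular_lifting n \<Phi> \<and> equivariant_lifting proj n l \<Phi>"
  then interpret regular_equivariant_lifting n l \<Phi> by unfold_locales auto
  show "\<exists>a. admissible_matrix n l a \<and> (\<forall>D \<in> diff_ops n. \<Phi> D = matrix_lifting a n l D)"
    by (rule eq_matrix_lifting)
next
  assume "\<exists>a. admissible_matrix n l a \<and> (\<forall>D \<in> diff_ops n. \<Phi> D = matrix_lifting a n l D)"
  then show "pencil_lifting n l \<Phi> \<and> regular_lifting n \<Phi> \<and> equivariant_lifting proj n l \<Phi>"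
    using matrix_lifting_correct by blast
qed

end
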